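(* Let $\theta,\gamma\in\mathbf{R}$, let $d\in\mathbf{Z}\setminus\{0\}$, and let $f\colon S^1\to\mathbf{R}$ be a continuous function. Let $r\in\mathbf{R}$, and set $g(\zeta)=f\left(e^{2\pi i r/d}\zeta\right)+r$ for $\zeta\in S^1$. Then the automorphism $\beta$ of $A_\theta$ determined by $\beta(u)=\exp(2\pi i r/d)u$ and $\beta(v)=v$ satisfies $$\beta\circ\alpha_{\theta,\gamma,d,f}\circ\beta^{-1}=\alpha_{\theta,\gamma,d,g}.$$ Moreover, the crossed products $C^*(\mathbf{Z},A_\theta,\alpha_{\theta,\gamma,d,f})$ and $C^*(\mathbf{Z},A_\theta,\alpha_{\theta,\gamma,d,g})$ are isomorphic.
   Context: For $\theta \in \mathbf{R}$, $A_\theta$ denotes the rotation algebra, the universal C*-algebra generated by unitaries $u$ and $v$ satisfying $vu = e^{2\pi i\theta}uv$. For $\theta,\gamma\in\mathbf{R}$, $d\in\mathbf{Z}$ and $f\colon S^1\to\mathbf{R}$ continuous, $\alpha_{\theta,\gamma,d,f}$ is the (unique) automorphism of $A_\theta$ such that $\alpha_{\theta,\gamma,d,f}(u) = e^{2\pi i\gamma}u$ and $\alpha_{\theta,\gamma,d,f}(v) = \exp(2\pi i f(u))u^d v$. $C^*(\mathbf{Z},A,\alpha)$ denotes the crossed product of $A$ by the action of $\mathbf{Z}$ generated by $\alpha$. *)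

theory Defs
  imports "HOL-Analysis.Analysis" "HOL-Algebra.Module" "HOL-Algebra.Bij"
begin

section \<open>Unital C*-algebras\<close>

definition complex_field :: "complex ring" where
  "complex_field = \<lparr>carrier = UNIV, mult = (*), one = 1, zero = 0, add = (+)\<rparr>"

record 'a cstar = "(complex, 'a) module" +
  star :: "'a \<Rightarrow> 'a"
  nrm :: "'a \<Rightarrow> real"

text \<open>All C*-algebras below are unital; the zero algebra (with $1 = 0$) is allowed.\<close>

locale cstar_algebra = module complex_field A + ring A
  for A :: "'a cstar" (structure) +
  assumes smult_mult_left:
      "\<lbrakk>x \<in> carrier A; y \<in> carrier A\<rbrakk> \<Longrightarrow> (c \<odot> x) \<otimes> y = c \<odot> (x \<otimes> y)"
    and smult_mult_right:
      "\<lbrakk>x \<in> carrier A; y \<in> carrier A\<rbrakk> \<Longrightarrow> x \<otimes> (c \<odot> y) = c \<odot> (x \<otimes> y)"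
    and star_closed: "x \<in> carrier A \<Longrightarrow> star A x \<in> carrier A"
    and star_star: "x \<in> carrier A \<Longrightarrow> star A (star A x) = x"
    and star_add:
      "\<lbrakk>x \<in> carrier A; y \<in> carrier A\<rbrakk> \<Longrightarrow> star A (x \<oplus> y) = star A x \<oplus> star A y"
    and star_smult: "x \<in> carrier A \<Longrightarrow> star A (c \<odot> x) = cnj c \<odot> star A x"
    and star_mult:
      "\<lbrakk>x \<in> carrier A; y \<in> carrier A\<rbrakk> \<Longrightarrow> star A (x \<otimes> y) = star A y \<otimes> star A x"
    and nrm_nonneg: "x \<in> carrier A \<Longrightarrow> 0 \<le> nrm A x"
    and nrm_eq_zero_iff: "x \<in> carrier A \<Longrightarrow> nrm A x = 0 \<longleftrightarrow> x = \<zero>"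
    and nrm_triangle:
      "\<lbrakk>x \<in> carrier A; y \<in> carrier A\<rbrakk> \<Longrightarrow> nrm A (x \<oplus> y) \<le> nrm A x + nrm A y"
    and nrm_smult: "x \<in> carrier A \<Longrightarrow> nrm A (c \<odot> x) = cmod c * nrm A x"
    and nrm_mult:
      "\<lbrakk>x \<in> carrier A; y \<in> carrier A\<rbrakk> \<Longrightarrow> nrm A (x \<otimes> y) \<le> nrm A x * nrm A y"
    and nrm_star_mult: "x \<in> carrier A \<Longrightarrow> nrm A (star A x \<otimes> x) = (nrm A x)\<^sup>2"
    and nrm_complete:
      "\<lbrakk>\<And>n. s n \<in> carrier A;
        \<And>e. 0 < e \<Longrightarrow> \<exists>N. \<forall>m\<ge>N. \<forall>n\<ge>N. nrm A (s m \<ominus> s n) < e\<rbrakk>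
       \<Longrightarrow> \<exists>x\<in>carrier A. (\<lambda>n::nat. nrm A (s n \<ominus> x)) \<longlonglongrightarrow> 0"

definition unitary :: "'a cstar \<Rightarrow> 'a \<Rightarrow> bool" where
  "unitary A x \<longleftrightarrow> x \<in> carrier A \<and>
     star A x \<otimes>\<^bsub>A\<^esub> x = \<one>\<^bsub>A\<^esub> \<and> x \<otimes>\<^bsub>A\<^esub> star A x = \<one>\<^bsub>A\<^esub>"

definition cstar_subalgebra :: "'a set \<Rightarrow> 'a cstar \<Rightarrow> bool" where
  "cstar_subalgebra S A \<longleftrightarrow> S \<subseteq> carrier A \<and> \<one>\<^bsub>A\<^esub> \<in> S \<and>
     (\<forall>x\<in>S. \<forall>y\<in>S. x \<oplus>\<^bsub>A\<^esub> y \<in> S \<and> x \<otimes>\<^bsub>A\<^esub> y \<in> S) \<and>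
     (\<forall>c. \<forall>x\<in>S. c \<odot>\<^bsub>A\<^esub> x \<in> S) \<and>
     (\<forall>x\<in>S. star A x \<in> S) \<and>
     (\<forall>s x. (\<forall>n::nat. s n \<in> S) \<and> x \<in> carrier A \<and>
        (\<lambda>n. nrm A (s n \<ominus>\<^bsub>A\<^esub> x)) \<longlonglongrightarrow> 0 \<longrightarrow> x \<in> S)"

definition generates :: "'a cstar \<Rightarrow> 'a set \<Rightarrow> bool" where
  "generates A G \<longleftrightarrow> G \<subseteq> carrier A \<and>
     (\<forall>S. cstar_subalgebra S A \<and> G \<subseteq> S \<longrightarrow> S = carrier A)"

text \<open>Unital *-homomorphisms (\<^const>\<open>ring_hom\<close> includes preservation of the unit).\<close>

definition star_hom :: "'a cstar \<Rightarrow> 'b cstar \<Rightarrow> ('a \<Rightarrow> 'b) set" where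
  "star_hom A B = {\<phi> \<in> ring_hom A B. \<forall>x\<in>carrier A.
     (\<forall>c. \<phi> (c \<odot>\<^bsub>A\<^esub> x) = c \<odot>\<^bsub>B\<^esub> \<phi> x) \<and> \<phi> (star A x) = star B (\<phi> x)}"

definition star_isomorphic :: "'a cstar \<Rightarrow> 'b cstar \<Rightarrow> bool" where
  "star_isomorphic A B \<longleftrightarrow> (\<exists>\<phi>\<in>star_hom A B. bij_betw \<phi> (carrier A) (carrier B))"

text \<open>As for \<^const>\<open>auto\<close>, automorphisms are extensional on the carrier, so that they are
  determined by their values there.\<close>

definition star_auto :: "'a cstar \<Rightarrow> ('a \<Rightarrow> 'a) set" where
  "star_auto A = star_hom A A \<inter> Bij (carrier A)"


section \<open>Continuous functional calculus of a unitary\<close>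

abbreviation circle :: "complex set" where
  "circle \<equiv> sphere 0 1"

abbreviation e2pi :: "real \<Rightarrow> complex" where
  "e2pi t \<equiv> exp (2 * of_real pi * \<i> * of_real t)"

definition circle_algebra :: "(complex \<Rightarrow> complex) cstar" where
  "circle_algebra =
     \<lparr>carrier = {h \<in> extensional circle. continuous_on circle h},
      mult = (\<lambda>h k. \<lambda>\<zeta>\<in>circle. h \<zeta> * k \<zeta>),
      one = (\<lambda>\<zeta>\<in>circle. 1),
      zero = (\<lambda>\<zeta>\<in>circle. 0),
      add = (\<lambda>h k. \<lambda>\<zeta>\<in>circle. h \<zeta> + k \<zeta>),
      smult = (\<lambda>c h. \<lambda>\<zeta>\<in>circle. c * h \<zeta>),
      star = (\<lambda>h. \<lambda>\<zeta>\<in>circle. cnj (h \<zeta>)),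
      nrm = (\<lambda>h. SUP \<zeta>\<in>circle. cmod (h \<zeta>))\<rparr>"

text \<open>The element $h(x)$ for a unitary $x$ and $h$ continuous on the circle: the image of $h$
  under the unique unital *-homomorphism from $C(S^1)$ that sends the identity function to $x$.\<close>

definition func_calc :: "'a cstar \<Rightarrow> 'a \<Rightarrow> (complex \<Rightarrow> complex) \<Rightarrow> 'a" where
  "func_calc A x h = (THE y. \<exists>\<Phi>\<in>star_hom circle_algebra A.
     \<Phi> (\<lambda>\<zeta>\<in>circle. \<zeta>) = x \<and> y = \<Phi> (restrict h circle))"


section \<open>Rotation algebras\<close>

definition rotation_pair :: "real \<Rightarrow> 'a cstar \<Rightarrow> 'a \<Rightarrow> 'a \<Rightarrow> bool" where
  "rotation_pair \<theta> A u v \<longleftrightarrow> unitary A u \<and> unitary A v \<and>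
     v \<otimes>\<^bsub>A\<^esub> u = e2pi \<theta> \<odot>\<^bsub>A\<^esub> (u \<otimes>\<^bsub>A\<^esub> v)"

text \<open>The universal C*-algebra generated by a rotation pair. It suffices to test universality
  against algebras \<open>B\<close> whose carrier is a set of complex sequences: the C*-subalgebra generated
  by a rotation pair in any C*-algebra has at most the cardinality of the continuum, hence is
  isomorphic to such a \<open>B\<close>. Uniqueness of \<open>\<phi>\<close> on the carrier follows from generation.\<close>

definition rotation_algebra :: "real \<Rightarrow> 'a cstar \<Rightarrow> 'a \<Rightarrow> 'a \<Rightarrow> bool" where
  "rotation_algebra \<theta> A u v \<longleftrightarrow>
     cstar_algebra A \<and> rotation_pair \<theta> A u v \<and> generates A {u, v} \<and>
     (\<forall>(B :: (nat \<Rightarrow> complex) cstar) x y. cstar_algebra B \<and> rotation_pair \<theta> B x y \<longrightarrow>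
        (\<exists>\<phi>\<in>star_hom A B. \<phi> u = x \<and> \<phi> v = y))"

text \<open>The automorphism $\alpha_{\theta,\gamma,d,f}$ of the rotation algebra \<open>A\<close> with canonical
  generators \<open>u\<close>, \<open>v\<close>; the dependence on $\theta$ is through \<open>A\<close>. Only the values of \<open>f\<close> on the
  circle matter.\<close>

definition rotation_auto ::
  "'a cstar \<Rightarrow> 'a \<Rightarrow> 'a \<Rightarrow> real \<Rightarrow> int \<Rightarrow> (complex \<Rightarrow> real) \<Rightarrow> 'a \<Rightarrow> 'a" where
  "rotation_auto A u v \<gamma> d f = (THE \<alpha>. \<alpha> \<in> star_auto A \<and>
     \<alpha> u = e2pi \<gamma> \<odot>\<^bsub>A\<^esub> u \<and>
     \<alpha> v = func_calc A u (\<lambda>\<zeta>. e2pi (f \<zeta>)) \<otimes>\<^bsub>A\<^esub> (u [^]\<^bsub>A\<^esub> d) \<otimes>\<^bsub>A\<^esub> v)"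


section \<open>Crossed products by the integers\<close>

definition covariant_pair ::
  "'a cstar \<Rightarrow> ('a \<Rightarrow> 'a) \<Rightarrow> 'b cstar \<Rightarrow> ('a \<Rightarrow> 'b) \<Rightarrow> 'b \<Rightarrow> bool" where
  "covariant_pair A \<alpha> B \<phi> w \<longleftrightarrow> \<phi> \<in> star_hom A B \<and> unitary B w \<and>
     (\<forall>a\<in>carrier A. w \<otimes>\<^bsub>B\<^esub> \<phi> a \<otimes>\<^bsub>B\<^esub> star B w = \<phi> (\<alpha> a))"

text \<open>\<open>C\<close> is the crossed product of \<open>A\<close> by the action $n \mapsto \alpha^n$ of the integers, with
  canonical map \<open>\<iota>\<close> and canonical unitary \<open>w\<close>: the universal C*-algebra generated by a covariant
  pair. Again it suffices to test against algebras \<open>B\<close> carried by \<open>nat \<Rightarrow> 'a\<close>: the C*-subalgebra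
  generated by a covariant pair consists of limits of sequences of finite sums of terms
  $\varphi(a) w^n$, so its cardinality is at most that of \<open>nat \<Rightarrow> 'a\<close>.\<close>

definition crossed_product ::
  "'a cstar \<Rightarrow> ('a \<Rightarrow> 'a) \<Rightarrow> 'c cstar \<Rightarrow> ('a \<Rightarrow> 'c) \<Rightarrow> 'c \<Rightarrow> bool" where
  "crossed_product A \<alpha> C \<iota> w \<longleftrightarrow>
     cstar_algebra C \<and> covariant_pair A \<alpha> C \<iota> w \<and> generates C (insert w (\<iota> ` carrier A)) \<and>
     (\<forall>(B :: (nat \<Rightarrow> 'a) cstar) \<phi> x. cstar_algebra B \<and> covariant_pair A \<alpha> B \<phi> x \<longrightarrow>
        (\<exists>\<psi>\<in>star_hom C B. (\<forall>a\<in>carrier A. \<psi> (\<iota> a) = \<phi> a) \<and> \<psi> w = x))"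

end

theory Submission
  imports Defs "HOL-Complex_Analysis.Cauchy_Integral_Formula"
begin

text \<open>
  Write $E(c,H)$ for the automorphism $u \mapsto cu$, $v \mapsto H(u)v$ with $|c| = 1$ and
  $H \colon S^1 \to S^1$ continuous. Then
  $E(c,H) \circ E(c',H') = E(cc', H'(c\,\cdot\,)H)$, so conjugating $E(c,H)$ by
  $\beta = E(b,1)$ gives $E(c, H(b\,\cdot\,))$; for $H(\zeta) = e^{2\pi i f(\zeta)}\zeta^d$ and
  $b = e^{2\pi i r/d}$ this replaces $f$ by $g$, because $b^d = e^{2\pi i r}$. A conjugacy of
  automorphisms turns covariant pairs into covariant pairs, so the universal properties yield mutually
  inverse homomorphisms between the crossed products.

  Universality is only available for target algebras carried by fixed types. The algebras that occur
  are generated by few elements, hence are approximated by countably many *-polynomial expressions in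
  sequences of generators; this bounds their cardinality, and the structure is transported along an
  injection into the required type.

  Homomorphisms that agree on generators are equal because *-homomorphisms are contractive: if
  $a = a^*$ and $\|a\| < 1$, then $a^2 + b^2 = 1$ for a self-adjoint $b$ commuting with $a$, and the
  image of $a$ is the real part of the unitary image of $a + ib$. The functional calculus of a unitary
  $u$ exists since $\|p(u)\| \le \sup_{S^1} |p|$ for polynomials $p$, by comparing
  $\|p(u)\|^n = \|p^n(u)\|$ with the sum of the coefficients of $p^n$.
\<close>

section \<open>Metric structure of a C*-algebra\<close>

text \<open>No spectral theory is used. Contractivity and the polynomial estimate both come from the
  C*-identity, the first through a unitary with prescribed real part, the second through squares of
  normal elements. Since \<open>func_calc\<close> and \<open>rotation_auto\<close> are definite
  descriptions, no formula about them is usable before existence and uniqueness are known.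
  Uniqueness means agreement on generators plus continuity, which is why contractivity comes so
  early. Existence has two sources. The circle algebra is given concretely, without a universal
  property, so a homomorphism out of it is built as the closure of a map on expressions, and the one
  thing to check is that norms do not increase. Rotation algebras and crossed products come with
  their property, and there the only difficulty is the type of the target. Hence the unit has norm
  at most 1 rather than 1, and real numbers cannot always be stored as multiples of the
  unit.\<close>

lemma complex_field_simps [simp]:
  "carrier complex_field = UNIV" "x \<otimes>\<^bsub>complex_field\<^esub> y = x * y" "\<one>\<^bsub>complex_field\<^esub> = 1"
  "\<zero>\<^bsub>complex_field\<^esub> = 0" "x \<oplus>\<^bsub>complex_field\<^esub> y = x + y"
  by (simp_all add: complex_field_def)

lemma cring_complex_field: "cring complex_field"
proof (rule cringI)
  show "abelian_group complex_field"
    by (rule abelian_groupI) (auto intro: exI[of _ "- x" for x] simp: add_eq_0_iff)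
  show "comm_monoid complex_field"
    by (rule comm_monoidI) auto
qed (auto simp: algebra_simps)

text \<open>Additive inverses and differences are written with the scalar -1: the inverse behind
  \<open>\<ominus>\<close> is a definite description, whereas the multiple by -1 can be computed
  pointwise in a concrete model.\<close>

lemma cstar_algebraI:
  fixes A :: "'a cstar" (structure)
  assumes closed: "\<And>x y. \<lbrakk>x \<in> carrier A; y \<in> carrier A\<rbrakk> \<Longrightarrow> x \<oplus> y \<in> carrier A"
      "\<And>x y. \<lbrakk>x \<in> carrier A; y \<in> carrier A\<rbrakk> \<Longrightarrow> x \<otimes> y \<in> carrier A"
      "\<zero> \<in> carrier A" "\<one> \<in> carrier A" "\<And>c x. x \<in> carrier A \<Longrightarrow> c \<odot> x \<in> carrier A"
      "\<And>x. x \<in> carrier A \<Longrightarrow> star A x \<in> carrier A"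
    and add: "\<And>x y z. \<lbrakk>x \<in> carrier A; y \<in> carrier A; z \<in> carrier A\<rbrakk>
        \<Longrightarrow> (x \<oplus> y) \<oplus> z = x \<oplus> (y \<oplus> z)"
      "\<And>x y. \<lbrakk>x \<in> carrier A; y \<in> carrier A\<rbrakk> \<Longrightarrow> x \<oplus> y = y \<oplus> x"
      "\<And>x. x \<in> carrier A \<Longrightarrow> \<zero> \<oplus> x = x"
      "\<And>x. x \<in> carrier A \<Longrightarrow> (-1) \<odot> x \<oplus> x = \<zero>"
    and mult: "\<And>x y z. \<lbrakk>x \<in> carrier A; y \<in> carrier A; z \<in> carrier A\<rbrakk>
        \<Longrightarrow> (x \<otimes> y) \<otimes> z = x \<otimes> (y \<otimes> z)"
      "\<And>x. x \<in> carrier A \<Longrightarrow> \<one> \<otimes> x = x" "\<And>x. x \<in> carrier A \<Longrightarrow> x \<otimes> \<one> = x"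
      "\<And>x y z. \<lbrakk>x \<in> carrier A; y \<in> carrier A; z \<in> carrier A\<rbrakk>
        \<Longrightarrow> (x \<oplus> y) \<otimes> z = x \<otimes> z \<oplus> y \<otimes> z"
      "\<And>x y z. \<lbrakk>x \<in> carrier A; y \<in> carrier A; z \<in> carrier A\<rbrakk>
        \<Longrightarrow> z \<otimes> (x \<oplus> y) = z \<otimes> x \<oplus> z \<otimes> y"
    and smult: "\<And>a b x. x \<in> carrier A \<Longrightarrow> (a + b) \<odot> x = a \<odot> x \<oplus> b \<odot> x"
      "\<And>a x y. \<lbrakk>x \<in> carrier A; y \<in> carrier A\<rbrakk> \<Longrightarrow> a \<odot> (x \<oplus> y) = a \<odot> x \<oplus> a \<odot> y"
      "\<And>a b x. x \<in> carrier A \<Longrightarrow> (a * b) \<odot> x = a \<odot> (b \<odot> x)"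
      "\<And>x. x \<in> carrier A \<Longrightarrow> 1 \<odot> x = x"
      "\<And>c x y. \<lbrakk>x \<in> carrier A; y \<in> carrier A\<rbrakk> \<Longrightarrow> (c \<odot> x) \<otimes> y = c \<odot> (x \<otimes> y)"
      "\<And>c x y. \<lbrakk>x \<in> carrier A; y \<in> carrier A\<rbrakk> \<Longrightarrow> x \<otimes> (c \<odot> y) = c \<odot> (x \<otimes> y)"
    and star: "\<And>x. x \<in> carrier A \<Longrightarrow> star A (star A x) = x"
      "\<And>x y. \<lbrakk>x \<in> carrier A; y \<in> carrier A\<rbrakk> \<Longrightarrow> star A (x \<oplus> y) = star A x \<oplus> star A y"
      "\<And>c x. x \<in> carrier A \<Longrightarrow> star A (c \<odot> x) = cnj c \<odot> star A x"
      "\<And>x y. \<lbrakk>x \<in> carrier A; y \<in> carrier A\<rbrakk> \<Longrightarrow> star A (x \<otimes> y) = star A y \<otimes> star A x"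
    and nrm: "\<And>x. x \<in> carrier A \<Longrightarrow> 0 \<le> nrm A x"
      "\<And>x. x \<in> carrier A \<Longrightarrow> nrm A x = 0 \<longleftrightarrow> x = \<zero>"
      "\<And>x y. \<lbrakk>x \<in> carrier A; y \<in> carrier A\<rbrakk> \<Longrightarrow> nrm A (x \<oplus> y) \<le> nrm A x + nrm A y"
      "\<And>c x. x \<in> carrier A \<Longrightarrow> nrm A (c \<odot> x) = cmod c * nrm A x"
      "\<And>x y. \<lbrakk>x \<in> carrier A; y \<in> carrier A\<rbrakk> \<Longrightarrow> nrm A (x \<otimes> y) \<le> nrm A x * nrm A y"
      "\<And>x. x \<in> carrier A \<Longrightarrow> nrm A (star A x \<otimes> x) = (nrm A x)\<^sup>2"
    and complete: "\<And>s. \<lbrakk>\<And>n. s n \<in> carrier A;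
        \<And>e. 0 < e \<Longrightarrow> \<exists>N. \<forall>m\<ge>N. \<forall>n\<ge>N. nrm A (s m \<oplus> (-1) \<odot> s n) < e\<rbrakk>
       \<Longrightarrow> \<exists>x\<in>carrier A. (\<lambda>n::nat. nrm A (s n \<oplus> (-1) \<odot> x)) \<longlonglongrightarrow> 0"
  shows "cstar_algebra A"
proof -
  interpret abelian_group A
  proof (rule abelian_groupI)
    show "\<exists>y\<in>carrier A. y \<oplus> x = \<zero>" if "x \<in> carrier A" for x
      using closed(5)[OF that] add(4)[OF that] by blast
  qed (use closed add in simp_all)
  have minus: "x \<ominus> y = x \<oplus> (-1) \<odot> y" if "x \<in> carrier A" "y \<in> carrier A" for x y
    using that closed(5)[of y "-1"] add(4)[of y] by (simp add: minus_eq minus_equality)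
  have "Module.module complex_field A"
    by (rule moduleI)
      (simp_all add: closed smult cring_complex_field abelian_group_axioms)
  moreover have "ring A"
  proof (rule ringI)
    show "Group.monoid A" by (rule monoidI) (simp_all add: closed mult)
  qed (simp_all add: mult abelian_group_axioms)
  moreover have "cstar_algebra_axioms A"
  proof
    fix s :: "nat \<Rightarrow> 'a"
    assume s: "\<And>n. s n \<in> carrier A"
      and "\<And>e. 0 < e \<Longrightarrow> \<exists>N. \<forall>m\<ge>N. \<forall>n\<ge>N. nrm A (s m \<ominus> s n) < e"
    then have "\<exists>x\<in>carrier A. (\<lambda>n::nat. nrm A (s n \<oplus> (-1) \<odot> x)) \<longlonglongrightarrow> 0"
      by (intro complete) (simp_all add: minus)
    with s show "\<exists>x\<in>carrier A. (\<lambda>n::nat. nrm A (s n \<ominus> x)) \<longlonglongrightarrow> 0"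
      by (simp add: minus cong: bex_cong)
  qed (simp_all add: closed smult star nrm)
  ultimately show ?thesis by (rule cstar_algebra.intro)
qed

abbreviation cstar_lim :: "'a cstar \<Rightarrow> (nat \<Rightarrow> 'a) \<Rightarrow> 'a \<Rightarrow> bool" where
  "cstar_lim A s x \<equiv> (\<lambda>n. nrm A (s n \<ominus>\<^bsub>A\<^esub> x)) \<longlonglongrightarrow> 0"

lemma cstar_subalgebraD:
  assumes "cstar_subalgebra S A"
  shows "S \<subseteq> carrier A" "\<one>\<^bsub>A\<^esub> \<in> S"
    "\<And>x y. \<lbrakk>x \<in> S; y \<in> S\<rbrakk> \<Longrightarrow> x \<oplus>\<^bsub>A\<^esub> y \<in> S"
    "\<And>x y. \<lbrakk>x \<in> S; y \<in> S\<rbrakk> \<Longrightarrow> x \<otimes>\<^bsub>A\<^esub> y \<in> S"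
    "\<And>c x. x \<in> S \<Longrightarrow> c \<odot>\<^bsub>A\<^esub> x \<in> S" "\<And>x. x \<in> S \<Longrightarrow> star A x \<in> S"
    "\<And>s x. \<lbrakk>\<And>n. s n \<in> S; x \<in> carrier A; cstar_lim A s x\<rbrakk> \<Longrightarrow> x \<in> S"
proof -
  show "x \<in> S" if s: "\<And>n. s n \<in> S" and x: "x \<in> carrier A" and lim: "cstar_lim A s x" for s x
  proof -
    have "\<forall>s x. (\<forall>n. s n \<in> S) \<and> x \<in> carrier A \<and> cstar_lim A s x \<longrightarrow> x \<in> S"
      using assms unfolding cstar_subalgebra_def by (elim conjE) assumption
    from this[rule_format, OF conjI, OF allI conjI, OF s x lim] show ?thesis .
  qed
qed (use assms in \<open>simp_all add: cstar_subalgebra_def\<close>)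

lemma cstar_subalgebraI:
  assumes "S \<subseteq> carrier A" "\<one>\<^bsub>A\<^esub> \<in> S"
    "\<And>x y. \<lbrakk>x \<in> S; y \<in> S\<rbrakk> \<Longrightarrow> x \<oplus>\<^bsub>A\<^esub> y \<in> S"
    "\<And>x y. \<lbrakk>x \<in> S; y \<in> S\<rbrakk> \<Longrightarrow> x \<otimes>\<^bsub>A\<^esub> y \<in> S"
    "\<And>c x. x \<in> S \<Longrightarrow> c \<odot>\<^bsub>A\<^esub> x \<in> S" "\<And>x. x \<in> S \<Longrightarrow> star A x \<in> S"
    "\<And>s x. \<lbrakk>\<And>n. s n \<in> S; x \<in> carrier A; cstar_lim A s x\<rbrakk> \<Longrightarrow> x \<in> S"
  shows "cstar_subalgebra S A"
  unfolding cstar_subalgebra_def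
proof (intro conjI)
  show "\<forall>s x. (\<forall>n. s n \<in> S) \<and> x \<in> carrier A \<and> cstar_lim A s x \<longrightarrow> x \<in> S"
  proof (intro allI impI, elim conjE)
    fix s x assume s: "\<forall>n. s n \<in> S" and x: "x \<in> carrier A" "cstar_lim A s x"
    show "x \<in> S" by (rule assms(7)[OF spec[OF s] x])
  qed
qed (simp_all add: assms(1-6))

context cstar_algebra
begin

lemmas smult_add_left = smult_l_distr[simplified]
lemmas smult_add_right = smult_r_distr[simplified]
lemmas smult_smult = smult_assoc1[simplified, symmetric]
lemmas smult_1 [simp] = smult_one[simplified]

declare star_closed [simp] star_star [simp]

lemma smult_0 [simp]: "x \<in> carrier A \<Longrightarrow> 0 \<odot> x = \<zero>"
  using smult_l_null[of x] by simp

lemma smult_zero [simp]: "c \<odot> \<zero> = \<zero>"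
  using smult_r_null[of c] by simp

lemma uminus_smult: "x \<in> carrier A \<Longrightarrow> \<ominus> x = (-1) \<odot> x"
  using smult_add_left[of x "-1" 1] by (simp add: M.minus_equality)

lemma minus_smult: "x \<in> carrier A \<Longrightarrow> y \<in> carrier A \<Longrightarrow> x \<ominus> y = x \<oplus> (-1) \<odot> y"
  by (simp add: minus_eq uminus_smult)

lemma star_zero [simp]: "star A \<zero> = \<zero>"
  using star_smult[of \<zero> 0] by simp

lemma star_one [simp]: "star A \<one> = \<one>"
proof -
  \<comment> \<open>The right-hand side is read in two ways: by \<open>star_mult\<close> it is the
    adjoint of the unit, by \<open>r_one\<close> and \<open>star_star\<close> it is the unit
    itself.\<close>
  have "star A \<one> = star A (star A \<one> \<otimes> \<one>)" by (simp del: r_one star_star add: star_mult) simp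
  then show ?thesis by simp
qed

lemma star_minus:
  "x \<in> carrier A \<Longrightarrow> y \<in> carrier A \<Longrightarrow> star A (x \<ominus> y) = star A x \<ominus> star A y"
  by (simp add: minus_smult star_add star_smult)

lemma nrm_zero [simp]: "nrm A \<zero> = 0"
  by (simp add: nrm_eq_zero_iff)

lemma nrm_minus_self [simp]: "x \<in> carrier A \<Longrightarrow> nrm A (x \<ominus> x) = 0"
  by (simp add: M.r_neg minus_eq)

lemma nrm_minus_eq_zero:
  "x \<in> carrier A \<Longrightarrow> y \<in> carrier A \<Longrightarrow> nrm A (x \<ominus> y) = 0 \<longleftrightarrow> x = y"
proof
  assume xy: "x \<in> carrier A" "y \<in> carrier A" "nrm A (x \<ominus> y) = 0"
  then have "(x \<ominus> y) \<oplus> y = y" by (simp add: nrm_eq_zero_iff)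
  moreover have "(x \<ominus> y) \<oplus> y = x" using xy by (simp add: minus_eq M.a_assoc M.l_neg)
  ultimately show "x = y" by simp
qed simp

lemma nrm_minus_commute:
  assumes "x \<in> carrier A" "y \<in> carrier A"
  shows "nrm A (x \<ominus> y) = nrm A (y \<ominus> x)"
proof -
  have "y \<ominus> x = (-1) \<odot> (x \<ominus> y)"
    using assms by (simp add: minus_smult smult_add_right smult_smult M.a_comm)
  then show ?thesis using assms nrm_smult[of "x \<ominus> y" "-1"] by simp
qed

lemma nrm_dist_triangle:
  assumes [simp]: "x \<in> carrier A" "y \<in> carrier A" "z \<in> carrier A"
  shows "nrm A (x \<ominus> z) \<le> nrm A (x \<ominus> y) + nrm A (y \<ominus> z)"
proof -
  have "x \<ominus> z = (x \<ominus> y) \<oplus> (y \<ominus> z)"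
    by (simp add: minus_eq M.a_assoc M.r_neg1)
  then show ?thesis by (simp add: nrm_triangle)
qed

lemma nrm_diff_le:
  assumes [simp]: "x \<in> carrier A" "y \<in> carrier A"
  shows "\<bar>nrm A x - nrm A y\<bar> \<le> nrm A (x \<ominus> y)"
proof -
  have "x = (x \<ominus> y) \<oplus> y" "y = (y \<ominus> x) \<oplus> x"
    by (simp_all add: minus_eq M.a_assoc M.l_neg)
  then have "nrm A x \<le> nrm A (x \<ominus> y) + nrm A y" "nrm A y \<le> nrm A (y \<ominus> x) + nrm A x"
    by (metis nrm_triangle assms M.minus_closed)+
  then show ?thesis by (simp add: nrm_minus_commute[of y x] abs_if)
qed

text \<open>The C*-identity at the unit makes its norm idempotent, so it is 0 or 1; the value 0
  occurs in the zero algebra.\<close>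

lemma nrm_one_le: "nrm A \<one> \<le> 1"
proof -
  have "(nrm A \<one>)\<^sup>2 = nrm A \<one>" using nrm_star_mult[of \<one>] by simp
  then show ?thesis by (auto simp: power2_eq_square)
qed

text \<open>By the C*-identity and submultiplicativity, the squared norm of y is at most the product
  of the norms of y and its adjoint. Cancelling gives one inequality, and the adjoint of y gives the
  other.\<close>

lemma nrm_star [simp]:
  assumes x: "x \<in> carrier A"
  shows "nrm A (star A x) = nrm A x"
proof -
  have le: "nrm A y \<le> nrm A (star A y)" if y: "y \<in> carrier A" for y
  proof (cases "nrm A y = 0")
    case True
    then show ?thesis using y by (simp add: nrm_nonneg)
  next
    case False
    have "nrm A y * nrm A y \<le> nrm A (star A y) * nrm A y"
      using nrm_star_mult[OF y] nrm_mult[of "star A y" y] y by (simp add: power2_eq_square)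
    then show ?thesis using False nrm_nonneg[OF y] by simp
  qed
  show ?thesis using le[OF x] le[of "star A x"] x by simp
qed

lemma nrm_unitary_le: "unitary A x \<Longrightarrow> nrm A x \<le> 1"
proof -
  assume "unitary A x"
  then have x: "x \<in> carrier A" "star A x \<otimes> x = \<one>" by (auto simp: unitary_def)
  then have "(nrm A x)\<^sup>2 \<le> 1" using nrm_star_mult[of x] nrm_one_le by simp
  then show ?thesis using power2_le_imp_le[of "nrm A x" 1] by simp
qed

lemma nrm_add_diff_le:
  assumes [simp]: "x \<in> carrier A" "y \<in> carrier A" "x' \<in> carrier A" "y' \<in> carrier A"
  shows "nrm A ((x \<oplus> y) \<ominus> (x' \<oplus> y')) \<le> nrm A (x \<ominus> x') + nrm A (y \<ominus> y')"
proof -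
  have "(x \<oplus> y) \<ominus> (x' \<oplus> y') = (x \<ominus> x') \<oplus> (y \<ominus> y')"
    by (simp add: minus_smult smult_add_right M.a_ac)
  then show ?thesis by (simp add: nrm_triangle)
qed

lemma nrm_mult_diff_le:
  assumes [simp]: "x \<in> carrier A" "y \<in> carrier A" "x' \<in> carrier A" "y' \<in> carrier A"
  shows "nrm A ((x \<otimes> y) \<ominus> (x' \<otimes> y')) \<le> nrm A (x \<ominus> x') * nrm A y + nrm A x' * nrm A (y \<ominus> y')"
proof -
  have "(x \<otimes> y) \<ominus> (x' \<otimes> y') = (x \<ominus> x') \<otimes> y \<oplus> x' \<otimes> (y \<ominus> y')"
    by (simp add: minus_eq l_distr r_distr l_minus r_minus M.a_assoc M.r_neg1)
  also have "nrm A \<dots> \<le> nrm A ((x \<ominus> x') \<otimes> y) + nrm A (x' \<otimes> (y \<ominus> y'))"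
    by (simp add: nrm_triangle)
  also have "\<dots> \<le> nrm A (x \<ominus> x') * nrm A y + nrm A x' * nrm A (y \<ominus> y')"
    by (intro add_mono nrm_mult) simp_all
  finally show ?thesis .
qed

lemma nrm_smult_diff:
  assumes [simp]: "x \<in> carrier A" "y \<in> carrier A"
  shows "nrm A (c \<odot> x \<ominus> c \<odot> y) = cmod c * nrm A (x \<ominus> y)"
proof -
  have "c \<odot> x \<ominus> c \<odot> y = c \<odot> (x \<ominus> y)"
    by (simp add: minus_smult smult_add_right smult_smult)
  then show ?thesis by (simp add: nrm_smult)
qed

lemma nrm_star_diff:
  "x \<in> carrier A \<Longrightarrow> y \<in> carrier A \<Longrightarrow> nrm A (star A x \<ominus> star A y) = nrm A (x \<ominus> y)"
  by (simp flip: star_minus)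

section \<open>Limits in norm\<close>

lemma lim_nrm:
  assumes "\<And>n. s n \<in> carrier A" "x \<in> carrier A" "cstar_lim A s x"
  shows "(\<lambda>n. nrm A (s n)) \<longlonglongrightarrow> nrm A x"
proof (rule LIM_zero_cancel, rule Lim_null_comparison[OF _ assms(3)])
  show "\<forall>\<^sub>F n in sequentially. norm (nrm A (s n) - nrm A x) \<le> nrm A (s n \<ominus> x)"
    using assms nrm_diff_le by simp
qed

lemma lim_unique:
  assumes s: "\<And>n. s n \<in> carrier A" and x: "x \<in> carrier A" "y \<in> carrier A"
    and lim: "cstar_lim A s x" "cstar_lim A s y"
  shows "x = y"
proof -
  have "(\<lambda>n. nrm A (s n \<ominus> x) + nrm A (s n \<ominus> y)) \<longlonglongrightarrow> 0"
    using tendsto_add[OF lim] by simp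
  moreover have "nrm A (x \<ominus> y) \<le> nrm A (s n \<ominus> x) + nrm A (s n \<ominus> y)" for n
    using nrm_dist_triangle[of x "s n" y] s x by (simp add: nrm_minus_commute[of x])
  ultimately have "nrm A (x \<ominus> y) \<le> 0" by (intro LIMSEQ_le_const) auto
  then show ?thesis using x nrm_nonneg[of "x \<ominus> y"] nrm_minus_eq_zero[of x y] by simp
qed

lemma lim_add:
  assumes "\<And>n. s n \<in> carrier A" "\<And>n. t n \<in> carrier A" "x \<in> carrier A" "y \<in> carrier A"
    and lim: "cstar_lim A s x" "cstar_lim A t y"
  shows "cstar_lim A (\<lambda>n. s n \<oplus> t n) (x \<oplus> y)"
proof (rule Lim_null_comparison)
  show "\<forall>\<^sub>F n in sequentially.
      norm (nrm A (s n \<oplus> t n \<ominus> (x \<oplus> y))) \<le> nrm A (s n \<ominus> x) + nrm A (t n \<ominus> y)"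
    using assms(1-4) by (auto simp: nrm_nonneg nrm_add_diff_le)
  show "(\<lambda>n. nrm A (s n \<ominus> x) + nrm A (t n \<ominus> y)) \<longlonglongrightarrow> 0"
    using tendsto_add[OF lim] by simp
qed

lemma lim_mult:
  assumes "\<And>n. s n \<in> carrier A" "\<And>n. t n \<in> carrier A" "x \<in> carrier A" "y \<in> carrier A"
    and lim: "cstar_lim A s x" "cstar_lim A t y"
  shows "cstar_lim A (\<lambda>n. s n \<otimes> t n) (x \<otimes> y)"
proof (rule Lim_null_comparison)
  show "\<forall>\<^sub>F n in sequentially. norm (nrm A (s n \<otimes> t n \<ominus> x \<otimes> y))
      \<le> nrm A (s n \<ominus> x) * nrm A (t n) + nrm A x * nrm A (t n \<ominus> y)"
    using assms(1-4) by (auto simp: nrm_nonneg nrm_mult_diff_le)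
  show "(\<lambda>n. nrm A (s n \<ominus> x) * nrm A (t n) + nrm A x * nrm A (t n \<ominus> y)) \<longlonglongrightarrow> 0"
    using tendsto_add[OF tendsto_mult[OF lim(1) lim_nrm[OF assms(2,4) lim(2)]]
        tendsto_mult[OF tendsto_const[of "nrm A x"] lim(2)]] by simp
qed

lemma lim_smult:
  assumes "\<And>n. s n \<in> carrier A" "x \<in> carrier A" and lim: "cstar_lim A s x"
  shows "cstar_lim A (\<lambda>n. c \<odot> s n) (c \<odot> x)"
  using tendsto_mult[OF tendsto_const[of "cmod c"] lim] assms by (simp add: nrm_smult_diff)

lemma lim_star:
  assumes "\<And>n. s n \<in> carrier A" "x \<in> carrier A" and lim: "cstar_lim A s x"
  shows "cstar_lim A (\<lambda>n. star A (s n)) (star A x)"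
  using assms by (simp add: nrm_star_diff)

lemma lim_Cauchy:
  assumes s: "\<And>n. s n \<in> carrier A" and x: "x \<in> carrier A" and lim: "cstar_lim A s x" and e: "0 < e"
  shows "\<exists>N. \<forall>m\<ge>N. \<forall>n\<ge>N. nrm A (s m \<ominus> s n) < e"
proof -
  obtain N where N: "nrm A (s n \<ominus> x) < e / 2" if "n \<ge> N" for n
    using LIMSEQ_D[OF lim, of "e / 2"] e nrm_nonneg s x by auto
  have "nrm A (s m \<ominus> s n) < e" if "m \<ge> N" "n \<ge> N" for m n
    using nrm_dist_triangle[of "s m" x "s n"] nrm_minus_commute[of x "s n"]
      N[OF that(1)] N[OF that(2)] s x by simp
  then show ?thesis by blast
qed

end

section \<open>Contractivity of *-homomorphisms\<close>

lemma star_homD: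
  assumes "\<phi> \<in> star_hom A B"
  shows "\<And>x. x \<in> carrier A \<Longrightarrow> \<phi> x \<in> carrier B"
    "\<And>x y. \<lbrakk>x \<in> carrier A; y \<in> carrier A\<rbrakk> \<Longrightarrow> \<phi> (x \<oplus>\<^bsub>A\<^esub> y) = \<phi> x \<oplus>\<^bsub>B\<^esub> \<phi> y"
    "\<And>x y. \<lbrakk>x \<in> carrier A; y \<in> carrier A\<rbrakk> \<Longrightarrow> \<phi> (x \<otimes>\<^bsub>A\<^esub> y) = \<phi> x \<otimes>\<^bsub>B\<^esub> \<phi> y"
    "\<phi> \<one>\<^bsub>A\<^esub> = \<one>\<^bsub>B\<^esub>"
    "\<And>c x. x \<in> carrier A \<Longrightarrow> \<phi> (c \<odot>\<^bsub>A\<^esub> x) = c \<odot>\<^bsub>B\<^esub> \<phi> x"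
    "\<And>x. x \<in> carrier A \<Longrightarrow> \<phi> (star A x) = star B (\<phi> x)"
  using assms by (auto simp: star_hom_def ring_hom_def)

lemma star_homI:
  assumes "\<And>x. x \<in> carrier A \<Longrightarrow> \<phi> x \<in> carrier B"
    "\<And>x y. \<lbrakk>x \<in> carrier A; y \<in> carrier A\<rbrakk> \<Longrightarrow> \<phi> (x \<oplus>\<^bsub>A\<^esub> y) = \<phi> x \<oplus>\<^bsub>B\<^esub> \<phi> y"
    "\<And>x y. \<lbrakk>x \<in> carrier A; y \<in> carrier A\<rbrakk> \<Longrightarrow> \<phi> (x \<otimes>\<^bsub>A\<^esub> y) = \<phi> x \<otimes>\<^bsub>B\<^esub> \<phi> y"
    "\<phi> \<one>\<^bsub>A\<^esub> = \<one>\<^bsub>B\<^esub>"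
    "\<And>c x. x \<in> carrier A \<Longrightarrow> \<phi> (c \<odot>\<^bsub>A\<^esub> x) = c \<odot>\<^bsub>B\<^esub> \<phi> x"
    "\<And>x. x \<in> carrier A \<Longrightarrow> \<phi> (star A x) = star B (\<phi> x)"
  shows "\<phi> \<in> star_hom A B"
  using assms by (auto simp: star_hom_def ring_hom_def)

lemma star_hom_comp:
  assumes "\<phi> \<in> star_hom A B" "\<psi> \<in> star_hom B C"
  shows "(\<lambda>x. \<psi> (\<phi> x)) \<in> star_hom A C"
  using star_homD[OF assms(1)] star_homD[OF assms(2)] by (intro star_homI) simp_all

lemma star_hom_id: "(\<lambda>x. x) \<in> star_hom A A"
  by (rule star_homI) simp_all

lemma star_hom_unitary:
  assumes "cstar_algebra A" "\<phi> \<in> star_hom A B" "unitary A x"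
  shows "unitary B (\<phi> x)"
proof -
  interpret cstar_algebra A by fact
  show ?thesis
    using assms(3) star_homD[OF assms(2)] unfolding unitary_def by (metis star_closed)
qed

context cstar_algebra
begin

text \<open>A square root of $1 - a^2$ is $1 - y$ for the fixed point $y$ of the contraction
  $y \mapsto (a^2 + y^2)/2$ of the ball of radius $\|a\|$.\<close>

lemma ex_sqrt_one_minus_square:
  assumes a [simp]: "a \<in> carrier A" and sa: "star A a = a" and lt: "nrm A a < 1"
  obtains b where "b \<in> carrier A" "star A b = b" "a \<otimes> b = b \<otimes> a" "a \<otimes> a \<oplus> b \<otimes> b = \<one>"
proof -
  define t where "t = nrm A a"
  have t: "0 \<le> t" "t < 1" using lt by (simp_all add: t_def nrm_nonneg)
  \<comment> \<open>The conditions besides the norm bound are closed and preserved by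
    \<open>F\<close>, so the fixed point inherits self-adjointness and commutation with a.\<close>
  define M where "M = {y \<in> carrier A. nrm A y \<le> t \<and> star A y = y \<and> a \<otimes> y = y \<otimes> a}"
  define F where "F = (\<lambda>y. (1/2) \<odot> (a \<otimes> a \<oplus> y \<otimes> y))"
  \<comment> \<open>\<open>Metric_space\<close> asks for nonnegativity and symmetry at all
    arguments, hence the default value 0 outside \<open>M\<close>.\<close>
  define d where "d = (\<lambda>x y. if x \<in> M \<and> y \<in> M then nrm A (x \<ominus> y) else 0)"
  have MC: "y \<in> carrier A" if "y \<in> M" for y using that by (simp add: M_def)
  interpret S: Metric_space M d
  proof
    show "0 \<le> d x y" for x y by (simp add: d_def nrm_nonneg MC)
    show "d x y = d y x" for x y by (simp add: d_def nrm_minus_commute MC)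
    show "d x y = 0 \<longleftrightarrow> x = y" if "x \<in> M" "y \<in> M" for x y
      using that by (simp add: d_def nrm_minus_eq_zero MC)
    show "d x z \<le> d x y + d y z" if "x \<in> M" "y \<in> M" "z \<in> M" for x y z
      using that by (simp add: d_def nrm_dist_triangle MC)
  qed
  have "S.mcomplete"
    unfolding S.mcomplete_def
  proof (intro allI impI)
    fix s assume s: "S.MCauchy s"
    then have sM: "s n \<in> M" for n by (auto simp: S.MCauchy_def)
    have "\<exists>N. \<forall>m\<ge>N. \<forall>n\<ge>N. nrm A (s m \<ominus> s n) < e" if "0 < e" for e
    proof -
      have "d (s m) (s n) = nrm A (s m \<ominus> s n)" for m n using sM by (simp add: d_def)
      then show ?thesis using s that unfolding S.MCauchy_def by simp
    qed
    then obtain x where x: "x \<in> carrier A" "cstar_lim A s x"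
      using nrm_complete[of s] sM MC by blast
    have "nrm A x \<le> t"
      by (rule LIMSEQ_le_const2[OF lim_nrm[OF _ x]]) (use sM in \<open>auto simp: M_def\<close>)
    moreover have "star A x = x"
    proof (rule lim_unique[of s])
      show "cstar_lim A s (star A x)"
        using lim_star[OF _ x] sM by (simp add: M_def)
    qed (use x sM MC in auto)
    moreover have "a \<otimes> x = x \<otimes> a"
    proof (rule lim_unique[of "\<lambda>n. a \<otimes> s n"])
      show "cstar_lim A (\<lambda>n. a \<otimes> s n) (a \<otimes> x)"
        by (rule lim_mult) (use x sM MC in auto)
      have "cstar_lim A (\<lambda>n. s n \<otimes> a) (x \<otimes> a)"
        by (rule lim_mult) (use x sM MC in auto)
      then show "cstar_lim A (\<lambda>n. a \<otimes> s n) (x \<otimes> a)" using sM by (simp add: M_def)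
    qed (use x sM MC in auto)
    ultimately have xM: "x \<in> M" using x by (simp add: M_def)
    have "\<exists>N. \<forall>n\<ge>N. nrm A (s n \<ominus> x) < e" if "0 < e" for e
      using LIMSEQ_D[OF x(2) that] x(1) sM MC by (simp add: nrm_nonneg)
    moreover have "d (s n) x = nrm A (s n \<ominus> x)" for n using sM xM by (simp add: d_def)
    ultimately have "limitin S.mtopology s x sequentially"
      using xM sM by (simp add: S.limit_metric_sequentially)
    then show "\<exists>x. limitin S.mtopology s x sequentially" ..
  qed
  moreover have "M \<noteq> {}"
  proof -
    have "\<zero> \<in> M" using t by (simp add: M_def)
    then show ?thesis by blast
  qed
  moreover have "F \<in> M \<rightarrow> M"
  proof
    fix y assume y: "y \<in> M"
    then have yC [simp]: "y \<in> carrier A" and yt: "nrm A y \<le> t" and ys: "star A y = y"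
      and ya: "a \<otimes> y = y \<otimes> a"
      by (auto simp: M_def)
    have "nrm A (F y) = (1/2) * nrm A (a \<otimes> a \<oplus> y \<otimes> y)"
      by (simp add: F_def nrm_smult)
    also have "nrm A (a \<otimes> a \<oplus> y \<otimes> y) \<le> nrm A (a \<otimes> a) + nrm A (y \<otimes> y)"
      by (simp add: nrm_triangle)
    also have "\<dots> \<le> nrm A a * nrm A a + nrm A y * nrm A y"
      by (intro add_mono nrm_mult) simp_all
    also have "\<dots> \<le> t * t + t * t"
      using yt by (intro add_mono mult_mono) (simp_all add: t_def nrm_nonneg)
    \<comment> \<open>The ball of radius t is mapped into itself because t < 1 makes t^2 at most
      t.\<close>
    also have "(1/2) * (t * t + t * t) \<le> t"
      using t by (simp add: mult_left_le)
    finally have "nrm A (F y) \<le> t" by simp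
    moreover have "star A (F y) = F y"
      by (simp add: F_def star_smult star_add star_mult sa ys)
    moreover have "a \<otimes> F y = F y \<otimes> a"
    proof -
      have "a \<otimes> (y \<otimes> y) = y \<otimes> y \<otimes> a"
        by (metis ya yC a m_assoc)
      then show ?thesis
        by (simp add: F_def smult_mult_left smult_mult_right l_distr r_distr m_assoc)
    qed
    ultimately show "F y \<in> M" by (simp add: M_def F_def)
  qed
  moreover have "d (F x) (F y) \<le> t * d x y" if xy: "x \<in> M" "y \<in> M" for x y
  proof -
    have [simp]: "x \<in> carrier A" "y \<in> carrier A" and n: "nrm A x \<le> t" "nrm A y \<le> t"
      using xy by (auto simp: M_def)
    have "nrm A (F x \<ominus> F y) = (1/2) * nrm A ((a \<otimes> a \<oplus> x \<otimes> x) \<ominus> (a \<otimes> a \<oplus> y \<otimes> y))"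
      by (simp add: F_def nrm_smult_diff)
    also have "nrm A ((a \<otimes> a \<oplus> x \<otimes> x) \<ominus> (a \<otimes> a \<oplus> y \<otimes> y)) \<le> nrm A (x \<otimes> x \<ominus> y \<otimes> y)"
      using nrm_add_diff_le[of "a \<otimes> a" "x \<otimes> x" "a \<otimes> a" "y \<otimes> y"] by simp
    also have "\<dots> \<le> nrm A (x \<ominus> y) * nrm A x + nrm A y * nrm A (x \<ominus> y)"
      by (simp add: nrm_mult_diff_le)
    also have "\<dots> \<le> nrm A (x \<ominus> y) * t + t * nrm A (x \<ominus> y)"
      using n by (intro add_mono mult_mono) (simp_all add: nrm_nonneg t)
    finally show ?thesis
      using xy \<open>F \<in> M \<rightarrow> M\<close> by (simp add: d_def Pi_iff)
  qed
  ultimately obtain y where y: "y \<in> M" "F y = y"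
    using S.Banach_fixedpoint_thm[of F t] t by blast
  then have yC [simp]: "y \<in> carrier A" and ys: "star A y = y" and ya: "a \<otimes> y = y \<otimes> a"
    by (auto simp: M_def)
  \<comment> \<open>The fixed point equation 2y = a^2 + y^2 is a rearrangement of a^2 + (1 - y)^2 =
    1.\<close>
  have y2: "a \<otimes> a \<oplus> y \<otimes> y = 2 \<odot> y"
  proof -
    have "2 \<odot> F y = a \<otimes> a \<oplus> y \<otimes> y" by (simp add: F_def smult_smult)
    then show ?thesis by (simp add: y(2))
  qed
  show thesis
  proof (rule that[of "\<one> \<ominus> y"])
    show "star A (\<one> \<ominus> y) = \<one> \<ominus> y" by (simp add: star_minus ys)
    show "a \<otimes> (\<one> \<ominus> y) = (\<one> \<ominus> y) \<otimes> a"
      by (simp add: minus_eq l_distr r_distr l_minus r_minus ya)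
    have "a \<otimes> a \<oplus> (\<one> \<ominus> y) \<otimes> (\<one> \<ominus> y) = (a \<otimes> a \<oplus> y \<otimes> y) \<oplus> (\<one> \<oplus> (-2) \<odot> y)"
    proof -
      have "(-2) \<odot> y = (-1) \<odot> y \<oplus> (-1) \<odot> y" by (simp flip: smult_add_left)
      then show ?thesis
        by (simp add: minus_smult l_distr r_distr smult_mult_left smult_mult_right
            smult_smult smult_add_right M.a_ac)
    qed
    also have "\<dots> = (2 \<odot> y \<oplus> (-2) \<odot> y) \<oplus> \<one>"
      unfolding y2 by (simp add: M.a_ac)
    also have "\<dots> = \<one>" by (simp flip: smult_add_left)
    finally show "a \<otimes> a \<oplus> (\<one> \<ominus> y) \<otimes> (\<one> \<ominus> y) = \<one>" .
  qed simp
qed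

text \<open>Here $p + iq$ is unitary, and $p$ is its real part.\<close>

lemma nrm_le_one_if_sum_squares:
  assumes [simp]: "p \<in> carrier A" "q \<in> carrier A" and sa: "star A p = p" "star A q = q"
    and comm: "p \<otimes> q = q \<otimes> p" and sum: "p \<otimes> p \<oplus> q \<otimes> q = \<one>"
  shows "nrm A p \<le> 1"
proof -
  define U where "U = p \<oplus> \<i> \<odot> q"
  have U [simp]: "U \<in> carrier A" by (simp add: U_def)
  have star_U: "star A U = p \<oplus> (-\<i>) \<odot> q" by (simp add: U_def star_add star_smult sa)
  have cancel: "\<i> \<odot> (q \<otimes> p) \<oplus> (-\<i>) \<odot> (q \<otimes> p) = \<zero>" by (simp flip: smult_add_left)
  have "star A U \<otimes> U = (p \<otimes> p \<oplus> q \<otimes> q) \<oplus> (\<i> \<odot> (q \<otimes> p) \<oplus> (-\<i>) \<odot> (q \<otimes> p))"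
    unfolding star_U
    by (simp add: U_def l_distr r_distr smult_mult_left smult_mult_right smult_smult
        smult_add_right comm M.a_ac)
  then have "star A U \<otimes> U = \<one>" by (simp add: cancel sum)
  then have "(nrm A U)\<^sup>2 \<le> 1" using nrm_star_mult[of U] nrm_one_le by simp
  then have nU: "nrm A U \<le> 1" using power2_le_imp_le[of "nrm A U" 1] by simp
  have "U \<oplus> star A U = (p \<oplus> p) \<oplus> (\<i> \<odot> q \<oplus> (-\<i>) \<odot> q)"
    unfolding star_U by (simp add: U_def M.a_ac)
  also have "\<dots> = 2 \<odot> p"
    using smult_add_left[of p 1 1] smult_add_left[of q \<i> "-\<i>"] by simp
  finally have "2 * nrm A p = nrm A (U \<oplus> star A U)" by (simp add: nrm_smult)
  also have "\<dots> \<le> nrm A U + nrm A (star A U)" by (rule nrm_triangle) simp_all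
  finally show ?thesis using nU by simp
qed

end

lemma star_hom_minus:
  assumes "cstar_algebra A" "cstar_algebra B" "\<phi> \<in> star_hom A B" "x \<in> carrier A" "y \<in> carrier A"
  shows "\<phi> (x \<ominus>\<^bsub>A\<^esub> y) = \<phi> x \<ominus>\<^bsub>B\<^esub> \<phi> y"
proof -
  interpret A: cstar_algebra A by fact
  interpret B: cstar_algebra B by fact
  show ?thesis using assms(4,5) by (simp add: A.minus_smult B.minus_smult star_homD[OF assms(3)])
qed

lemma star_hom_nrm_le:
  assumes "cstar_algebra A" "cstar_algebra B" and \<phi>: "\<phi> \<in> star_hom A B" and x: "x \<in> carrier A"
  shows "nrm B (\<phi> x) \<le> nrm A x"
proof -
  interpret A: cstar_algebra A by fact
  interpret B: cstar_algebra B by fact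
  note hom = star_homD[OF \<phi>]
  have unit_ball: "nrm B (\<phi> a) \<le> 1"
    if a: "a \<in> carrier A" "star A a = a" "nrm A a < 1" for a
  proof -
    obtain b where b: "b \<in> carrier A" "star A b = b" "a \<otimes>\<^bsub>A\<^esub> b = b \<otimes>\<^bsub>A\<^esub> a"
      "a \<otimes>\<^bsub>A\<^esub> a \<oplus>\<^bsub>A\<^esub> b \<otimes>\<^bsub>A\<^esub> b = \<one>\<^bsub>A\<^esub>"
      using A.ex_sqrt_one_minus_square[OF a] .
    show ?thesis
    proof (rule B.nrm_le_one_if_sum_squares)
      show "star B (\<phi> a) = \<phi> a" "star B (\<phi> b) = \<phi> b"
        using a b hom(6) by metis+
      show "\<phi> a \<otimes>\<^bsub>B\<^esub> \<phi> b = \<phi> b \<otimes>\<^bsub>B\<^esub> \<phi> a"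
        using a b hom(3) by metis
      show "\<phi> a \<otimes>\<^bsub>B\<^esub> \<phi> a \<oplus>\<^bsub>B\<^esub> \<phi> b \<otimes>\<^bsub>B\<^esub> \<phi> b = \<one>\<^bsub>B\<^esub>"
        using a b hom(2,3,4) by (metis A.m_closed)
    qed (use a b hom in auto)
  qed
  have self_adjoint: "nrm B (\<phi> a) \<le> nrm A a" if a: "a \<in> carrier A" "star A a = a" for a
  proof (rule field_le_epsilon)
    fix e :: real assume e: "0 < e"
    \<comment> \<open>Division by a number strictly above the norm puts a into the open unit ball,
      also when the norm of a is 0.\<close>
    define t where "t = nrm A a + e"
    have t: "0 < t" "nrm A a < t" using e A.nrm_nonneg[OF a(1)] by (simp_all add: t_def)
    have "nrm B (\<phi> (of_real (1 / t) \<odot>\<^bsub>A\<^esub> a)) \<le> 1"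
      using t a by (intro unit_ball) (simp_all add: A.star_smult A.nrm_smult norm_divide)
    then show "nrm B (\<phi> a) \<le> nrm A a + e"
      using t a hom by (simp add: B.nrm_smult norm_divide divide_le_eq flip: t_def)
  qed
  have "(nrm B (\<phi> x))\<^sup>2 = nrm B (\<phi> (star A x \<otimes>\<^bsub>A\<^esub> x))"
    using x hom by (simp add: B.nrm_star_mult)
  also have "\<dots> \<le> nrm A (star A x \<otimes>\<^bsub>A\<^esub> x)"
    using x by (intro self_adjoint) (simp_all add: A.star_mult)
  also have "\<dots> = (nrm A x)\<^sup>2" using x by (rule A.nrm_star_mult)
  finally show ?thesis by (rule power2_le_imp_le) (simp add: A.nrm_nonneg x)
qed

lemma star_hom_lim:
  assumes "cstar_algebra A" "cstar_algebra B" and \<phi>: "\<phi> \<in> star_hom A B"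
    and s: "\<And>n. s n \<in> carrier A" "x \<in> carrier A" and lim: "cstar_lim A s x"
  shows "cstar_lim B (\<lambda>n. \<phi> (s n)) (\<phi> x)"
proof (rule Lim_null_comparison[OF _ lim])
  interpret A: cstar_algebra A by fact
  interpret B: cstar_algebra B by fact
  have "nrm B (\<phi> (s n) \<ominus>\<^bsub>B\<^esub> \<phi> x) \<le> nrm A (s n \<ominus>\<^bsub>A\<^esub> x)" for n
    using star_hom_nrm_le[OF assms(1-3), of "s n \<ominus>\<^bsub>A\<^esub> x"] star_hom_minus[OF assms(1-3)] s by simp
  then show "\<forall>\<^sub>F n in sequentially. norm (nrm B (\<phi> (s n) \<ominus>\<^bsub>B\<^esub> \<phi> x)) \<le> nrm A (s n \<ominus>\<^bsub>A\<^esub> x)"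
    using s star_homD[OF \<phi>] by (simp add: B.nrm_nonneg)
qed

text \<open>The elements where both maps agree form a C*-subalgebra; closedness under norm limits is
  where contractivity enters. Uniqueness of homomorphisms is always obtained this way below.\<close>

lemma star_hom_eqI:
  assumes "cstar_algebra A" "cstar_algebra B" and \<phi>: "\<phi> \<in> star_hom A B" and \<psi>: "\<psi> \<in> star_hom A B"
    and gen: "generates A G" and eq: "\<And>x. x \<in> G \<Longrightarrow> \<phi> x = \<psi> x" and x: "x \<in> carrier A"
  shows "\<phi> x = \<psi> x"
proof -
  interpret A: cstar_algebra A by fact
  interpret B: cstar_algebra B by fact
  define S where "S = {x \<in> carrier A. \<phi> x = \<psi> x}"
  have "x \<in> S" if s: "\<And>n. s n \<in> S" and x: "x \<in> carrier A" and lim: "cstar_lim A s x" for s x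
  proof -
    have sC: "s n \<in> carrier A" for n using s by (simp add: S_def)
    have "cstar_lim B (\<lambda>n. \<phi> (s n)) (\<phi> x)"
      by (rule star_hom_lim) (use assms sC x lim in auto)
    moreover have "cstar_lim B (\<lambda>n. \<psi> (s n)) (\<psi> x)"
      by (rule star_hom_lim) (use assms sC x lim in auto)
    moreover have "\<phi> (s n) = \<psi> (s n)" for n using s by (simp add: S_def)
    ultimately have "\<phi> x = \<psi> x"
      using x sC star_homD[OF \<phi>] star_homD[OF \<psi>] by (intro B.lim_unique[of "\<lambda>n. \<psi> (s n)"]) simp_all
    then show ?thesis using x by (simp add: S_def)
  qed
  then have "cstar_subalgebra S A"
    using star_homD[OF \<phi>] star_homD[OF \<psi>]
    by (intro cstar_subalgebraI) (auto simp: S_def)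
  moreover have "G \<subseteq> S" using gen eq by (auto simp: S_def generates_def)
  ultimately have "S = carrier A" using gen by (simp add: generates_def)
  then show ?thesis using x by (auto simp: S_def)
qed

section \<open>Expressions in generators and change of carrier\<close>

text \<open>Only countably many scalars are used, so that the expressions are countable while their
  values stay dense.\<close>

datatype star_expr = EGen nat | EOne | EAdd star_expr star_expr | ENeg star_expr
  | EMult star_expr star_expr | EStar star_expr | EScale nat star_expr

instance star_expr :: countable
  by countable_datatype

text \<open>One fixed dense sequence, so that a scalar inside an expression is named by a natural
  number and the same expression makes sense in every algebra.\<close>

definition dense_scalar :: "nat \<Rightarrow> complex" where
  "dense_scalar = (SOME q. \<forall>c e. 0 < e \<longrightarrow> (\<exists>n. cmod (q n - c) < e))"

lemma dense_scalar:
  assumes "0 < e"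
  shows "\<exists>n. cmod (dense_scalar n - c) < e"
proof -
  obtain D :: "complex set" where D: "countable D" "\<And>X. open X \<Longrightarrow> X \<noteq> {} \<Longrightarrow> \<exists>d\<in>D. d \<in> X"
    using countable_dense_exists by blast
  have "\<exists>n. cmod (from_nat_into D n - c) < e" if e: "0 < e" for c e
  proof -
    obtain x where "x \<in> D" "x \<in> ball c e"
      using D(2)[of "ball c e"] e by auto
    then show ?thesis
      using from_nat_into_surj[OF D(1)] by (metis dist_norm dist_commute mem_ball)
  qed
  then have "\<exists>q :: nat \<Rightarrow> complex. \<forall>c e. 0 < e \<longrightarrow> (\<exists>n. cmod (q n - c) < e)" by blast
  then show ?thesis
    unfolding dense_scalar_def using assms someI_ex[of "\<lambda>q. \<forall>c e. 0 < e \<longrightarrow> (\<exists>n. cmod (q n - c) < e)"]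
    by blast
qed

primrec expr_eval :: "'a cstar \<Rightarrow> (nat \<Rightarrow> 'a) \<Rightarrow> star_expr \<Rightarrow> 'a" where
  "expr_eval A g (EGen n) = g n"
| "expr_eval A g EOne = \<one>\<^bsub>A\<^esub>"
| "expr_eval A g (EAdd a b) = expr_eval A g a \<oplus>\<^bsub>A\<^esub> expr_eval A g b"
| "expr_eval A g (ENeg a) = (-1) \<odot>\<^bsub>A\<^esub> expr_eval A g a"
| "expr_eval A g (EMult a b) = expr_eval A g a \<otimes>\<^bsub>A\<^esub> expr_eval A g b"
| "expr_eval A g (EStar a) = star A (expr_eval A g a)"
| "expr_eval A g (EScale n a) = dense_scalar n \<odot>\<^bsub>A\<^esub> expr_eval A g a"

definition expr_closure :: "'a cstar \<Rightarrow> (nat \<Rightarrow> 'a) \<Rightarrow> 'a set" where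
  "expr_closure A g = {x \<in> carrier A. \<exists>e. cstar_lim A (\<lambda>n. expr_eval A g (e n)) x}"

lemma expr_closureI:
  assumes "x \<in> carrier A" "cstar_lim A (\<lambda>n. expr_eval A g (e n)) x"
  shows "x \<in> expr_closure A g"
  using assms by (auto simp: expr_closure_def)

lemma expr_eval_in_subalgebra:
  assumes "cstar_subalgebra S A" "range g \<subseteq> S"
  shows "expr_eval A g e \<in> S"
  using assms(2) by (induction e) (auto intro: cstar_subalgebraD(2-6)[OF assms(1)])

lemma expr_closure_subset:
  assumes "cstar_subalgebra S A" "range g \<subseteq> S"
  shows "expr_closure A g \<subseteq> S"
proof
  fix x assume "x \<in> expr_closure A g"
  then obtain e where "x \<in> carrier A" "cstar_lim A (\<lambda>n. expr_eval A g (e n)) x"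
    by (auto simp: expr_closure_def)
  then show "x \<in> S"
    using expr_eval_in_subalgebra[OF assms] by (rule cstar_subalgebraD(7)[OF assms(1), rotated])
qed

context cstar_algebra
begin

lemma expr_eval_closed [simp]:
  assumes "range g \<subseteq> carrier A"
  shows "expr_eval A g e \<in> carrier A"
  using assms by (induction e) auto

text \<open>The epsilon form spares diagonal sequences: a limit of limits is handled by one triangle
  inequality.\<close>

lemma expr_closure_iff:
  assumes g: "range g \<subseteq> carrier A"
  shows "x \<in> expr_closure A g \<longleftrightarrow>
    x \<in> carrier A \<and> (\<forall>\<epsilon>>0. \<exists>e. nrm A (expr_eval A g e \<ominus> x) < \<epsilon>)" (is "_ \<longleftrightarrow> ?R")
proof
  assume "x \<in> expr_closure A g"
  then obtain e where x: "x \<in> carrier A" and lim: "cstar_lim A (\<lambda>n. expr_eval A g (e n)) x"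
    by (auto simp: expr_closure_def)
  have "\<exists>N. \<forall>n\<ge>N. nrm A (expr_eval A g (e n) \<ominus> x) < \<epsilon>" if "0 < \<epsilon>" for \<epsilon>
    using LIMSEQ_D[OF lim that] g x by (simp add: nrm_nonneg)
  then show ?R using x by blast
next
  assume R: ?R
  then have "\<exists>e. nrm A (expr_eval A g e \<ominus> x) < 1 / Suc n" for n by simp
  then obtain e where e: "\<And>n. nrm A (expr_eval A g (e n) \<ominus> x) < 1 / Suc n" by metis
  have "cstar_lim A (\<lambda>n. expr_eval A g (e n)) x"
  proof (rule Lim_null_comparison)
    show "\<forall>\<^sub>F n in sequentially. norm (nrm A (expr_eval A g (e n) \<ominus> x)) \<le> 1 / Suc n"
      using e R g by (simp add: nrm_nonneg less_imp_le)
    show "(\<lambda>n. 1 / real (Suc n)) \<longlonglongrightarrow> 0"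
      by (rule LIMSEQ_Suc) (rule lim_1_over_n)
  qed
  then show "x \<in> expr_closure A g" using R by (auto simp: expr_closure_def)
qed

lemma expr_eval_in_closure:
  assumes "range g \<subseteq> carrier A"
  shows "expr_eval A g e \<in> expr_closure A g"
  using assms by (auto simp: expr_closure_iff intro!: exI[of _ e])

lemma expr_closure_subalgebra:
  assumes g: "range g \<subseteq> carrier A"
  shows "cstar_subalgebra (expr_closure A g) A"
proof -
  let ?S = "expr_closure A g"
  note [simp] = expr_eval_closed[OF g]
  have add: "x \<oplus> y \<in> ?S" and mult: "x \<otimes> y \<in> ?S" if "x \<in> ?S" "y \<in> ?S" for x y
  proof -
    obtain e where x: "x \<in> carrier A" "cstar_lim A (\<lambda>n. expr_eval A g (e n)) x"
      using \<open>x \<in> ?S\<close> by (auto simp: expr_closure_def)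
    obtain e' where y: "y \<in> carrier A" "cstar_lim A (\<lambda>n. expr_eval A g (e' n)) y"
      using \<open>y \<in> ?S\<close> by (auto simp: expr_closure_def)
    show "x \<oplus> y \<in> ?S"
      by (rule expr_closureI[where e = "\<lambda>n. EAdd (e n) (e' n)"]) (use x y in \<open>simp_all add: lim_add\<close>)
    show "x \<otimes> y \<in> ?S"
      by (rule expr_closureI[where e = "\<lambda>n. EMult (e n) (e' n)"]) (use x y in \<open>simp_all add: lim_mult\<close>)
  qed
  have star: "star A x \<in> ?S" if "x \<in> ?S" for x
  proof -
    obtain e where x: "x \<in> carrier A" "cstar_lim A (\<lambda>n. expr_eval A g (e n)) x"
      using \<open>x \<in> ?S\<close> by (auto simp: expr_closure_def)
    then show ?thesis
      by (intro expr_closureI[where e = "\<lambda>n. EStar (e n)"]) (simp_all add: lim_star)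
  qed
  have one: "\<one> \<in> ?S" using expr_eval_in_closure[OF g, of EOne] by simp
  \<comment> \<open>Arbitrary scalars have no constructor of their own. Approximating multiples of
    the unit is enough, since c x = (c 1) x and products are already covered.\<close>
  have scalar: "c \<odot> \<one> \<in> ?S" for c
    unfolding expr_closure_iff[OF g]
  proof (intro conjI allI impI)
    fix \<epsilon> :: real assume "0 < \<epsilon>"
    then obtain n where n: "cmod (dense_scalar n - c) < \<epsilon>" using dense_scalar by blast
    have "dense_scalar n \<odot> \<one> \<ominus> c \<odot> \<one> = (dense_scalar n - c) \<odot> \<one>"
      using smult_add_left[of \<one> "dense_scalar n" "- c"] by (simp add: minus_smult smult_smult)
    then have "nrm A (expr_eval A g (EScale n EOne) \<ominus> c \<odot> \<one>) \<le> cmod (dense_scalar n - c)"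
      using nrm_one_le by (simp add: nrm_smult mult_left_le nrm_nonneg)
    then show "\<exists>e. nrm A (expr_eval A g e \<ominus> c \<odot> \<one>) < \<epsilon>" using n by (meson le_less_trans)
  qed simp
  have smult: "c \<odot> x \<in> ?S" if "x \<in> ?S" for c x
    using mult[OF scalar[of c] that] that by (simp add: smult_mult_left expr_closure_def)
  have lim: "x \<in> ?S" if s: "\<And>n. s n \<in> ?S" and x: "x \<in> carrier A" and lim: "cstar_lim A s x" for s x
    unfolding expr_closure_iff[OF g]
  proof (intro conjI allI impI x)
    fix \<epsilon> :: real assume \<epsilon>: "0 < \<epsilon>"
    have sC: "s n \<in> carrier A" for n using s by (simp add: expr_closure_def)
    obtain n where n: "nrm A (s n \<ominus> x) < \<epsilon> / 2"
      using LIMSEQ_D[OF lim, of "\<epsilon> / 2"] \<epsilon> sC x by (auto simp: nrm_nonneg)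
    obtain e where e: "nrm A (expr_eval A g e \<ominus> s n) < \<epsilon> / 2"
      using s[of n] \<epsilon> unfolding expr_closure_iff[OF g] by (meson half_gt_zero)
    have "nrm A (expr_eval A g e \<ominus> x) < \<epsilon>"
      using nrm_dist_triangle[of "expr_eval A g e" "s n" x] n e sC x by simp
    then show "\<exists>e. nrm A (expr_eval A g e \<ominus> x) < \<epsilon>" ..
  qed
  show ?thesis
  proof (rule cstar_subalgebraI)
    show "?S \<subseteq> carrier A" by (auto simp: expr_closure_def)
  qed (fact add mult star one smult lim)+
qed

lemma expr_closure_generated:
  assumes "generates A (range g)"
  shows "expr_closure A g = carrier A"
proof -
  have g: "range g \<subseteq> carrier A" using assms by (simp add: generates_def)
  have "range g \<subseteq> expr_closure A g"
    using expr_eval_in_closure[OF g, of "EGen _"] by auto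
  then show ?thesis
    using assms expr_closure_subalgebra[OF g] by (simp add: generates_def)
qed

text \<open>Each element depends on countably many generators only. The union \<open>S\<close> of
  the closures over all sequences in \<open>G\<close> is closed under limits because countably many
  sequences can be merged into one, and it contains each generator by way of a constant
  sequence.\<close>

lemma in_expr_closure_of_generators:
  assumes gen: "generates A G" and ne: "G \<noteq> {}" and x: "x \<in> carrier A"
  obtains g where "range g \<subseteq> G" "x \<in> expr_closure A g"
proof -
  have GC: "G \<subseteq> carrier A" using gen by (simp add: generates_def)
  define S where "S = {x. \<exists>g::nat \<Rightarrow> 'a. range g \<subseteq> G \<and> x \<in> expr_closure A g}"
  have merge: "\<exists>g. range g \<subseteq> G \<and> (\<forall>n. s n \<in> expr_closure A g)" if "\<And>n::nat. s n \<in> S" for s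
  proof -
    have "\<forall>n. \<exists>h. range h \<subseteq> G \<and> s n \<in> expr_closure A h" using that by (auto simp: S_def)
    then obtain h where h: "\<And>n. range (h n) \<subseteq> G" "\<And>n. s n \<in> expr_closure A (h n)" by metis
    define g where "g = (\<lambda>m. case prod_decode m of (n, i) \<Rightarrow> h n i)"
    have gG: "range g \<subseteq> G" using h(1) by (fastforce simp: g_def split: prod.split)
    then have gC: "range g \<subseteq> carrier A" using GC by simp
    have "range (h n) \<subseteq> expr_closure A g" for n
    proof
      fix y assume "y \<in> range (h n)"
      then obtain i where "y = h n i" by blast
      then have "y = expr_eval A g (EGen (prod_encode (n, i)))" by (simp add: g_def)
      then show "y \<in> expr_closure A g" using expr_eval_in_closure[OF gC] by metis
    qed
    then have "s n \<in> expr_closure A g" for n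
      using expr_closure_subset[OF expr_closure_subalgebra[OF gC]] h(2) by blast
    then show ?thesis using gG by blast
  qed
  have pair: "\<exists>g. range g \<subseteq> G \<and> x \<in> expr_closure A g \<and> y \<in> expr_closure A g"
    if "x \<in> S" "y \<in> S" for x y
  proof -
    have "(if n = 0 then x else y) \<in> S" for n :: nat using that by simp
    then obtain g where g: "range g \<subseteq> G" "\<forall>n::nat. (if n = 0 then x else y) \<in> expr_closure A g"
      using merge[of "\<lambda>n. if n = 0 then x else y"] by blast
    from g(1) spec[OF g(2), of 0] spec[OF g(2), of 1] show ?thesis by auto
  qed
  have sub: "cstar_subalgebra (expr_closure A g) A" if "range g \<subseteq> G" for g
    using that GC by (intro expr_closure_subalgebra) simp
  obtain b where b: "b \<in> G" using ne by blast
  have "\<one> \<in> expr_closure A (\<lambda>_. b)" using cstar_subalgebraD(2)[OF sub] b by simp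
  then have one: "\<one> \<in> S" using b by (auto simp: S_def intro!: exI[of _ "\<lambda>_. b"])
  have lim: "x \<in> S" if s: "\<And>n. s n \<in> S" and x: "x \<in> carrier A" and lim: "cstar_lim A s x" for s x
  proof -
    obtain g where g: "range g \<subseteq> G" "\<And>n. s n \<in> expr_closure A g" using merge[of s, OF s] by blast
    have "x \<in> expr_closure A g"
      using g(2) x lim by (rule cstar_subalgebraD(7)[OF sub[OF g(1)]])
    then show ?thesis using g(1) by (auto simp: S_def)
  qed
  have "cstar_subalgebra S A"
  proof (rule cstar_subalgebraI)
    show "S \<subseteq> carrier A" by (auto simp: S_def expr_closure_def)
    show "x \<oplus> y \<in> S" "x \<otimes> y \<in> S" if xy: "x \<in> S" "y \<in> S" for x y
    proof -
      obtain g where g: "range g \<subseteq> G" "x \<in> expr_closure A g" "y \<in> expr_closure A g"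
        using pair[OF xy] by blast
      then show "x \<oplus> y \<in> S" "x \<otimes> y \<in> S"
        using cstar_subalgebraD(3,4)[OF sub[OF g(1)]] unfolding S_def by blast+
    qed
    show "c \<odot> x \<in> S" "star A x \<in> S" if x: "x \<in> S" for c x
    proof -
      obtain g where g: "range g \<subseteq> G" "x \<in> expr_closure A g" using x by (auto simp: S_def)
      then show "c \<odot> x \<in> S" "star A x \<in> S"
        using cstar_subalgebraD(5,6)[OF sub[OF g(1)]] unfolding S_def by blast+
    qed
  qed (fact one lim)+
  moreover have "G \<subseteq> S"
  proof
    fix y assume "y \<in> G"
    moreover from this have "y \<in> expr_closure A (\<lambda>_. y)"
      using expr_eval_in_closure[of "\<lambda>_. y" "EGen 0"] GC by auto
    ultimately show "y \<in> S" by (auto simp: S_def intro!: exI[of _ "\<lambda>_. y"])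
  qed
  ultimately have "S = carrier A" using gen by (simp add: generates_def)
  then show thesis using x that by (auto simp: S_def)
qed

text \<open>An element is determined by a sequence of generators whose expressions approximate it and by
  its distances to the values of these expressions.\<close>

lemma ex_inj_on_generated:
  fixes j :: "'a \<Rightarrow> nat \<Rightarrow> 'b" and k :: "real \<Rightarrow> 'b"
  assumes gen: "generates A G" and ne: "G \<noteq> {}" and j: "inj_on j G" and k: "inj k"
  shows "\<exists>J :: 'a \<Rightarrow> nat \<Rightarrow> 'b. inj_on J (carrier A)"
proof -
  have "\<forall>x\<in>carrier A. \<exists>g. range g \<subseteq> G \<and> x \<in> expr_closure A g"
    using in_expr_closure_of_generators[OF gen ne] by metis
  then obtain g where g: "\<And>x. x \<in> carrier A \<Longrightarrow> range (g x) \<subseteq> G"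
    "\<And>x. x \<in> carrier A \<Longrightarrow> x \<in> expr_closure A (g x)" by metis
  \<comment> \<open>Row 0 of the code stores the distances to the values of all expressions; row i +
    1 stores the \<open>j\<close>-code of the i-th member of the chosen sequence of generators.
    \<open>prod_decode\<close> flattens the rows into one sequence.\<close>
  define J where "J = (\<lambda>x n. case prod_decode n of (i, m) \<Rightarrow>
    if i = 0 then k (nrm A (expr_eval A (g x) (from_nat m) \<ominus> x)) else j (g x (i - 1)) m)"
  have "x = y" if x: "x \<in> carrier A" and y: "y \<in> carrier A" and eq: "J x = J y" for x y
  proof -
    have "j (g x i) m = j (g y i) m" for i m
      using fun_cong[OF eq, of "prod_encode (Suc i, m)"] by (simp add: J_def)
    then have "j (g x i) = j (g y i)" for i by blast
    then have gxy: "g x = g y"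
      using g(1)[OF x] g(1)[OF y] inj_onD[OF j] by blast
    have "k (nrm A (expr_eval A (g x) e \<ominus> x)) = k (nrm A (expr_eval A (g y) e \<ominus> y))" for e
      using fun_cong[OF eq, of "prod_encode (0, to_nat e)"] by (simp add: J_def)
    then have dist: "nrm A (expr_eval A (g x) e \<ominus> x) = nrm A (expr_eval A (g x) e \<ominus> y)" for e
      unfolding gxy using injD[OF k] by blast
    obtain e where e: "cstar_lim A (\<lambda>n. expr_eval A (g x) (e n)) x"
      using g(2)[OF x] by (auto simp: expr_closure_def)
    then have e': "cstar_lim A (\<lambda>n. expr_eval A (g x) (e n)) y" by (simp add: dist)
    have "range (g x) \<subseteq> carrier A" using g(1)[OF x] gen by (auto simp: generates_def)
    then show ?thesis using lim_unique[OF _ x y e e'] by simp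
  qed
  then show ?thesis by (auto simp: inj_on_def)
qed

end

section \<open>Transport of structure along an injection, and homomorphisms from norm bounds\<close>

definition transport_cstar :: "('a \<Rightarrow> 'b) \<Rightarrow> 'a cstar \<Rightarrow> 'b cstar" where
  "transport_cstar J A = (let K = inv_into (carrier A) J in
     \<lparr>carrier = J ` carrier A,
      mult = (\<lambda>x y. J (K x \<otimes>\<^bsub>A\<^esub> K y)),
      one = J \<one>\<^bsub>A\<^esub>,
      zero = J \<zero>\<^bsub>A\<^esub>,
      add = (\<lambda>x y. J (K x \<oplus>\<^bsub>A\<^esub> K y)),
      smult = (\<lambda>c x. J (c \<odot>\<^bsub>A\<^esub> K x)),
      star = (\<lambda>x. J (star A (K x))),
      nrm = (\<lambda>x. nrm A (K x))\<rparr>)"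

context cstar_algebra
begin

lemma transport_cstar:
  assumes J: "inj_on J (carrier A)"
  shows "cstar_algebra (transport_cstar J A)" "J \<in> star_hom A (transport_cstar J A)"
    "inv_into (carrier A) J \<in> star_hom (transport_cstar J A) A"
proof -
  define K where "K = inv_into (carrier A) J"
  have KJ [simp]: "K (J x) = x" if "x \<in> carrier A" for x
    using that J by (simp add: K_def)
  have JK: "\<exists>y\<in>carrier A. x = J y" if "x \<in> J ` carrier A" for x
    using that by blast
  let ?B = "transport_cstar J A"
  have ops [simp]: "carrier ?B = J ` carrier A" "mult ?B = (\<lambda>x y. J (K x \<otimes> K y))"
      "one ?B = J \<one>" "zero ?B = J \<zero>" "add ?B = (\<lambda>x y. J (K x \<oplus> K y))"
      "smult ?B = (\<lambda>c x. J (c \<odot> K x))" "star ?B = (\<lambda>x. J (star A (K x)))"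
      "nrm ?B = (\<lambda>x. nrm A (K x))"
    by (simp_all add: transport_cstar_def K_def Let_def)
  show "cstar_algebra ?B"
  proof (rule cstar_algebraI)
    fix s :: "nat \<Rightarrow> 'b"
    assume s: "\<And>n. s n \<in> carrier ?B"
      and cauchy: "\<And>e. 0 < e \<Longrightarrow>
        \<exists>N. \<forall>m\<ge>N. \<forall>n\<ge>N. nrm ?B (s m \<oplus>\<^bsub>?B\<^esub> (-1) \<odot>\<^bsub>?B\<^esub> s n) < e"
    have "\<forall>n. \<exists>y\<in>carrier A. s n = J y" using s by auto
    then obtain t where t [simp]: "\<And>n. t n \<in> carrier A" "\<And>n. s n = J (t n)" by metis
    have "\<exists>x\<in>carrier A. cstar_lim A t x"
      using cauchy by (intro nrm_complete) (simp_all add: minus_smult)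
    then show "\<exists>x\<in>carrier ?B. (\<lambda>n. nrm ?B (s n \<oplus>\<^bsub>?B\<^esub> (-1) \<odot>\<^bsub>?B\<^esub> x)) \<longlonglongrightarrow> 0"
      by (auto simp: minus_smult)
  qed (auto simp: M.a_assoc m_assoc l_distr r_distr smult_add_left smult_add_right smult_smult
      smult_mult_left smult_mult_right star_add star_smult star_mult nrm_nonneg nrm_triangle
      nrm_smult nrm_mult nrm_star_mult nrm_eq_zero_iff inj_on_eq_iff[OF J]
      intro!: arg_cong[where f = J] M.a_comm simp flip: uminus_smult intro: M.l_neg)
  show "J \<in> star_hom A ?B"
    by (rule star_homI) simp_all
  have "K \<in> star_hom ?B A"
    by (rule star_homI) auto
  then show "inv_into (carrier A) J \<in> star_hom ?B A" by (simp add: K_def)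
qed

end

text \<open>The map is the closure of the assignment sending the value of an expression in
  \<open>g\<close> to its value in \<open>h\<close>. The bound, applied to differences of
  expressions, makes this single-valued and sends Cauchy sequences to Cauchy sequences. It supplies
  homomorphisms out of an algebra that has no universal property at hand.\<close>

lemma ex_star_hom_of_expr_bound:
  assumes "cstar_algebra A" "cstar_algebra B"
    and gen: "generates A (range g)" and h: "range h \<subseteq> carrier B"
    and bound: "\<And>e. nrm B (expr_eval B h e) \<le> nrm A (expr_eval A g e)"
  shows "\<exists>\<phi>\<in>star_hom A B. \<forall>n. \<phi> (g n) = h n"
proof -
  interpret A: cstar_algebra A by fact
  interpret B: cstar_algebra B by fact
  have g: "range g \<subseteq> carrier A" using gen by (simp add: generates_def)
  note [simp] = A.expr_eval_closed[OF g] B.expr_eval_closed[OF h]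
  \<comment> \<open>The closure of the graph: one and the same sequence of expressions has to
    converge on both sides. Proving the algebraic rules for the relation keeps choices of
    approximating sequences out of the definition of the map.\<close>
  define R where "R = (\<lambda>x y. x \<in> carrier A \<and> y \<in> carrier B \<and>
    (\<exists>e. cstar_lim A (\<lambda>n. expr_eval A g (e n)) x \<and> cstar_lim B (\<lambda>n. expr_eval B h (e n)) y))"
  have RC: "x \<in> carrier A" "y \<in> carrier B" if "R x y" for x y
    using that by (auto simp: R_def)
  have RI: "R x y" if "x \<in> carrier A" "y \<in> carrier B"
      "cstar_lim A (\<lambda>n. expr_eval A g (e n)) x" "cstar_lim B (\<lambda>n. expr_eval B h (e n)) y" for x y e
    using that by (auto simp: R_def)
  have R_eval: "R (expr_eval A g e) (expr_eval B h e)" for e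
    by (rule RI[where e = "\<lambda>n. e"]) simp_all
  have R_add: "R (x \<oplus>\<^bsub>A\<^esub> x') (y \<oplus>\<^bsub>B\<^esub> y')" and R_mult: "R (x \<otimes>\<^bsub>A\<^esub> x') (y \<otimes>\<^bsub>B\<^esub> y')"
    if "R x y" "R x' y'" for x y x' y'
  proof -
    obtain e where e: "cstar_lim A (\<lambda>n. expr_eval A g (e n)) x" "cstar_lim B (\<lambda>n. expr_eval B h (e n)) y"
      using \<open>R x y\<close> by (auto simp: R_def)
    obtain e' where e': "cstar_lim A (\<lambda>n. expr_eval A g (e' n)) x'" "cstar_lim B (\<lambda>n. expr_eval B h (e' n)) y'"
      using \<open>R x' y'\<close> by (auto simp: R_def)
    note C [simp] = RC[OF \<open>R x y\<close>] RC[OF \<open>R x' y'\<close>]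
    show "R (x \<oplus>\<^bsub>A\<^esub> x') (y \<oplus>\<^bsub>B\<^esub> y')"
      by (rule RI[where e = "\<lambda>n. EAdd (e n) (e' n)"]) (simp_all add: A.lim_add B.lim_add e e')
    show "R (x \<otimes>\<^bsub>A\<^esub> x') (y \<otimes>\<^bsub>B\<^esub> y')"
      by (rule RI[where e = "\<lambda>n. EMult (e n) (e' n)"]) (simp_all add: A.lim_mult B.lim_mult e e')
  qed
  have R_star: "R (star A x) (star B y)" and R_neg: "R ((-1) \<odot>\<^bsub>A\<^esub> x) ((-1) \<odot>\<^bsub>B\<^esub> y)"
    if "R x y" for x y
  proof -
    obtain e where e: "cstar_lim A (\<lambda>n. expr_eval A g (e n)) x" "cstar_lim B (\<lambda>n. expr_eval B h (e n)) y"
      using \<open>R x y\<close> by (auto simp: R_def)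
    note C [simp] = RC[OF \<open>R x y\<close>]
    show "R (star A x) (star B y)"
      by (rule RI[where e = "\<lambda>n. EStar (e n)"]) (simp_all add: A.lim_star B.lim_star e)
    show "R ((-1) \<odot>\<^bsub>A\<^esub> x) ((-1) \<odot>\<^bsub>B\<^esub> y)"
      by (rule RI[where e = "\<lambda>n. ENeg (e n)"]) (simp_all add: A.lim_smult B.lim_smult e)
  qed
  \<comment> \<open>One sequence of indices approximates the scalar in both algebras; general
    multiples follow by multiplication.\<close>
  have R_scalar: "R (c \<odot>\<^bsub>A\<^esub> \<one>\<^bsub>A\<^esub>) (c \<odot>\<^bsub>B\<^esub> \<one>\<^bsub>B\<^esub>)" for c
  proof -
    have "\<exists>m. cmod (dense_scalar m - c) < 1 / Suc n" for n by (rule dense_scalar) simp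
    then obtain m where m: "\<And>n. cmod (dense_scalar (m n) - c) < 1 / Suc n" by metis
    have "(\<lambda>n. dense_scalar (m n) - c) \<longlonglongrightarrow> 0"
    proof (rule Lim_null_comparison)
      show "\<forall>\<^sub>F n in sequentially. cmod (dense_scalar (m n) - c) \<le> 1 / real (Suc n)"
        using m by (simp add: less_imp_le)
      show "(\<lambda>n. 1 / real (Suc n)) \<longlonglongrightarrow> 0"
        by (rule LIMSEQ_Suc) (rule lim_1_over_n)
    qed
    then have lim: "(\<lambda>n. cmod (dense_scalar (m n) - c) * K) \<longlonglongrightarrow> 0" for K
      by (intro tendsto_mult_left_zero tendsto_norm_zero)
    have diff: "nrm D (a \<odot>\<^bsub>D\<^esub> \<one>\<^bsub>D\<^esub> \<ominus>\<^bsub>D\<^esub> c \<odot>\<^bsub>D\<^esub> \<one>\<^bsub>D\<^esub>) = cmod (a - c) * nrm D \<one>\<^bsub>D\<^esub>"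
      if "cstar_algebra D" for D :: "'x cstar" and a
    proof -
      interpret D: cstar_algebra D by fact
      show ?thesis
        using D.smult_add_left[of "\<one>\<^bsub>D\<^esub>" a "- c"] D.nrm_smult[of "\<one>\<^bsub>D\<^esub>" "a - c"]
        by (simp add: D.minus_smult D.smult_smult)
    qed
    show ?thesis
      by (rule RI[where e = "\<lambda>n. EScale (m n) EOne"])
        (use lim in \<open>simp_all add: diff[OF assms(1)] diff[OF assms(2)]\<close>)
  qed
  have R_smult: "R (c \<odot>\<^bsub>A\<^esub> x) (c \<odot>\<^bsub>B\<^esub> y)" if "R x y" for c x y
    using R_mult[OF R_scalar that, of c] RC[OF that] by (simp add: A.smult_mult_left B.smult_mult_left)
  have R_le: "nrm B y \<le> nrm A x" if "R x y" for x y
  proof -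
    obtain e where e: "cstar_lim A (\<lambda>n. expr_eval A g (e n)) x" "cstar_lim B (\<lambda>n. expr_eval B h (e n)) y"
      using \<open>R x y\<close> by (auto simp: R_def)
    show ?thesis
      by (rule LIMSEQ_le[OF B.lim_nrm[OF _ _ e(2)] A.lim_nrm[OF _ _ e(1)]])
        (use RC[OF that] bound in auto)
  qed
  have R_unique: "y = y'" if "R x y" "R x y'" for x y y'
  proof -
    have "R (x \<ominus>\<^bsub>A\<^esub> x) (y \<ominus>\<^bsub>B\<^esub> y')"
      using R_add[OF that(1) R_neg[OF that(2)]] RC[OF that(1)] RC[OF that(2)]
      by (simp add: A.minus_smult B.minus_smult)
    then have "nrm B (y \<ominus>\<^bsub>B\<^esub> y') \<le> 0" using R_le RC[OF that(1)] by fastforce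
    then show ?thesis
      using RC(2)[OF that(1)] RC(2)[OF that(2)] B.nrm_nonneg[of "y \<ominus>\<^bsub>B\<^esub> y'"]
        B.nrm_minus_eq_zero[of y y'] by simp
  qed
  have R_ex: "\<exists>y. R x y" if x: "x \<in> carrier A" for x
  proof -
    obtain e where e: "cstar_lim A (\<lambda>n. expr_eval A g (e n)) x"
      using A.expr_closure_generated[OF gen] x by (auto simp: expr_closure_def)
    \<comment> \<open>\<open>ENeg\<close> makes the difference of two expressions an expression,
      although -1 need not occur in the dense sequence of scalars.\<close>
    have le: "nrm B (expr_eval B h a \<ominus>\<^bsub>B\<^esub> expr_eval B h b)
        \<le> nrm A (expr_eval A g a \<ominus>\<^bsub>A\<^esub> expr_eval A g b)" for a b
      using bound[of "EAdd a (ENeg b)"] by (simp add: A.minus_smult B.minus_smult)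
    have "\<exists>y\<in>carrier B. cstar_lim B (\<lambda>n. expr_eval B h (e n)) y"
    proof (rule B.nrm_complete)
      fix \<epsilon> :: real assume "0 < \<epsilon>"
      then show "\<exists>N. \<forall>m\<ge>N. \<forall>n\<ge>N. nrm B (expr_eval B h (e m) \<ominus>\<^bsub>B\<^esub> expr_eval B h (e n)) < \<epsilon>"
        using A.lim_Cauchy[OF _ x e] le by (meson le_less_trans A.expr_eval_closed[OF g])
    qed simp
    then show ?thesis using x e by (auto simp: R_def)
  qed
  define \<phi> where "\<phi> = (\<lambda>x. THE y. R x y)"
  have R_iff: "\<phi> x = y" if "R x y" for x y
    unfolding \<phi>_def using that R_unique by blast
  have R\<phi>: "R x (\<phi> x)" if "x \<in> carrier A" for x
    using R_ex[OF that] R_iff by metis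
  have "\<phi> \<in> star_hom A B"
    using R\<phi> RC(2)[OF R\<phi>] R_add R_mult R_star R_smult R_eval[of EOne]
    by (intro star_homI R_iff) simp_all
  moreover have "\<phi> (g n) = h n" for n
    using R_eval[of "EGen n"] by (intro R_iff) simp
  ultimately show ?thesis by blast
qed

section \<open>Continuous functions on the circle\<close>

lemma circle_algebra_simps [simp]:
  "h \<in> carrier circle_algebra \<longleftrightarrow> h \<in> extensional circle \<and> continuous_on circle h"
  "h \<otimes>\<^bsub>circle_algebra\<^esub> k = (\<lambda>\<zeta>\<in>circle. h \<zeta> * k \<zeta>)"
  "\<one>\<^bsub>circle_algebra\<^esub> = (\<lambda>\<zeta>\<in>circle. 1)"
  "\<zero>\<^bsub>circle_algebra\<^esub> = (\<lambda>\<zeta>\<in>circle. 0)"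
  "h \<oplus>\<^bsub>circle_algebra\<^esub> k = (\<lambda>\<zeta>\<in>circle. h \<zeta> + k \<zeta>)"
  "c \<odot>\<^bsub>circle_algebra\<^esub> h = (\<lambda>\<zeta>\<in>circle. c * h \<zeta>)"
  "star circle_algebra h = (\<lambda>\<zeta>\<in>circle. cnj (h \<zeta>))"
  by (simp_all add: circle_algebra_def)

text \<open>The left-hand side is how the simplifier normalises continuity of a function
  restricted to the circle.\<close>

lemma continuous_on_circle_if [simp]:
  "continuous_on circle (\<lambda>\<zeta>. if cmod \<zeta> = 1 then h \<zeta> else c) \<longleftrightarrow> continuous_on circle h"
  by (rule continuous_on_cong) simp_all

lemma restrict_in_circle_algebra:
  "continuous_on circle h \<Longrightarrow> restrict h circle \<in> carrier circle_algebra"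
  by simp

text \<open>Compactness of the circle turns the supremum into a maximum, so that norms are compared
  at a single point and the supremum need not be unfolded again.\<close>

lemma nrm_circle_attained:
  assumes h: "continuous_on circle h"
  obtains \<zeta> where "\<zeta> \<in> circle" "nrm circle_algebra h = cmod (h \<zeta>)"
    "\<And>\<xi>. \<xi> \<in> circle \<Longrightarrow> cmod (h \<xi>) \<le> nrm circle_algebra h"
proof -
  have "continuous_on circle (\<lambda>\<zeta>. cmod (h \<zeta>))" using h by (intro continuous_intros)
  then obtain \<zeta> where \<zeta>: "\<zeta> \<in> circle" "\<And>\<xi>. \<xi> \<in> circle \<Longrightarrow> cmod (h \<xi>) \<le> cmod (h \<zeta>)"
    using continuous_attains_sup[of circle "\<lambda>\<zeta>. cmod (h \<zeta>)"] by auto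
  have "nrm circle_algebra h = cmod (h \<zeta>)"
    using \<zeta> by (auto simp: circle_algebra_def intro!: cSup_eq_maximum)
  then show thesis using that \<zeta> by simp
qed

lemma nrm_circle_ge:
  "continuous_on circle h \<Longrightarrow> \<zeta> \<in> circle \<Longrightarrow> cmod (h \<zeta>) \<le> nrm circle_algebra h"
  using nrm_circle_attained by blast

lemma nrm_circle_le:
  assumes "continuous_on circle h" "\<And>\<zeta>. \<zeta> \<in> circle \<Longrightarrow> cmod (h \<zeta>) \<le> B"
  shows "nrm circle_algebra h \<le> B"
  using nrm_circle_attained[OF assms(1)] assms(2) by metis

lemma cstar_algebra_circle: "cstar_algebra circle_algebra"
proof (rule cstar_algebraI)
  fix h :: "complex \<Rightarrow> complex" assume "h \<in> carrier circle_algebra"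
  then have h: "h \<in> extensional circle" "continuous_on circle h" by auto
  obtain \<zeta> where \<zeta>: "\<zeta> \<in> circle" "nrm circle_algebra h = cmod (h \<zeta>)"
    "\<And>\<xi>. \<xi> \<in> circle \<Longrightarrow> cmod (h \<xi>) \<le> nrm circle_algebra h"
    using nrm_circle_attained[OF h(2)] by metis
  show "0 \<le> nrm circle_algebra h" using \<zeta> by simp
  show "nrm circle_algebra h = 0 \<longleftrightarrow> h = \<zero>\<^bsub>circle_algebra\<^esub>"
    using \<zeta> h by (auto intro!: extensionalityI[of _ circle])
  show "nrm circle_algebra (c \<odot>\<^bsub>circle_algebra\<^esub> h) = cmod c * nrm circle_algebra h" for c
  proof (rule antisym)
    have cont: "continuous_on circle (c \<odot>\<^bsub>circle_algebra\<^esub> h)"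
      using h by (auto intro!: continuous_intros)
    show "nrm circle_algebra (c \<odot>\<^bsub>circle_algebra\<^esub> h) \<le> cmod c * nrm circle_algebra h"
      using \<zeta> by (intro nrm_circle_le[OF cont]) (auto simp: norm_mult intro!: mult_left_mono)
    show "cmod c * nrm circle_algebra h \<le> nrm circle_algebra (c \<odot>\<^bsub>circle_algebra\<^esub> h)"
      using nrm_circle_ge[OF cont \<zeta>(1)] \<zeta> by (simp add: norm_mult)
  qed
  show "nrm circle_algebra (star circle_algebra h \<otimes>\<^bsub>circle_algebra\<^esub> h) = (nrm circle_algebra h)\<^sup>2"
  proof (rule antisym)
    have cont: "continuous_on circle (star circle_algebra h \<otimes>\<^bsub>circle_algebra\<^esub> h)"
      using h by (auto intro!: continuous_intros)
    show "nrm circle_algebra (star circle_algebra h \<otimes>\<^bsub>circle_algebra\<^esub> h) \<le> (nrm circle_algebra h)\<^sup>2"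
      using \<zeta> by (intro nrm_circle_le[OF cont]) (auto simp: norm_mult power2_eq_square intro!: mult_mono)
    show "(nrm circle_algebra h)\<^sup>2 \<le> nrm circle_algebra (star circle_algebra h \<otimes>\<^bsub>circle_algebra\<^esub> h)"
      using nrm_circle_ge[OF cont \<zeta>(1)] \<zeta> by (simp add: norm_mult power2_eq_square)
  qed
next
  fix h k :: "complex \<Rightarrow> complex"
  assume "h \<in> carrier circle_algebra" "k \<in> carrier circle_algebra"
  then have h: "continuous_on circle h" and k: "continuous_on circle k" by auto
  show "nrm circle_algebra (h \<oplus>\<^bsub>circle_algebra\<^esub> k) \<le> nrm circle_algebra h + nrm circle_algebra k"
    using h k by (intro nrm_circle_le)
      (auto intro!: continuous_intros norm_triangle_le add_mono nrm_circle_ge)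
  have "0 \<le> nrm circle_algebra h"
    using nrm_circle_ge[OF h, of 1] norm_ge_zero[of "h 1"] by (simp del: norm_ge_zero)
  then show "nrm circle_algebra (h \<otimes>\<^bsub>circle_algebra\<^esub> k) \<le> nrm circle_algebra h * nrm circle_algebra k"
    using h k by (intro nrm_circle_le)
      (auto simp: norm_mult intro!: continuous_intros mult_mono nrm_circle_ge)
next
  fix s :: "nat \<Rightarrow> complex \<Rightarrow> complex"
  assume s: "\<And>n. s n \<in> carrier circle_algebra"
    and cauchy: "\<And>e. 0 < e \<Longrightarrow> \<exists>N. \<forall>m\<ge>N. \<forall>n\<ge>N.
      nrm circle_algebra (s m \<oplus>\<^bsub>circle_algebra\<^esub> (-1) \<odot>\<^bsub>circle_algebra\<^esub> s n) < e"
  have sc: "continuous_on circle (s n)" for n using s by simp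
  \<comment> \<open>Cauchy in the supremum norm means uniformly Cauchy, and the uniform limit is
    continuous; it is then cut down to the circle to be extensional.\<close>
  have "uniformly_Cauchy_on circle s"
    unfolding uniformly_Cauchy_on_def
  proof (intro allI impI)
    fix e :: real assume "0 < e"
    then obtain N where N: "nrm circle_algebra (s m \<oplus>\<^bsub>circle_algebra\<^esub> (-1) \<odot>\<^bsub>circle_algebra\<^esub> s n) < e"
      if "m \<ge> N" "n \<ge> N" for m n using cauchy by meson
    have "dist (s m \<zeta>) (s n \<zeta>) < e" if mn: "m \<ge> N" "n \<ge> N" and \<zeta>: "\<zeta> \<in> circle" for m n \<zeta>
    proof -
      have "continuous_on circle (s m \<oplus>\<^bsub>circle_algebra\<^esub> (-1) \<odot>\<^bsub>circle_algebra\<^esub> s n)"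
        using sc by (auto intro!: continuous_intros)
      from nrm_circle_ge[OF this \<zeta>] N[OF mn] \<zeta> show ?thesis by (simp add: dist_norm)
    qed
    then show "\<exists>M. \<forall>x\<in>circle. \<forall>m\<ge>M. \<forall>n\<ge>M. dist (s m x) (s n x) < e" by blast
  qed
  then obtain l where l: "uniform_limit circle s l sequentially"
    using Cauchy_uniformly_convergent uniformly_convergent_on_def by blast
  then have lc: "continuous_on circle l"
    using sc by (intro uniform_limit_theorem[where f = s]) (auto intro: always_eventually)
  have cont: "continuous_on circle (s n \<oplus>\<^bsub>circle_algebra\<^esub> (-1) \<odot>\<^bsub>circle_algebra\<^esub> restrict l circle)" for n
    using sc lc by (auto intro!: continuous_intros)
  have "(\<lambda>n. nrm circle_algebra (s n \<oplus>\<^bsub>circle_algebra\<^esub> (-1) \<odot>\<^bsub>circle_algebra\<^esub> restrict l circle)) \<longlonglongrightarrow> 0"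
  proof (rule LIMSEQ_I)
    fix e :: real assume "0 < e"
    then obtain N where N: "\<And>n \<zeta>. n \<ge> N \<Longrightarrow> \<zeta> \<in> circle \<Longrightarrow> dist (s n \<zeta>) (l \<zeta>) < e"
      using l unfolding uniform_limit_iff eventually_sequentially by meson
    have "norm (nrm circle_algebra (s n \<oplus>\<^bsub>circle_algebra\<^esub> (-1) \<odot>\<^bsub>circle_algebra\<^esub> restrict l circle)) < e"
      if n: "n \<ge> N" for n
    proof -
      obtain \<zeta> where "\<zeta> \<in> circle" "nrm circle_algebra (s n \<oplus>\<^bsub>circle_algebra\<^esub> (-1) \<odot>\<^bsub>circle_algebra\<^esub> restrict l circle)
          = cmod ((s n \<oplus>\<^bsub>circle_algebra\<^esub> (-1) \<odot>\<^bsub>circle_algebra\<^esub> restrict l circle) \<zeta>)"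
        using nrm_circle_attained[OF cont] by metis
      then show ?thesis using N[OF n] by (simp add: dist_norm)
    qed
    then show "\<exists>N. \<forall>n\<ge>N. norm (nrm circle_algebra
        (s n \<oplus>\<^bsub>circle_algebra\<^esub> (-1) \<odot>\<^bsub>circle_algebra\<^esub> restrict l circle) - 0) < e" by auto
  qed
  moreover have "restrict l circle \<in> carrier circle_algebra" using lc by simp
  ultimately show "\<exists>x\<in>carrier circle_algebra.
      (\<lambda>n. nrm circle_algebra (s n \<oplus>\<^bsub>circle_algebra\<^esub> (-1) \<odot>\<^bsub>circle_algebra\<^esub> x)) \<longlonglongrightarrow> 0"
    by blast
qed (auto simp: algebra_simps intro!: continuous_intros extensionalityI[of _ circle] restrict_ext)

abbreviation circle_id :: "complex \<Rightarrow> complex" where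
  "circle_id \<equiv> \<lambda>\<zeta>\<in>circle. \<zeta>"

text \<open>Stone-Weierstrass in its real form: Re h and Im h are approximated by real polynomial
  functions, and on the circle these are polynomials in the identity function and its conjugate, so
  they lie in every C*-subalgebra containing the identity function.\<close>

lemma generates_circle_algebra: "generates circle_algebra {circle_id}"
  unfolding generates_def
proof (intro conjI allI impI)
  show "{circle_id} \<subseteq> carrier circle_algebra"
    using restrict_in_circle_algebra[OF continuous_on_id] by blast
  fix S assume "cstar_subalgebra S circle_algebra \<and> {circle_id} \<subseteq> S"
  then have sub: "cstar_subalgebra S circle_algebra" and idS: "circle_id \<in> S" by auto
  interpret cstar_algebra circle_algebra by (rule cstar_algebra_circle)
  have SC: "S \<subseteq> carrier circle_algebra" and oneS: "(\<lambda>\<zeta>\<in>circle. 1) \<in> S"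
    using cstar_subalgebraD(1,2)[OF sub] by simp_all
  have S_add: "(\<lambda>\<zeta>\<in>circle. h \<zeta> + k \<zeta>) \<in> S" and S_mult: "(\<lambda>\<zeta>\<in>circle. h \<zeta> * k \<zeta>) \<in> S"
    if "restrict h circle \<in> S" "restrict k circle \<in> S" for h k
  proof -
    have "restrict h circle \<oplus>\<^bsub>circle_algebra\<^esub> restrict k circle \<in> S"
      "restrict h circle \<otimes>\<^bsub>circle_algebra\<^esub> restrict k circle \<in> S"
      using that by (auto intro: cstar_subalgebraD(3,4)[OF sub] simp del: circle_algebra_simps)
    then show "(\<lambda>\<zeta>\<in>circle. h \<zeta> + k \<zeta>) \<in> S" "(\<lambda>\<zeta>\<in>circle. h \<zeta> * k \<zeta>) \<in> S"
      by (simp_all cong: restrict_cong)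
  qed
  have S_smult: "(\<lambda>\<zeta>\<in>circle. c * h \<zeta>) \<in> S" if "restrict h circle \<in> S" for h c
  proof -
    have "c \<odot>\<^bsub>circle_algebra\<^esub> restrict h circle \<in> S"
      using that by (rule cstar_subalgebraD(5)[OF sub])
    then show ?thesis by (simp cong: restrict_cong)
  qed
  have "star circle_algebra circle_id \<in> S"
    using idS by (rule cstar_subalgebraD(6)[OF sub])
  then have cnjS: "(\<lambda>\<zeta>\<in>circle. cnj \<zeta>) \<in> S" by (simp cong: restrict_cong)
  have poly: "(\<lambda>\<zeta>\<in>circle. of_real (p \<zeta>)) \<in> S"
    if "real_polynomial_function p" for p :: "complex \<Rightarrow> real"
    using that
  proof induction
    case (linear p)
    interpret bounded_linear p by fact
    define a b where "a = complex_of_real (p 1)" and "b = complex_of_real (p \<i>)"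
    \<comment> \<open>A real-linear p has the value Re(zeta) p(1) + Im(zeta) p(i); the coefficients
      come from expressing Re and Im through zeta and its conjugate.\<close>
    have "complex_of_real (p \<zeta>) = ((a - \<i> * b) / 2) * \<zeta> + ((a + \<i> * b) / 2) * cnj \<zeta>" for \<zeta>
    proof -
      have "\<zeta> = Re \<zeta> *\<^sub>R 1 + Im \<zeta> *\<^sub>R \<i>" by (simp add: complex_eq_iff)
      then have "p \<zeta> = Re \<zeta> * p 1 + Im \<zeta> * p \<i>" by (metis add scaleR real_scaleR_def)
      then show ?thesis by (simp add: complex_eq_iff a_def b_def field_simps)
    qed
    then show ?case
      using S_add[OF S_smult[OF idS, of "(a - \<i> * b) / 2"] S_smult[OF cnjS, of "(a + \<i> * b) / 2"]]
      by (simp only:)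
  next
    case (const c)
    show ?case using S_smult[OF oneS, of "of_real c"] by (simp only: mult_1_right)
  next
    case (add p q)
    then show ?case unfolding of_real_add by (intro S_add)
  next
    case (mult p q)
    then show ?case unfolding of_real_mult by (intro S_mult)
  qed
  have "h \<in> S" if h: "h \<in> carrier circle_algebra" for h
  proof -
    have hc: "continuous_on circle h" and he: "h \<in> extensional circle" using h by auto
    have "\<exists>k\<in>S. nrm circle_algebra (k \<ominus>\<^bsub>circle_algebra\<^esub> h) < e" if e: "0 < e" for e
    proof -
      obtain p where p: "real_polynomial_function p" "\<And>\<zeta>. \<zeta> \<in> circle \<Longrightarrow> \<bar>Re (h \<zeta>) - p \<zeta>\<bar> < e / 2"
        using Stone_Weierstrass_real_polynomial_function[of circle "\<lambda>\<zeta>. Re (h \<zeta>)" "e / 2"] hc e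
        by (auto intro!: continuous_intros)
      obtain q where q: "real_polynomial_function q" "\<And>\<zeta>. \<zeta> \<in> circle \<Longrightarrow> \<bar>Im (h \<zeta>) - q \<zeta>\<bar> < e / 2"
        using Stone_Weierstrass_real_polynomial_function[of circle "\<lambda>\<zeta>. Im (h \<zeta>)" "e / 2"] hc e
        by (auto intro!: continuous_intros)
      define k where "k = (\<lambda>\<zeta>\<in>circle. complex_of_real (p \<zeta>) + \<i> * complex_of_real (q \<zeta>))"
      have kS: "k \<in> S" unfolding k_def by (intro S_add S_smult poly p q)
      then have kC: "k \<in> carrier circle_algebra" using SC by blast
      have cont: "continuous_on circle (k \<ominus>\<^bsub>circle_algebra\<^esub> h)"
        using M.minus_closed[OF kC h] by simp
      obtain \<zeta> where \<zeta>: "\<zeta> \<in> circle" "nrm circle_algebra (k \<ominus>\<^bsub>circle_algebra\<^esub> h) = cmod ((k \<ominus>\<^bsub>circle_algebra\<^esub> h) \<zeta>)"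
        using nrm_circle_attained[OF cont] by metis
      have "cmod ((k \<ominus>\<^bsub>circle_algebra\<^esub> h) \<zeta>) = cmod (k \<zeta> - h \<zeta>)"
        using \<zeta>(1) unfolding minus_smult[OF kC h] by simp
      also have "\<dots> \<le> \<bar>Re (k \<zeta> - h \<zeta>)\<bar> + \<bar>Im (k \<zeta> - h \<zeta>)\<bar>" by (rule cmod_le)
      also have "\<dots> < e"
        using p(2)[OF \<zeta>(1)] q(2)[OF \<zeta>(1)] \<zeta>(1) by (simp add: k_def abs_minus_commute)
      finally have "nrm circle_algebra (k \<ominus>\<^bsub>circle_algebra\<^esub> h) < e" unfolding \<zeta>(2) .
      then show ?thesis using kS by blast
    qed
    then have "\<exists>k\<in>S. nrm circle_algebra (k \<ominus>\<^bsub>circle_algebra\<^esub> h) < 1 / Suc n" for n by simp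
    then obtain k where k: "\<And>n. k n \<in> S"
      "\<And>n. nrm circle_algebra (k n \<ominus>\<^bsub>circle_algebra\<^esub> h) < 1 / Suc n" by metis
    have "cstar_lim circle_algebra k h"
    proof (rule Lim_null_comparison)
      show "\<forall>\<^sub>F n in sequentially. norm (nrm circle_algebra (k n \<ominus>\<^bsub>circle_algebra\<^esub> h)) \<le> 1 / real (Suc n)"
      proof (rule always_eventually, rule allI)
        fix n
        have "k n \<in> carrier circle_algebra" using k(1) SC by blast
        then have "0 \<le> nrm circle_algebra (k n \<ominus>\<^bsub>circle_algebra\<^esub> h)"
          using h by (intro nrm_nonneg M.minus_closed)
        then show "norm (nrm circle_algebra (k n \<ominus>\<^bsub>circle_algebra\<^esub> h)) \<le> 1 / real (Suc n)"
          using k(2)[of n] by simp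
      qed
      show "(\<lambda>n. 1 / real (Suc n)) \<longlonglongrightarrow> 0"
        by (rule LIMSEQ_Suc) (rule lim_1_over_n)
    qed
    then show ?thesis by (rule cstar_subalgebraD(7)[of S circle_algebra k h, OF sub k(1) h])
  qed
  then show "S = carrier circle_algebra" using SC by blast
qed

section \<open>Polynomials in a unitary\<close>

text \<open>Cauchy's estimate at the centre of the unit disc: the n-th derivative there is n! times
  the coefficient, the factorials cancel, and radius 1 leaves no power behind.\<close>

lemma cmod_coeff_le:
  fixes p :: "complex poly"
  assumes "\<And>\<zeta>. \<zeta> \<in> circle \<Longrightarrow> cmod (poly p \<zeta>) \<le> B"
  shows "cmod (coeff p n) \<le> B"
proof -
  have "(deriv ^^ n) (poly p) = poly ((pderiv ^^ n) p)"
  proof (induction n)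
    case (Suc n)
    have "deriv (poly q) = poly (pderiv q)" for q :: "complex poly"
      by (rule ext) (rule DERIV_imp_deriv[OF poly_DERIV])
    then show ?case by (simp add: Suc)
  qed simp
  then have "(deriv ^^ n) (poly p) 0 = fact n * coeff p n"
    using coeff_higher_pderiv[of n p 0] by (simp add: poly_0_coeff_0 pochhammer_fact)
  moreover have "cmod ((deriv ^^ n) (poly p) 0) \<le> fact n * B / 1 ^ n"
    using assms
    by (intro Cauchy_inequality) (auto simp: dist_norm intro!: holomorphic_intros continuous_intros)
  ultimately show ?thesis by (simp add: norm_mult)
qed

text \<open>If M < N, dividing by the power of N gives that 1 is at most (n D + 1) q^n with q = M/N
  < 1, which tends to 0. Exponents are powers of two because norms of normal elements are followed
  through repeated squaring.\<close>

lemma le_if_powers_le_linear_growth: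
  fixes N M D :: real
  assumes N: "0 \<le> N" and M: "0 \<le> M"
    and le: "\<And>k::nat. N ^ (2 ^ k) \<le> (2 ^ k * D + 1) * M ^ (2 ^ k)"
  shows "N \<le> M"
proof (rule ccontr)
  assume "\<not> N \<le> M"
  then have "M < N" by simp
  define q where "q = M / N"
  have q: "0 \<le> q" "q < 1" using \<open>M < N\<close> M by (simp_all add: q_def)
  have "(\<lambda>n. D * (of_nat n * q ^ n) + q ^ n) \<longlonglongrightarrow> D * 0 + 0"
    using q by (intro tendsto_intros powser_times_n_limit_0 LIMSEQ_realpow_zero) simp_all
  then obtain n0 where n0: "\<And>n. n \<ge> n0 \<Longrightarrow> D * (of_nat n * q ^ n) + q ^ n < 1"
    using LIMSEQ_D[of _ "0::real" 1] by (force simp: abs_less_iff)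
  \<comment> \<open>The limit runs through all n, the hypothesis only through powers of two; this is
    a power of two beyond \<open>n0\<close>.\<close>
  have "n0 \<le> 2 ^ n0" by (simp add: less_imp_le)
  from n0[OF this] have lt: "(2 ^ n0 * D + 1) * q ^ (2 ^ n0) < 1"
    by (simp add: algebra_simps)
  have pos: "0 < N ^ (2 ^ n0)" using \<open>M < N\<close> M by simp
  have "N ^ (2 ^ n0) \<le> (2 ^ n0 * D + 1) * (q * N) ^ (2 ^ n0)"
    using le[of n0] \<open>M < N\<close> M by (simp add: q_def)
  also have "\<dots> = ((2 ^ n0 * D + 1) * q ^ (2 ^ n0)) * N ^ (2 ^ n0)"
    by (simp add: power_mult_distrib)
  also have "\<dots> < 1 * N ^ (2 ^ n0)"
    using lt pos by (intro mult_strict_right_mono)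
  finally show False by simp
qed

text \<open>Horner's scheme, with constants embedded as multiples of the unit of
  \<open>A\<close>.\<close>

definition poly_eval :: "'a cstar \<Rightarrow> 'a \<Rightarrow> complex poly \<Rightarrow> 'a" where
  "poly_eval A x p = fold_coeffs (\<lambda>a y. a \<odot>\<^bsub>A\<^esub> \<one>\<^bsub>A\<^esub> \<oplus>\<^bsub>A\<^esub> x \<otimes>\<^bsub>A\<^esub> y) p \<zero>\<^bsub>A\<^esub>"

lemma unitaryD:
  assumes "unitary A x"
  shows "x \<in> carrier A" "star A x \<otimes>\<^bsub>A\<^esub> x = \<one>\<^bsub>A\<^esub>" "x \<otimes>\<^bsub>A\<^esub> star A x = \<one>\<^bsub>A\<^esub>"
  using assms by (simp_all add: unitary_def)

context cstar_algebra
begin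

lemma unitary_one: "unitary A \<one>"
  by (simp add: unitary_def)

lemma unitary_mult:
  assumes x: "unitary A x" and y: "unitary A y"
  shows "unitary A (x \<otimes> y)"
proof -
  note [simp] = unitaryD(1)[OF x] unitaryD(1)[OF y]
  have "star A y \<otimes> star A x \<otimes> (x \<otimes> y) = star A y \<otimes> (star A x \<otimes> x) \<otimes> y"
    "x \<otimes> y \<otimes> (star A y \<otimes> star A x) = x \<otimes> (y \<otimes> star A y) \<otimes> star A x"
    by (simp_all add: m_assoc)
  then show ?thesis by (simp add: unitary_def star_mult unitaryD[OF x] unitaryD[OF y])
qed

lemma unitary_smult:
  assumes x: "unitary A x" and c: "cmod c = 1"
  shows "unitary A (c \<odot> x)"
  using unitaryD[OF x] c complex_norm_square[of c]
  by (simp add: unitary_def star_smult smult_mult_left smult_mult_right smult_smult mult.commute)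

text \<open>Multiply the relation by the adjoint of u from both sides; for a unitary the adjoint is
  the inverse.\<close>

lemma commute_star_unitary:
  assumes u: "unitary A u" and x: "x \<in> carrier A" and comm: "x \<otimes> u = u \<otimes> x"
  shows "x \<otimes> star A u = star A u \<otimes> x"
proof -
  note [simp] = unitaryD(1)[OF u] x
  have "x \<otimes> star A u = star A u \<otimes> u \<otimes> x \<otimes> star A u" by (simp add: unitaryD[OF u])
  also have "\<dots> = star A u \<otimes> (u \<otimes> x) \<otimes> star A u" by (simp add: m_assoc)
  also have "\<dots> = star A u \<otimes> x \<otimes> (u \<otimes> star A u)"
    unfolding comm[symmetric] by (simp add: m_assoc)
  finally show ?thesis by (simp add: unitaryD[OF u])
qed

lemma commute_star:
  assumes "x \<in> carrier A" "y \<in> carrier A" "x \<otimes> star A y = star A y \<otimes> x"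
  shows "star A x \<otimes> y = y \<otimes> star A x"
proof -
  have "star A (x \<otimes> star A y) = star A (star A y \<otimes> x)" using assms(3) by simp
  then show ?thesis using assms(1,2) by (simp add: star_mult)
qed

section \<open>Polynomial calculus and its norm estimate\<close>

lemma poly_eval_0 [simp]: "poly_eval A x 0 = \<zero>"
  by (simp add: poly_eval_def)

lemma poly_eval_pCons:
  assumes "x \<in> carrier A"
  shows "poly_eval A x (pCons a p) = a \<odot> \<one> \<oplus> x \<otimes> poly_eval A x p"
  \<comment> \<open>If a and p both vanish, \<open>pCons\<close> drops the coefficient and both
    sides are zero; otherwise this is one step of the fold.\<close>
  using assms by (cases "a = 0 \<and> p = 0") (auto simp: poly_eval_def)

lemma poly_eval_closed [simp]:
  assumes "x \<in> carrier A"
  shows "poly_eval A x p \<in> carrier A"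
  using assms by (induction p) (simp_all add: poly_eval_pCons)

lemma poly_eval_add:
  assumes [simp]: "x \<in> carrier A"
  shows "poly_eval A x (p + q) = poly_eval A x p \<oplus> poly_eval A x q"
  by (induction p q rule: poly_induct2)
    (simp_all add: poly_eval_pCons smult_add_left r_distr M.a_ac)

lemma poly_eval_smult:
  assumes [simp]: "x \<in> carrier A"
  shows "poly_eval A x (Polynomial.smult c p) = c \<odot> poly_eval A x p"
  by (induction p)
    (simp_all add: poly_eval_pCons smult_add_right smult_smult smult_mult_right)

lemma poly_eval_mult:
  assumes [simp]: "x \<in> carrier A"
  shows "poly_eval A x (p * q) = poly_eval A x p \<otimes> poly_eval A x q"
  by (induction p)
    (simp_all add: poly_eval_pCons poly_eval_add poly_eval_smult l_distr smult_mult_left m_assoc)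

lemma poly_eval_1 [simp]: "x \<in> carrier A \<Longrightarrow> poly_eval A x 1 = \<one>"
  by (simp add: one_pCons poly_eval_pCons)

lemma poly_eval_X [simp]: "x \<in> carrier A \<Longrightarrow> poly_eval A x [:0, 1:] = x"
  by (simp add: poly_eval_pCons)

lemma poly_eval_commute:
  assumes [simp]: "x \<in> carrier A" "z \<in> carrier A" and comm: "z \<otimes> x = x \<otimes> z"
  shows "z \<otimes> poly_eval A x p = poly_eval A x p \<otimes> z"
proof (induction p)
  case (pCons a p)
  have "z \<otimes> (x \<otimes> poly_eval A x p) = x \<otimes> (z \<otimes> poly_eval A x p)"
    by (simp add: comm flip: m_assoc)
  then show ?case
    by (simp add: poly_eval_pCons pCons.IH l_distr r_distr smult_mult_left smult_mult_right m_assoc)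
qed simp

lemma unitary_poly_eval_X_power:
  assumes "unitary A u"
  shows "unitary A (poly_eval A u ([:0, 1:] ^ n))"
proof (induction n)
  case (Suc n)
  then show ?case
    using unitary_mult[OF assms Suc] unitaryD(1)[OF assms] by (simp add: poly_eval_mult del: mult_pCons_left)
qed (use unitaryD(1)[OF assms] in \<open>simp add: unitary_one\<close>)

text \<open>Normality regroups \<open>star A (y \<otimes> y) \<otimes> (y \<otimes> y)\<close> into
  the square of the self-adjoint element \<open>star A y \<otimes> y\<close>, and the C*-identity is
  then applied on both levels.\<close>

lemma nrm_square_normal:
  assumes [simp]: "y \<in> carrier A" and normal: "star A y \<otimes> y = y \<otimes> star A y"
  shows "nrm A (y \<otimes> y) = (nrm A y)\<^sup>2"
proof -
  have "star A y \<otimes> star A y \<otimes> (y \<otimes> y) = star A y \<otimes> (star A y \<otimes> y) \<otimes> y"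
    by (simp add: m_assoc)
  also have "\<dots> = star A y \<otimes> (y \<otimes> star A y) \<otimes> y" by (simp only: normal)
  also have "\<dots> = star A (star A y \<otimes> y) \<otimes> (star A y \<otimes> y)" by (simp add: star_mult m_assoc)
  finally have "star A (y \<otimes> y) \<otimes> (y \<otimes> y) = star A (star A y \<otimes> y) \<otimes> (star A y \<otimes> y)"
    by (simp add: star_mult)
  then have "(nrm A (y \<otimes> y))\<^sup>2 = (nrm A (star A y \<otimes> y))\<^sup>2"
    by (metis nrm_star_mult assms(1) m_closed star_closed)
  then have "nrm A (y \<otimes> y) = nrm A (star A y \<otimes> y)"
    by (rule power2_eq_imp_eq) (simp_all add: nrm_nonneg)
  then show ?thesis by (simp add: nrm_star_mult)
qed

text \<open>Commutation spreads: the adjoint of u commutes with u, hence with p(u). Taking adjoints,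
  u commutes with the adjoint of p(u), and therefore so does p(u).\<close>

lemma poly_eval_normal:
  assumes u: "unitary A u"
  shows "star A (poly_eval A u p) \<otimes> poly_eval A u p = poly_eval A u p \<otimes> star A (poly_eval A u p)"
proof -
  note [simp] = unitaryD(1)[OF u]
  have "poly_eval A u p \<otimes> star A u = star A u \<otimes> poly_eval A u p"
    using poly_eval_commute[of u "star A u" p] by (simp add: unitaryD[OF u])
  then have "star A (poly_eval A u p) \<otimes> u = u \<otimes> star A (poly_eval A u p)"
    by (intro commute_star) simp_all
  then show ?thesis by (intro poly_eval_commute) simp_all
qed

lemma nrm_poly_eval_le_coeffs:
  assumes u: "unitary A u" and B: "\<And>n. cmod (coeff p n) \<le> B"
  shows "nrm A (poly_eval A u p) \<le> (real (degree p) + 1) * B"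
  using B
proof (induction p)
  case 0
  then show ?case by simp
next
  case (pCons a p)
  note [simp] = unitaryD(1)[OF u]
  have a: "cmod a \<le> B" using pCons.prems[of 0] by simp
  have IH: "nrm A (poly_eval A u p) \<le> (real (degree p) + 1) * B"
    using pCons.prems[of "Suc _"] by (intro pCons.IH) simp
  have "nrm A (poly_eval A u (pCons a p)) \<le> nrm A (a \<odot> \<one>) + nrm A (u \<otimes> poly_eval A u p)"
    by (simp add: poly_eval_pCons nrm_triangle)
  also have "\<dots> \<le> cmod a * nrm A \<one> + nrm A u * nrm A (poly_eval A u p)"
    by (simp add: nrm_smult nrm_mult)
  also have "\<dots> \<le> cmod a * 1 + 1 * nrm A (poly_eval A u p)"
    using nrm_one_le nrm_unitary_le[OF u] by (intro add_mono mult_mono) (simp_all add: nrm_nonneg)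
  also have "\<dots> \<le> (real (degree (pCons a p)) + 1) * B"
  proof (cases "p = 0")
    case True
    then show ?thesis using a by simp
  next
    case False
    then show ?thesis using a IH by (simp add: algebra_simps)
  qed
  finally show ?case .
qed

text \<open>The coefficients of $p^n$ are bounded by $M^n$ and their number grows only linearly in $n$,
  while $\|p(u)\|^n = \|p^n(u)\|$ for $n = 2^k$ because $p(u)$ is normal.\<close>

lemma nrm_poly_eval_le:
  assumes u: "unitary A u" and M: "\<And>\<zeta>. \<zeta> \<in> circle \<Longrightarrow> cmod (poly p \<zeta>) \<le> M"
  shows "nrm A (poly_eval A u p) \<le> M"
proof (rule le_if_powers_le_linear_growth[where D = "real (degree p)"])
  note [simp] = unitaryD(1)[OF u]
  show "0 \<le> nrm A (poly_eval A u p)" by (simp add: nrm_nonneg)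
  show "0 \<le> M" using M[of 1] norm_ge_zero[of "poly p 1"] by (simp del: norm_ge_zero)
  fix k :: nat
  have "nrm A (poly_eval A u (p ^ (2 ^ k))) = nrm A (poly_eval A u p) ^ (2 ^ k)"
  proof (induction k)
    case (Suc k)
    have "p ^ (2 ^ Suc k) = p ^ (2 ^ k) * p ^ (2 ^ k)" by (simp add: mult_2 power_add)
    then show ?case
      using nrm_square_normal[OF _ poly_eval_normal[OF u], of "p ^ (2 ^ k)"] Suc
      by (simp add: poly_eval_mult mult_2 power_add power2_eq_square)
  qed simp
  moreover have "nrm A (poly_eval A u (p ^ (2 ^ k))) \<le> (real (degree (p ^ (2 ^ k))) + 1) * M ^ (2 ^ k)"
    by (intro nrm_poly_eval_le_coeffs u cmod_coeff_le)
      (simp add: norm_power power_mono M)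
  moreover have "\<dots> \<le> (2 ^ k * real (degree p) + 1) * M ^ (2 ^ k)"
  proof -
    have "real (degree (p ^ (2 ^ k))) \<le> real (degree p * 2 ^ k)"
      by (rule of_nat_mono) (rule degree_power_le)
    then show ?thesis using \<open>0 \<le> M\<close> by (intro mult_right_mono) (simp_all add: mult.commute)
  qed
  ultimately show "nrm A (poly_eval A u p) ^ 2 ^ k \<le> (2 ^ k * real (degree p) + 1) * M ^ 2 ^ k"
    by simp
qed

text \<open>On the circle the conjugate of zeta is its inverse, so a power of zeta turns the
  conjugate of p into a polynomial; for a unitary the adjoint is the inverse and the same
  computation holds. Asserting both with one N and one q is what later allows norms in
  \<open>A\<close> and in C(S^1) to be compared.\<close>

lemma star_poly_eval:
  assumes u: "unitary A u"
  shows "\<exists>N q. (\<forall>\<zeta>\<in>circle. \<zeta> ^ N * cnj (poly p \<zeta>) = poly q \<zeta>) \<and>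
    poly_eval A u ([:0, 1:] ^ N) \<otimes> star A (poly_eval A u p) = poly_eval A u q"
proof (induction p)
  case 0
  then show ?case using unitaryD(1)[OF u] by (intro exI[of _ 0] exI[of _ "0::complex poly"]) simp
next
  case (pCons a p)
  note [simp] = unitaryD(1)[OF u]
  obtain N q where q: "\<And>\<zeta>. \<zeta> \<in> circle \<Longrightarrow> \<zeta> ^ N * cnj (poly p \<zeta>) = poly q \<zeta>"
    and qA: "poly_eval A u ([:0, 1:] ^ N) \<otimes> star A (poly_eval A u p) = poly_eval A u q"
    using pCons.IH by blast
  let ?X = "[:0, 1:] :: complex poly"
  \<comment> \<open>Read off from zeta^(N+1) times the conjugate of a + zeta p(zeta): in the second
    summand the conjugate of zeta cancels one power.\<close>
  define q' where "q' = Polynomial.smult (cnj a) (?X ^ Suc N) + q"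
  have "\<zeta> ^ Suc N * cnj (poly (pCons a p) \<zeta>) = poly q' \<zeta>" if \<zeta>: "\<zeta> \<in> circle" for \<zeta>
  proof -
    have "\<zeta> * cnj \<zeta> = 1" using \<zeta> by (simp add: complex_norm_square[symmetric])
    then have "\<zeta> ^ Suc N * cnj (poly (pCons a p) \<zeta>)
        = cnj a * \<zeta> ^ Suc N + \<zeta> ^ N * cnj (poly p \<zeta>)"
      by (simp add: algebra_simps)
    then show ?thesis using q[OF \<zeta>] by (simp add: q'_def)
  qed
  moreover have "poly_eval A u (?X ^ Suc N) \<otimes> star A (poly_eval A u (pCons a p)) = poly_eval A u q'"
  proof -
    let ?XN = "poly_eval A u (?X ^ N)" and ?s = "star A (poly_eval A u p)"
    have XS: "poly_eval A u (?X ^ Suc N) = u \<otimes> ?XN"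
      by (simp add: poly_eval_mult del: mult_pCons_left)
    have comm: "u \<otimes> poly_eval A u r = poly_eval A u r \<otimes> u" for r
      by (rule poly_eval_commute) simp_all
    have "u \<otimes> ?XN \<otimes> (?s \<otimes> star A u) = u \<otimes> (?XN \<otimes> ?s) \<otimes> star A u"
      by (simp add: m_assoc)
    also have "\<dots> = poly_eval A u q \<otimes> (u \<otimes> star A u)"
      unfolding qA comm by (simp add: m_assoc)
    also have "\<dots> = poly_eval A u q" by (simp add: unitaryD[OF u])
    finally have main: "u \<otimes> ?XN \<otimes> (?s \<otimes> star A u) = poly_eval A u q" .
    have "poly_eval A u q' = cnj a \<odot> (u \<otimes> ?XN) \<oplus> poly_eval A u q"
      by (simp only: q'_def poly_eval_add poly_eval_smult XS unitaryD(1)[OF u])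
    moreover have "star A (poly_eval A u (pCons a p)) = cnj a \<odot> \<one> \<oplus> ?s \<otimes> star A u"
      by (simp add: poly_eval_pCons star_add star_smult star_mult)
    ultimately show ?thesis
      unfolding XS main[symmetric] by (simp add: r_distr smult_mult_right)
  qed
  ultimately show ?case by blast
qed

end

section \<open>Functional calculus\<close>

context cstar_algebra
begin

text \<open>\<open>A\<close> is not commutative, and powers of u have to be moved past expressions
  when denominators are cleared.\<close>

lemma expr_eval_commute:
  assumes u: "unitary A u"
  shows "expr_eval A (\<lambda>_. u) e \<otimes> u = u \<otimes> expr_eval A (\<lambda>_. u) e"
proof (induction e)
  case (EMult a b)
  have "expr_eval A (\<lambda>_. u) a \<in> carrier A" "expr_eval A (\<lambda>_. u) b \<in> carrier A"
    using unitaryD(1)[OF u] by simp_all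
  with EMult show ?case
    using unitaryD(1)[OF u] by (metis expr_eval.simps(5) m_assoc)
next
  case (EStar a)
  have a: "expr_eval A (\<lambda>_. u) a \<in> carrier A" using unitaryD(1)[OF u] by simp
  show ?case
    using commute_star[OF a unitaryD(1)[OF u] commute_star_unitary[OF u a EStar]] by simp
qed (use unitaryD(1)[OF u] in \<open>simp_all add: l_distr r_distr smult_mult_left smult_mult_right\<close>)

text \<open>An expression in a unitary is a Laurent polynomial, and a power of u clears its negative
  exponents. The pair N, p serves the circle and \<open>A\<close> at once, which reduces the norm
  bound for expressions to the one for polynomials.\<close>

lemma expr_eval_laurent:
  assumes u: "unitary A u"
  shows "\<exists>N p. (\<forall>\<zeta>\<in>circle. \<zeta> ^ N * expr_eval circle_algebra (\<lambda>_. circle_id) e \<zeta> = poly p \<zeta>) \<and>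
    poly_eval A u ([:0, 1:] ^ N) \<otimes> expr_eval A (\<lambda>_. u) e = poly_eval A u p"
proof -
  note unitaryD(1)[OF u, simp]
  have C [simp]: "u \<in> carrier A" "\<And>e. expr_eval A (\<lambda>_. u) e \<in> carrier A" by simp_all
  let ?X = "[:0, 1:] :: complex poly" and ?f = "expr_eval circle_algebra (\<lambda>_. circle_id)"
    and ?a = "expr_eval A (\<lambda>_. u)"
  have comm: "?a e \<otimes> poly_eval A u p = poly_eval A u p \<otimes> ?a e" for e p
    by (rule poly_eval_commute) (simp_all add: expr_eval_commute[OF u])
  show ?thesis
  proof (induction e)
    case (EGen n)
    show ?case by (intro exI[of _ 0] exI[of _ ?X]) simp
  next
    case EOne
    show ?case by (intro exI[of _ 0] exI[of _ "1 :: complex poly"]) simp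
  next
    case (EAdd e e')
    obtain N p where p: "\<And>\<zeta>. \<zeta> \<in> circle \<Longrightarrow> \<zeta> ^ N * ?f e \<zeta> = poly p \<zeta>"
      and pA: "poly_eval A u (?X ^ N) \<otimes> ?a e = poly_eval A u p" using EAdd.IH(1) by blast
    obtain N' p' where p': "\<And>\<zeta>. \<zeta> \<in> circle \<Longrightarrow> \<zeta> ^ N' * ?f e' \<zeta> = poly p' \<zeta>"
      and pA': "poly_eval A u (?X ^ N') \<otimes> ?a e' = poly_eval A u p'" using EAdd.IH(2) by blast
    \<comment> \<open>Common denominator: each summand is multiplied by the power belonging to the
      other one.\<close>
    have "poly_eval A u (?X ^ (N' + N)) = poly_eval A u (?X ^ N') \<otimes> poly_eval A u (?X ^ N)"
      "poly_eval A u (?X ^ (N' + N)) = poly_eval A u (?X ^ N) \<otimes> poly_eval A u (?X ^ N')"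
      by (simp_all only: poly_eval_mult[symmetric] unitaryD(1)[OF u] power_add mult.commute)
    then have "poly_eval A u (?X ^ (N' + N)) \<otimes> ?a e = poly_eval A u (?X ^ N') \<otimes> poly_eval A u p"
      "poly_eval A u (?X ^ (N' + N)) \<otimes> ?a e' = poly_eval A u (?X ^ N) \<otimes> poly_eval A u p'"
      using pA pA' C by (metis m_assoc poly_eval_closed)+
    then have "poly_eval A u (?X ^ (N' + N)) \<otimes> ?a (EAdd e e') = poly_eval A u (?X ^ N' * p + ?X ^ N * p')"
      by (simp add: poly_eval_add poly_eval_mult r_distr)
    moreover have "\<zeta> ^ (N' + N) * ?f (EAdd e e') \<zeta> = poly (?X ^ N' * p + ?X ^ N * p') \<zeta>"
      if "\<zeta> \<in> circle" for \<zeta>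
      using that p[OF that, symmetric] p'[OF that, symmetric] by (simp add: power_add algebra_simps)
    ultimately show ?case by blast
  next
    case (EMult e e')
    obtain N p where p: "\<And>\<zeta>. \<zeta> \<in> circle \<Longrightarrow> \<zeta> ^ N * ?f e \<zeta> = poly p \<zeta>"
      and pA: "poly_eval A u (?X ^ N) \<otimes> ?a e = poly_eval A u p" using EMult.IH(1) by blast
    obtain N' p' where p': "\<And>\<zeta>. \<zeta> \<in> circle \<Longrightarrow> \<zeta> ^ N' * ?f e' \<zeta> = poly p' \<zeta>"
      and pA': "poly_eval A u (?X ^ N') \<otimes> ?a e' = poly_eval A u p'" using EMult.IH(2) by blast
    have "poly_eval A u (?X ^ (N + N')) \<otimes> ?a (EMult e e')
        = poly_eval A u (?X ^ N) \<otimes> (poly_eval A u (?X ^ N') \<otimes> ?a e) \<otimes> ?a e'"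
      by (simp add: power_add poly_eval_mult m_assoc)
    also have "\<dots> = (poly_eval A u (?X ^ N) \<otimes> ?a e) \<otimes> (poly_eval A u (?X ^ N') \<otimes> ?a e')"
      unfolding comm[of e "?X ^ N'", symmetric] by (simp add: m_assoc)
    also have "\<dots> = poly_eval A u (p * p')" by (simp add: pA pA' poly_eval_mult)
    finally have "poly_eval A u (?X ^ (N + N')) \<otimes> ?a (EMult e e') = poly_eval A u (p * p')" .
    moreover have "\<zeta> ^ (N + N') * ?f (EMult e e') \<zeta> = poly (p * p') \<zeta>" if "\<zeta> \<in> circle" for \<zeta>
      using that p[OF that, symmetric] p'[OF that, symmetric] by (simp add: power_add algebra_simps)
    ultimately show ?case by blast
  next
    case (EStar e)
    obtain N p where p: "\<And>\<zeta>. \<zeta> \<in> circle \<Longrightarrow> \<zeta> ^ N * ?f e \<zeta> = poly p \<zeta>"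
      and pA: "poly_eval A u (?X ^ N) \<otimes> ?a e = poly_eval A u p" using EStar.IH by blast
    obtain M q where q: "\<And>\<zeta>. \<zeta> \<in> circle \<Longrightarrow> \<zeta> ^ M * cnj (poly p \<zeta>) = poly q \<zeta>"
      and qA: "poly_eval A u (?X ^ M) \<otimes> star A (poly_eval A u p) = poly_eval A u q"
      using star_poly_eval[OF u] by blast
    let ?N = "poly_eval A u (?X ^ N)"
    have N: "star A ?N \<otimes> ?N = \<one>" by (rule unitaryD[OF unitary_poly_eval_X_power[OF u]])
    \<comment> \<open>The adjoint of the induction hypothesis carries the adjoint of u^N on the
      right; multiplying by u^N on the right removes it.\<close>
    have "star A (poly_eval A u p) \<otimes> ?N = star A (?a e) \<otimes> (star A ?N \<otimes> ?N)"
      unfolding pA[symmetric] by (simp add: star_mult m_assoc)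
    then have "poly_eval A u (?X ^ M) \<otimes> ?a (EStar e)
        = poly_eval A u (?X ^ M) \<otimes> star A (poly_eval A u p) \<otimes> ?N"
      by (simp add: N m_assoc)
    then have "poly_eval A u (?X ^ M) \<otimes> ?a (EStar e) = poly_eval A u (q * ?X ^ N)"
      unfolding qA by (simp add: poly_eval_mult)
    moreover have "\<zeta> ^ M * ?f (EStar e) \<zeta> = poly (q * ?X ^ N) \<zeta>" if \<zeta>: "\<zeta> \<in> circle" for \<zeta>
    proof -
      have "\<zeta> * cnj \<zeta> = 1" using \<zeta> by (simp add: complex_norm_square[symmetric])
      then have "cnj \<zeta> ^ N * \<zeta> ^ N = 1" by (simp add: mult.commute flip: power_mult_distrib)
      then have "\<zeta> ^ M * cnj (?f e \<zeta>) = \<zeta> ^ M * cnj (\<zeta> ^ N * ?f e \<zeta>) * \<zeta> ^ N"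
        by (simp add: algebra_simps)
      then show ?thesis using \<zeta> unfolding p[OF \<zeta>] q[OF \<zeta>] by simp
    qed
    ultimately show ?case by blast
  next
    case (ENeg e)
    obtain N p where p: "\<And>\<zeta>. \<zeta> \<in> circle \<Longrightarrow> \<zeta> ^ N * ?f e \<zeta> = poly p \<zeta>"
      and pA: "poly_eval A u (?X ^ N) \<otimes> ?a e = poly_eval A u p" using ENeg.IH by blast
    have "poly_eval A u (?X ^ N) \<otimes> ?a (ENeg e) = poly_eval A u (Polynomial.smult (-1) p)"
      by (simp add: poly_eval_smult smult_mult_right pA del: smult_minus_left)
    moreover have "\<zeta> ^ N * ?f (ENeg e) \<zeta> = poly (Polynomial.smult (-1) p) \<zeta>" if "\<zeta> \<in> circle" for \<zeta>
      using that p[OF that, symmetric] by simp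
    ultimately show ?case by blast
  next
    case (EScale n e)
    obtain N p where p: "\<And>\<zeta>. \<zeta> \<in> circle \<Longrightarrow> \<zeta> ^ N * ?f e \<zeta> = poly p \<zeta>"
      and pA: "poly_eval A u (?X ^ N) \<otimes> ?a e = poly_eval A u p" using EScale.IH by blast
    have "poly_eval A u (?X ^ N) \<otimes> ?a (EScale n e) = poly_eval A u (Polynomial.smult (dense_scalar n) p)"
      by (simp add: poly_eval_smult smult_mult_right pA)
    moreover have "\<zeta> ^ N * ?f (EScale n e) \<zeta> = poly (Polynomial.smult (dense_scalar n) p) \<zeta>"
      if "\<zeta> \<in> circle" for \<zeta>
      using that p[OF that, symmetric] by simp
    ultimately show ?case by blast
  qed
qed

text \<open>Clearing denominators is harmless on both sides: u^N is unitary and zeta^N has modulus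
  1. What remains is the polynomial bound.\<close>

lemma nrm_expr_eval_unitary_le:
  assumes u: "unitary A u"
  shows "nrm A (expr_eval A (\<lambda>_. u) e) \<le> nrm circle_algebra (expr_eval circle_algebra (\<lambda>_. circle_id) e)"
    (is "nrm A ?a \<le> nrm circle_algebra ?f")
proof -
  note [simp] = unitaryD(1)[OF u]
  interpret S: cstar_algebra circle_algebra by (rule cstar_algebra_circle)
  have [simp]: "?a \<in> carrier A" by simp
  have "?f \<in> carrier circle_algebra"
    using generates_circle_algebra by (intro S.expr_eval_closed) (simp add: generates_def)
  then have f: "continuous_on circle ?f" by simp
  obtain N p where p: "\<And>\<zeta>. \<zeta> \<in> circle \<Longrightarrow> \<zeta> ^ N * ?f \<zeta> = poly p \<zeta>"
    and pA: "poly_eval A u ([:0, 1:] ^ N) \<otimes> ?a = poly_eval A u p"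
    using expr_eval_laurent[OF u] by blast
  let ?N = "poly_eval A u ([:0, 1:] ^ N)"
  have N: "unitary A ?N" by (rule unitary_poly_eval_X_power[OF u])
  have "?a = star A ?N \<otimes> ?N \<otimes> ?a" by (simp add: unitaryD[OF N])
  also have "\<dots> = star A ?N \<otimes> poly_eval A u p" by (simp add: m_assoc pA)
  finally have "nrm A ?a \<le> nrm A (star A ?N) * nrm A (poly_eval A u p)"
    using nrm_mult[of "star A ?N" "poly_eval A u p"] by simp
  also have "\<dots> \<le> 1 * nrm A (poly_eval A u p)"
    using nrm_unitary_le[OF N] by (intro mult_right_mono) (simp_all add: nrm_nonneg)
  also have "nrm A (poly_eval A u p) \<le> nrm circle_algebra ?f"
  proof (rule nrm_poly_eval_le[OF u])
    fix \<zeta> assume \<zeta>: "\<zeta> \<in> circle"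
    show "cmod (poly p \<zeta>) \<le> nrm circle_algebra ?f"
      using nrm_circle_ge[OF f \<zeta>] \<zeta> by (simp add: norm_mult norm_power flip: p[OF \<zeta>])
  qed
  finally show ?thesis by simp
qed

lemma ex_star_hom_circle:
  assumes u: "unitary A u"
  obtains \<Phi> where "\<Phi> \<in> star_hom circle_algebra A" "\<Phi> circle_id = u"
proof -
  have "\<exists>\<Phi>\<in>star_hom circle_algebra A. \<forall>n::nat. \<Phi> circle_id = u"
  proof (rule ex_star_hom_of_expr_bound[where g = "\<lambda>_. circle_id" and h = "\<lambda>_. u"])
    show "generates circle_algebra (range (\<lambda>_::nat. circle_id))"
      using generates_circle_algebra by simp
  qed (use nrm_expr_eval_unitary_le[OF u] unitaryD(1)[OF u] cstar_algebra_circle cstar_algebra_axioms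
      in auto)
  then show thesis using that by blast
qed

text \<open>The identity function generates C(S^1), so a homomorphism is determined by its value
  there, and any available one computes the definite description.\<close>

lemma func_calc_eq:
  assumes \<Phi>: "\<Phi> \<in> star_hom circle_algebra A" "\<Phi> circle_id = u" and h: "continuous_on circle h"
  shows "func_calc A u h = \<Phi> (restrict h circle)"
  unfolding func_calc_def
proof (rule the_equality)
  fix y assume "\<exists>\<Psi>\<in>star_hom circle_algebra A. \<Psi> circle_id = u \<and> y = \<Psi> (restrict h circle)"
  then obtain \<Psi> where \<Psi>: "\<Psi> \<in> star_hom circle_algebra A" "\<Psi> circle_id = u" "y = \<Psi> (restrict h circle)"
    by blast
  show "y = \<Phi> (restrict h circle)"
    unfolding \<Psi>(3)
    by (rule star_hom_eqI[OF cstar_algebra_circle cstar_algebra_axioms \<Psi>(1) \<Phi>(1)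
          generates_circle_algebra _ restrict_in_circle_algebra[OF h]])
      (use \<Phi>(2) \<Psi>(2) in auto)
qed (use \<Phi> in blast)

lemma func_calc_closed [simp]:
  assumes u: "unitary A u" and h: "continuous_on circle h"
  shows "func_calc A u h \<in> carrier A"
proof -
  obtain \<Phi> where \<Phi>: "\<Phi> \<in> star_hom circle_algebra A" "\<Phi> circle_id = u"
    using ex_star_hom_circle[OF u] .
  show ?thesis
    unfolding func_calc_eq[OF \<Phi> h] by (rule star_homD(1)[OF \<Phi>(1) restrict_in_circle_algebra[OF h]])
qed

lemma func_calc_mult:
  assumes u: "unitary A u" and h: "continuous_on circle h" and k: "continuous_on circle k"
  shows "func_calc A u (\<lambda>\<zeta>. h \<zeta> * k \<zeta>) = func_calc A u h \<otimes> func_calc A u k"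
proof -
  obtain \<Phi> where \<Phi>: "\<Phi> \<in> star_hom circle_algebra A" "\<Phi> circle_id = u"
    using ex_star_hom_circle[OF u] .
  have "restrict h circle \<otimes>\<^bsub>circle_algebra\<^esub> restrict k circle = (\<lambda>\<zeta>\<in>circle. h \<zeta> * k \<zeta>)"
    by auto
  then show ?thesis
    using star_homD(3)[OF \<Phi>(1) restrict_in_circle_algebra[OF h] restrict_in_circle_algebra[OF k]]
      func_calc_eq[OF \<Phi> h] func_calc_eq[OF \<Phi> k] func_calc_eq[OF \<Phi> continuous_on_mult[OF h k]]
    by (simp only:)
qed

lemma func_calc_star:
  assumes u: "unitary A u" and h: "continuous_on circle h"
  shows "func_calc A u (\<lambda>\<zeta>. cnj (h \<zeta>)) = star A (func_calc A u h)"
proof -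
  obtain \<Phi> where \<Phi>: "\<Phi> \<in> star_hom circle_algebra A" "\<Phi> circle_id = u"
    using ex_star_hom_circle[OF u] .
  have "star circle_algebra (restrict h circle) = (\<lambda>\<zeta>\<in>circle. cnj (h \<zeta>))" by auto
  then show ?thesis
    using star_homD(6)[OF \<Phi>(1) restrict_in_circle_algebra[OF h]] func_calc_eq[OF \<Phi> h]
      func_calc_eq[OF \<Phi> continuous_on_cnj[OF h]] by (simp only:)
qed

lemma func_calc_one:
  assumes u: "unitary A u"
  shows "func_calc A u (\<lambda>\<zeta>. 1) = \<one>"
proof -
  obtain \<Phi> where \<Phi>: "\<Phi> \<in> star_hom circle_algebra A" "\<Phi> circle_id = u"
    using ex_star_hom_circle[OF u] .
  show ?thesis
    using func_calc_eq[OF \<Phi> continuous_on_const[of _ 1]] star_homD(4)[OF \<Phi>(1)]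
    by (simp only: circle_algebra_simps)
qed

lemma func_calc_id:
  assumes u: "unitary A u"
  shows "func_calc A u (\<lambda>\<zeta>. \<zeta>) = u"
proof -
  obtain \<Phi> where \<Phi>: "\<Phi> \<in> star_hom circle_algebra A" "\<Phi> circle_id = u"
    using ex_star_hom_circle[OF u] .
  show ?thesis using func_calc_eq[OF \<Phi> continuous_on_id] \<Phi>(2) by (simp only:)
qed

lemma func_calc_cong:
  assumes "\<And>\<zeta>. \<zeta> \<in> circle \<Longrightarrow> h \<zeta> = k \<zeta>"
  shows "func_calc A u h = func_calc A u k"
proof -
  have "restrict h circle = restrict k circle" using assms by (intro restrict_ext)
  then show ?thesis unfolding func_calc_def by simp
qed

lemma func_calc_commute:
  assumes u: "unitary A u" and h: "continuous_on circle h"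
  shows "func_calc A u h \<otimes> u = u \<otimes> func_calc A u h"
  using func_calc_mult[OF u h continuous_on_id] func_calc_mult[OF u continuous_on_id h]
  by (simp add: func_calc_id[OF u] mult.commute)

lemma func_calc_unitary:
  assumes u: "unitary A u" and h: "continuous_on circle h"
    and unimodular: "\<And>\<zeta>. \<zeta> \<in> circle \<Longrightarrow> cmod (h \<zeta>) = 1"
  shows "unitary A (func_calc A u h)"
proof -
  have cnj: "cnj (h \<zeta>) * h \<zeta> = 1" if "\<zeta> \<in> circle" for \<zeta>
    using unimodular[OF that] complex_norm_square[of "h \<zeta>"] by (simp add: mult.commute)
  have "func_calc A u (\<lambda>\<zeta>. cnj (h \<zeta>) * h \<zeta>) = \<one>"
    "func_calc A u (\<lambda>\<zeta>. h \<zeta> * cnj (h \<zeta>)) = \<one>"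
    unfolding func_calc_one[OF u, symmetric]
    using cnj by (auto intro!: func_calc_cong simp: mult.commute)
  then show ?thesis
    using func_calc_mult[OF u h continuous_on_cnj[OF h]] func_calc_mult[OF u continuous_on_cnj[OF h] h]
      func_calc_closed[OF u h] func_calc_star[OF u h]
    by (simp add: unitary_def)
qed

text \<open>Precomposition with the rotation by c is an endomorphism of C(S^1). Followed by the
  calculus of u it sends the identity function to c u, so by uniqueness it is the calculus of c
  u.\<close>

lemma func_calc_rotate:
  assumes u: "unitary A u" and h: "continuous_on circle h" and c: "cmod c = 1"
  shows "func_calc A (c \<odot> u) h = func_calc A u (\<lambda>\<zeta>. h (c * \<zeta>))"
proof -
  obtain \<Phi> where \<Phi>: "\<Phi> \<in> star_hom circle_algebra A" "\<Phi> circle_id = u"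
    using ex_star_hom_circle[OF u] .
  define \<rho> :: "(complex \<Rightarrow> complex) \<Rightarrow> complex \<Rightarrow> complex" where "\<rho> = (\<lambda>k. \<lambda>\<zeta>\<in>circle. k (c * \<zeta>))"
  have cont: "continuous_on circle (\<lambda>\<zeta>. k (c * \<zeta>))" if "continuous_on circle k"
    for k :: "complex \<Rightarrow> complex"
    by (rule continuous_on_compose2[OF that]) (auto simp: norm_mult c intro!: continuous_intros)
  have "\<rho> \<in> star_hom circle_algebra circle_algebra"
  proof (rule star_homI)
    show "\<rho> k \<in> carrier circle_algebra" if "k \<in> carrier circle_algebra" for k
      unfolding \<rho>_def using that by (intro restrict_in_circle_algebra cont) simp
  qed (auto simp: \<rho>_def norm_mult c)
  then have hom: "(\<lambda>k. \<Phi> (\<rho> k)) \<in> star_hom circle_algebra A" using \<Phi>(1) by (rule star_hom_comp)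
  have "\<rho> circle_id = c \<odot>\<^bsub>circle_algebra\<^esub> circle_id" by (auto simp: \<rho>_def norm_mult c)
  then have id: "\<Phi> (\<rho> circle_id) = c \<odot> u"
    using star_homD(5)[OF \<Phi>(1) restrict_in_circle_algebra[OF continuous_on_id], of c] \<Phi>(2)
    by simp
  have "\<rho> (restrict h circle) = (\<lambda>\<zeta>\<in>circle. h (c * \<zeta>))" by (auto simp: \<rho>_def norm_mult c)
  then show ?thesis
    using func_calc_eq[OF hom id h] func_calc_eq[OF \<Phi> cont[OF h]] by (simp only:)
qed

lemma inv_unitary:
  assumes "unitary A x"
  shows "inv x = star A x"
  using inv_unique'[of x "star A x"] unitaryD[OF assms] by simp

lemma continuous_on_power_int_circle: "continuous_on circle (\<lambda>\<zeta>. \<zeta> powi d)"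
  by (intro continuous_intros) auto

lemma func_calc_power_int:
  assumes u: "unitary A u"
  shows "func_calc A u (\<lambda>\<zeta>. \<zeta> powi d) = u [^] d"
proof -
  have cont: "continuous_on circle (\<lambda>\<zeta>::complex. \<zeta> ^ n)" for n by (intro continuous_intros)
  have nat: "func_calc A u (\<lambda>\<zeta>. \<zeta> ^ n) = u [^] n" for n :: nat
  proof (induction n)
    case (Suc n)
    have "func_calc A u (\<lambda>\<zeta>. \<zeta> ^ Suc n) = func_calc A u (\<lambda>\<zeta>. \<zeta> ^ n * \<zeta>)"
      by (rule func_calc_cong) simp
    then show ?case
      using Suc func_calc_mult[OF u cont continuous_on_id, of n] by (simp add: func_calc_id[OF u])
  qed (simp add: func_calc_one[OF u])
  show ?thesis
  proof (cases "d < 0")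
    case True
    define n where "n = nat (- d)"
    have un: "unitary A (u [^] n)"
      unfolding nat[symmetric] by (rule func_calc_unitary[OF u cont]) (simp add: norm_power)
    \<comment> \<open>Negative powers on the circle are conjugates of positive ones, and conjugation
      becomes the adjoint. This is the inverse of u^n, by which \<open>[^]\<close> is defined at
      negative integers.\<close>
    have "func_calc A u (\<lambda>\<zeta>. \<zeta> powi d) = func_calc A u (\<lambda>\<zeta>. cnj (\<zeta> ^ n))"
    proof (rule func_calc_cong)
      fix \<zeta> :: complex assume "\<zeta> \<in> circle"
      then have "inverse \<zeta> = cnj \<zeta>"
        using complex_norm_square[of \<zeta>] by (intro inverse_unique) simp
      then show "\<zeta> powi d = cnj (\<zeta> ^ n)" using True by (simp add: power_int_def n_def)
    qed
    also have "\<dots> = star A (u [^] n)" by (simp only: func_calc_star[OF u cont] nat)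
    finally show ?thesis using True by (simp add: int_pow_def2 inv_unitary[OF un] flip: n_def)
  next
    case False
    have "func_calc A u (\<lambda>\<zeta>. \<zeta> powi d) = func_calc A u (\<lambda>\<zeta>. \<zeta> ^ nat d)"
      using False
      by (intro func_calc_cong) (simp add: power_int_def)
    also have "\<dots> = u [^] nat d" by (rule nat)
    finally show ?thesis using False by (simp only: int_pow_def2 if_False)
  qed
qed

end

text \<open>The calculus of u followed by \<open>\<phi>\<close> is a homomorphism from C(S^1)
  sending the identity function to \<open>\<phi> u\<close>.\<close>

lemma star_hom_func_calc:
  assumes "cstar_algebra A" "cstar_algebra B" and \<phi>: "\<phi> \<in> star_hom A B"
    and u: "unitary A u" and h: "continuous_on circle h"
  shows "\<phi> (func_calc A u h) = func_calc B (\<phi> u) h"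
proof -
  interpret A: cstar_algebra A by fact
  interpret B: cstar_algebra B by fact
  obtain \<Phi> where \<Phi>: "\<Phi> \<in> star_hom circle_algebra A" "\<Phi> circle_id = u"
    using A.ex_star_hom_circle[OF u] .
  have "(\<lambda>x. \<phi> (\<Phi> x)) \<in> star_hom circle_algebra B" by (rule star_hom_comp[OF \<Phi>(1) \<phi>])
  from B.func_calc_eq[OF this _ h, of "\<phi> u"] show ?thesis
    using \<Phi>(2) A.func_calc_eq[OF \<Phi> h] by (simp only:)
qed

section \<open>Rotation algebras and crossed products\<close>

lemma star_hom_inv_into:
  assumes "cstar_algebra A" and \<phi>: "\<phi> \<in> star_hom A B" and bij: "bij_betw \<phi> (carrier A) (carrier B)"
  shows "inv_into (carrier A) \<phi> \<in> star_hom B A"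
proof -
  interpret cstar_algebra A by fact
  let ?\<psi> = "inv_into (carrier A) \<phi>"
  have closed: "?\<psi> y \<in> carrier A" "\<phi> (?\<psi> y) = y" if "y \<in> carrier B" for y
    using bij that by (auto simp: bij_betw_def inv_into_into f_inv_into_f)
  have eq: "?\<psi> y = x" if "x \<in> carrier A" "\<phi> x = y" for x y
    using bij that by (auto simp: bij_betw_def)
  note hom = star_homD[OF \<phi>]
  show ?thesis
    by (rule star_homI) (auto intro!: eq simp: closed hom)
qed

lemma star_autoD:
  assumes "\<alpha> \<in> star_auto A"
  shows "\<alpha> \<in> star_hom A A" "bij_betw \<alpha> (carrier A) (carrier A)" "\<alpha> \<in> extensional (carrier A)"
  using assms by (auto simp: star_auto_def Bij_def)

lemma star_auto_eqI:
  assumes "cstar_algebra A" "generates A G" "\<alpha> \<in> star_auto A" "\<beta> \<in> star_auto A"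
    and "\<And>x. x \<in> G \<Longrightarrow> \<alpha> x = \<beta> x"
  shows "\<alpha> = \<beta>"
proof (rule extensionalityI[OF star_autoD(3)[OF assms(3)] star_autoD(3)[OF assms(4)]])
  fix x assume "x \<in> carrier A"
  then show "\<alpha> x = \<beta> x"
    using assms(5)
    by (rule star_hom_eqI[OF assms(1,1) star_autoD(1)[OF assms(3)] star_autoD(1)[OF assms(4)] assms(2), rotated])
qed

text \<open>Being generated by two elements, \<open>A\<close> has a carrier that injects into
  complex sequences. Universality is applied to the transported copy, and the result is brought back
  along the inverse of the injection.\<close>

lemma ex_rotation_hom:
  assumes A: "rotation_algebra \<theta> A u v" and xy: "rotation_pair \<theta> A x y"
  shows "\<exists>\<phi>\<in>star_hom A A. \<phi> u = x \<and> \<phi> v = y"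
proof -
  interpret cstar_algebra A using A by (simp add: rotation_algebra_def)
  have gen: "generates A {u, v}" using A by (simp add: rotation_algebra_def)
  have "inj_on (\<lambda>x. \<lambda>_::nat. if x = u then 0 else 1 :: complex) {u, v}"
    by (auto simp: inj_on_def fun_eq_iff)
  then obtain J :: "'a \<Rightarrow> nat \<Rightarrow> complex" where J: "inj_on J (carrier A)"
    using ex_inj_on_generated[OF gen _ _ inj_of_real] by blast
  define B where "B = transport_cstar J A"
  define K where "K = inv_into (carrier A) J"
  have B: "cstar_algebra B" and JB: "J \<in> star_hom A B" and KB: "K \<in> star_hom B A"
    using transport_cstar[OF J] by (simp_all add: B_def K_def)
  have KJ: "K (J a) = a" if "a \<in> carrier A" for a using that J by (simp add: K_def)
  have x: "unitary A x" "unitary A y" "y \<otimes>\<^bsub>A\<^esub> x = e2pi \<theta> \<odot>\<^bsub>A\<^esub> (x \<otimes>\<^bsub>A\<^esub> y)"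
    using xy by (simp_all add: rotation_pair_def)
  note [simp] = unitaryD(1)[OF x(1)] unitaryD(1)[OF x(2)]
  have "rotation_pair \<theta> B (J x) (J y)"
    unfolding rotation_pair_def
    using star_hom_unitary[OF cstar_algebra_axioms JB] x star_homD(3)[OF JB, of y x]
      star_homD(3)[OF JB, of x y] star_homD(5)[OF JB, of "x \<otimes>\<^bsub>A\<^esub> y" "e2pi \<theta>"]
    by simp
  then obtain \<phi> where "\<phi> \<in> star_hom A B" "\<phi> u = J x" "\<phi> v = J y"
    using A B unfolding rotation_algebra_def by blast
  then show ?thesis
    using star_hom_comp[OF _ KB] by (intro bexI[of _ "\<lambda>a. K (\<phi> a)"]) (simp_all add: KJ)
qed

section \<open>Automorphisms of a rotation algebra\<close>

locale rotation_cstar_algebra =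
  fixes \<theta> :: real and A :: "'a cstar" (structure) and u v :: 'a
  assumes rotation: "rotation_algebra \<theta> A u v"

sublocale rotation_cstar_algebra \<subseteq> cstar_algebra A
  using rotation by (simp add: rotation_algebra_def)

context rotation_cstar_algebra
begin

lemma generates_uv: "generates A {u, v}" and unitary_u: "unitary A u" and unitary_v: "unitary A v"
  and v_mult_u: "v \<otimes> u = e2pi \<theta> \<odot> (u \<otimes> v)"
  using rotation by (simp_all add: rotation_algebra_def rotation_pair_def)

lemma uv_closed [simp]: "u \<in> carrier A" "v \<in> carrier A"
  using unitary_u unitary_v by (simp_all add: unitary_def)

text \<open>The commutation relation survives because H(u) commutes with u, and the scalar c occurs
  once on each side.\<close>

lemma rotation_pair_skew:
  assumes c: "cmod c = 1" and H: "continuous_on circle H" "\<And>\<zeta>. \<zeta> \<in> circle \<Longrightarrow> cmod (H \<zeta>) = 1"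
  shows "rotation_pair \<theta> A (c \<odot> u) (func_calc A u H \<otimes> v)"
proof -
  let ?h = "func_calc A u H"
  have h: "unitary A ?h" by (rule func_calc_unitary[OF unitary_u H])
  note [simp] = unitaryD(1)[OF h]
  have "?h \<otimes> v \<otimes> (c \<odot> u) = c \<odot> (?h \<otimes> (v \<otimes> u))"
    by (simp add: smult_mult_right m_assoc)
  also have "\<dots> = e2pi \<theta> \<odot> (c \<odot> (?h \<otimes> u \<otimes> v))"
    unfolding v_mult_u by (simp add: smult_mult_right smult_smult m_assoc mult.commute)
  also have "?h \<otimes> u = u \<otimes> ?h" by (rule func_calc_commute[OF unitary_u H(1)])
  finally have "?h \<otimes> v \<otimes> (c \<odot> u) = e2pi \<theta> \<odot> (c \<odot> u \<otimes> (?h \<otimes> v))"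
    by (simp add: smult_mult_left m_assoc)
  then show ?thesis
    unfolding rotation_pair_def using unitary_smult[OF unitary_u c] unitary_mult[OF h unitary_v] by simp
qed

text \<open>\<open>\<phi>\<close> passes through the functional calculus: it takes H'(u) to H'
  evaluated at c u, which is the rotated function evaluated at u. The factor H(u) coming from v then
  multiplies it pointwise.\<close>

lemma skew_comp:
  assumes \<phi>: "\<phi> \<in> star_hom A A" "\<phi> u = c \<odot> u" "\<phi> v = func_calc A u H \<otimes> v"
    and \<psi>: "\<psi> u = c' \<odot> u" "\<psi> v = func_calc A u H' \<otimes> v"
    and c: "cmod c = 1" and H: "continuous_on circle H" "continuous_on circle H'"
  shows "\<phi> (\<psi> u) = (c * c') \<odot> u" "\<phi> (\<psi> v) = func_calc A u (\<lambda>\<zeta>. H' (c * \<zeta>) * H \<zeta>) \<otimes> v"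
proof -
  note hom = star_homD[OF \<phi>(1)]
  note [simp] = func_calc_closed[OF unitary_u]
  show "\<phi> (\<psi> u) = (c * c') \<odot> u" by (simp add: \<psi> \<phi>(2) hom smult_smult mult.commute)
  have cont: "continuous_on circle (\<lambda>\<zeta>. H' (c * \<zeta>))"
    by (rule continuous_on_compose2[OF H(2)]) (auto simp: norm_mult c intro!: continuous_intros)
  have "\<phi> (func_calc A u H') = func_calc A u (\<lambda>\<zeta>. H' (c * \<zeta>))"
    using star_hom_func_calc[OF cstar_algebra_axioms cstar_algebra_axioms \<phi>(1) unitary_u H(2)]
      func_calc_rotate[OF unitary_u H(2) c] by (simp add: \<phi>(2))
  then have "\<phi> (\<psi> v) = func_calc A u (\<lambda>\<zeta>. H' (c * \<zeta>)) \<otimes> (func_calc A u H \<otimes> v)"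
    using H by (simp add: \<psi> \<phi>(3) hom)
  then show "\<phi> (\<psi> v) = func_calc A u (\<lambda>\<zeta>. H' (c * \<zeta>) * H \<zeta>) \<otimes> v"
    using H cont by (simp add: func_calc_mult[OF unitary_u] m_assoc)
qed

text \<open>The map $u \mapsto cu$, $v \mapsto H(u)v$ is inverted by the map of the same kind with
  parameters $\bar c$ and $\overline{H(\bar c \,\cdot\,)}$.\<close>

lemma ex_skew_auto:
  assumes c: "cmod c = 1" and H: "continuous_on circle H" "\<And>\<zeta>. \<zeta> \<in> circle \<Longrightarrow> cmod (H \<zeta>) = 1"
  shows "\<exists>\<alpha>\<in>star_auto A. \<alpha> u = c \<odot> u \<and> \<alpha> v = func_calc A u H \<otimes> v"
proof -
  define H' where "H' = (\<lambda>\<zeta>. cnj (H (cnj c * \<zeta>)))"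
  have c': "cmod (cnj c) = 1" "cnj c * c = 1" "c * cnj c = 1"
    using c complex_norm_square[of c] by (simp_all add: mult.commute)
  have H': "continuous_on circle H'" "\<And>\<zeta>. \<zeta> \<in> circle \<Longrightarrow> cmod (H' \<zeta>) = 1"
    unfolding H'_def using H(2) c
    by (auto simp: norm_mult intro!: continuous_intros continuous_on_compose2[OF H(1)])
  obtain \<phi> where \<phi>: "\<phi> \<in> star_hom A A" "\<phi> u = c \<odot> u" "\<phi> v = func_calc A u H \<otimes> v"
    using ex_rotation_hom[OF rotation rotation_pair_skew[OF c H]] by blast
  obtain \<psi> where \<psi>: "\<psi> \<in> star_hom A A" "\<psi> u = cnj c \<odot> u" "\<psi> v = func_calc A u H' \<otimes> v"
    using ex_rotation_hom[OF rotation rotation_pair_skew[OF c'(1) H']] by blast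
  have one: "func_calc A u K \<otimes> v = v" if "\<And>\<zeta>. \<zeta> \<in> circle \<Longrightarrow> K \<zeta> = 1" for K
    using func_calc_cong[of K "\<lambda>_. 1" u] that by (simp add: func_calc_one[OF unitary_u])
  have norm_one: "cnj (H \<zeta>) * H \<zeta> = 1" if "\<zeta> \<in> circle" for \<zeta>
    using H(2)[OF that] complex_norm_square[of "H \<zeta>"] by (simp add: mult.commute)
  \<comment> \<open>The rotation by c undoes the rotation by its conjugate inside \<open>H'\<close>,
    leaving the conjugate of H times H.\<close>
  have "H' (c * \<zeta>) * H \<zeta> = 1" if "\<zeta> \<in> circle" for \<zeta>
    using norm_one[OF that] by (simp add: H'_def c' flip: mult.assoc)
  then have "\<phi> (\<psi> u) = u" "\<phi> (\<psi> v) = v"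
    using skew_comp[OF \<phi> \<psi>(2,3) c H(1) H'(1)] one[of "\<lambda>\<zeta>. H' (c * \<zeta>) * H \<zeta>"] by (simp_all add: c')
  then have \<phi>\<psi>: "\<phi> (\<psi> x) = x" if "x \<in> carrier A" for x
    using star_hom_eqI[OF cstar_algebra_axioms cstar_algebra_axioms
        star_hom_comp[OF \<psi>(1) \<phi>(1)] star_hom_id generates_uv _ that] by auto
  have "H (cnj c * \<zeta>) * H' \<zeta> = 1" if "\<zeta> \<in> circle" for \<zeta>
    using norm_one[of "cnj c * \<zeta>"] that c by (simp add: H'_def norm_mult mult.commute)
  then have "\<psi> (\<phi> u) = u" "\<psi> (\<phi> v) = v"
    using skew_comp[OF \<psi> \<phi>(2,3) c'(1) H'(1) H(1)] one[of "\<lambda>\<zeta>. H (cnj c * \<zeta>) * H' \<zeta>"]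
    by (simp_all add: c')
  then have \<psi>\<phi>: "\<psi> (\<phi> x) = x" if "x \<in> carrier A" for x
    using star_hom_eqI[OF cstar_algebra_axioms cstar_algebra_axioms
        star_hom_comp[OF \<phi>(1) \<psi>(1)] star_hom_id generates_uv _ that] by auto
  \<comment> \<open>\<open>star_auto\<close> asks for an extensional map, while
    \<open>\<phi>\<close> is controlled on the carrier only.\<close>
  define \<alpha> where "\<alpha> = restrict \<phi> (carrier A)"
  have \<alpha>: "\<alpha> x = \<phi> x" if "x \<in> carrier A" for x using that by (simp add: \<alpha>_def)
  have "\<alpha> \<in> star_hom A A"
    by (rule star_homI) (simp_all add: \<alpha> star_homD[OF \<phi>(1)])
  moreover have "bij_betw \<alpha> (carrier A) (carrier A)"
    by (rule bij_betw_byWitness[where f' = \<psi>])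
      (auto simp: \<alpha> \<phi>\<psi> \<psi>\<phi> star_homD(1)[OF \<phi>(1)] star_homD(1)[OF \<psi>(1)])
  moreover have "\<alpha> \<in> extensional (carrier A)" by (simp add: \<alpha>_def)
  ultimately have "\<alpha> \<in> star_auto A" by (simp add: star_auto_def Bij_def)
  then show ?thesis using \<phi>(2,3) by (intro bexI[of _ \<alpha>]) (simp_all add: \<alpha>)
qed

lemma star_auto_ex1:
  assumes "\<exists>\<alpha>\<in>star_auto A. \<alpha> u = x \<and> \<alpha> v = y"
  shows "\<exists>!\<alpha>. \<alpha> \<in> star_auto A \<and> \<alpha> u = x \<and> \<alpha> v = y"
proof (rule ex_ex1I)
  show "\<exists>\<alpha>. \<alpha> \<in> star_auto A \<and> \<alpha> u = x \<and> \<alpha> v = y" using assms by blast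
  fix \<alpha> \<beta> assume "\<alpha> \<in> star_auto A \<and> \<alpha> u = x \<and> \<alpha> v = y" "\<beta> \<in> star_auto A \<and> \<beta> u = x \<and> \<beta> v = y"
  then show "\<alpha> = \<beta>" by (intro star_auto_eqI[OF cstar_algebra_axioms generates_uv]) auto
qed

lemma cmod_e2pi [simp]: "cmod (e2pi t) = 1"
  by (simp add: norm_exp_eq_Re)

lemma continuous_on_skew_function:
  fixes f :: "complex \<Rightarrow> real"
  assumes "continuous_on circle f"
  shows "continuous_on circle (\<lambda>\<zeta>. e2pi (f \<zeta>) * \<zeta> powi d)"
  using assms by (intro continuous_intros) auto

text \<open>The product of exp(2 pi i f(u)) and u^d is one unimodular function of u, so the definite
  description is met by exactly one automorphism, of the kind already constructed.\<close>

lemma rotation_auto: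
  assumes f: "continuous_on circle f"
  shows "rotation_auto A u v \<gamma> d f \<in> star_auto A"
    "rotation_auto A u v \<gamma> d f u = e2pi \<gamma> \<odot> u"
    "rotation_auto A u v \<gamma> d f v = func_calc A u (\<lambda>\<zeta>. e2pi (f \<zeta>) * \<zeta> powi d) \<otimes> v"
proof -
  let ?H = "\<lambda>\<zeta>. e2pi (f \<zeta>) * \<zeta> powi d"
  have ef: "continuous_on circle (\<lambda>\<zeta>. e2pi (f \<zeta>))" using f by (intro continuous_intros)
  have eq: "func_calc A u (\<lambda>\<zeta>. e2pi (f \<zeta>)) \<otimes> (u [^] d) = func_calc A u ?H"
    using func_calc_mult[OF unitary_u ef continuous_on_power_int_circle]
    by (simp add: func_calc_power_int[OF unitary_u])
  have "\<exists>\<alpha>\<in>star_auto A. \<alpha> u = e2pi \<gamma> \<odot> u \<and> \<alpha> v = func_calc A u ?H \<otimes> v"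
    by (rule ex_skew_auto[OF cmod_e2pi continuous_on_skew_function[OF f]])
      (simp add: norm_mult norm_power_int del: of_real_mult)
  then have "\<exists>!\<alpha>. \<alpha> \<in> star_auto A \<and> \<alpha> u = e2pi \<gamma> \<odot> u \<and>
      \<alpha> v = func_calc A u (\<lambda>\<zeta>. e2pi (f \<zeta>)) \<otimes> (u [^] d) \<otimes> v"
    unfolding eq by (rule star_auto_ex1)
  from theI'[OF this] show "rotation_auto A u v \<gamma> d f \<in> star_auto A"
    "rotation_auto A u v \<gamma> d f u = e2pi \<gamma> \<odot> u"
    "rotation_auto A u v \<gamma> d f v = func_calc A u ?H \<otimes> v"
    unfolding rotation_auto_def eq by blast+
qed

lemma ex1_rotate_u:
  assumes "cmod c = 1"
  shows "\<exists>!\<beta>. \<beta> \<in> star_auto A \<and> \<beta> u = c \<odot> u \<and> \<beta> v = v"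
proof -
  have "\<exists>\<beta>\<in>star_auto A. \<beta> u = c \<odot> u \<and> \<beta> v = func_calc A u (\<lambda>_. 1) \<otimes> v"
    by (rule ex_skew_auto[OF assms]) simp_all
  then show ?thesis by (intro star_auto_ex1) (simp add: func_calc_one[OF unitary_u])
qed

text \<open>In this intertwining form the inverse of \<open>\<beta>\<close> does not occur: both
  sides are composites of homomorphisms with known values at u and v, where equality is checked.
  Crossed products need it in the same form.\<close>

lemma rotation_auto_conjugate:
  assumes d: "d \<noteq> 0" and f: "continuous_on circle f"
    and g: "\<And>\<zeta>. \<zeta> \<in> circle \<Longrightarrow> g \<zeta> = f (e2pi (r / of_int d) * \<zeta>) + r"
    and \<beta>: "\<beta> \<in> star_auto A" "\<beta> u = e2pi (r / of_int d) \<odot> u" "\<beta> v = v"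
    and x: "x \<in> carrier A"
  shows "rotation_auto A u v \<gamma> d g (\<beta> x) = \<beta> (rotation_auto A u v \<gamma> d f x)"
proof -
  define b where "b = e2pi (r / of_int d)"
  have b: "cmod b = 1" unfolding b_def by (rule cmod_e2pi)
  have \<beta>u: "\<beta> u = b \<odot> u" and \<beta>v: "\<beta> v = func_calc A u (\<lambda>_. 1) \<otimes> v"
    using \<beta> by (simp_all add: b_def func_calc_one[OF unitary_u])
  \<comment> \<open>The angle r/d is chosen for this: its d-th multiple is exactly the shift r,
    which requires d to be nonzero.\<close>
  have bd: "b powi d = e2pi r"
    using d by (simp add: b_def exp_power_int)
  have "continuous_on circle (\<lambda>\<zeta>. f (b * \<zeta>) + r)"
    using b by (intro continuous_intros continuous_on_compose2[OF f]) (auto simp: norm_mult)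
  then have gc: "continuous_on circle g"
    by (rule continuous_on_eq) (simp add: g b_def)
  let ?Hf = "\<lambda>\<zeta>. e2pi (f \<zeta>) * \<zeta> powi d" and ?Hg = "\<lambda>\<zeta>. e2pi (g \<zeta>) * \<zeta> powi d"
  let ?\<alpha>f = "rotation_auto A u v \<gamma> d f" and ?\<alpha>g = "rotation_auto A u v \<gamma> d g"
  note Hf = continuous_on_skew_function[OF f, of d] and Hg = continuous_on_skew_function[OF gc, of d]
  note \<alpha>f = rotation_auto[OF f, of \<gamma> d] and \<alpha>g = rotation_auto[OF gc, of \<gamma> d]
  have H: "?Hf (b * \<zeta>) = ?Hg \<zeta>" if "\<zeta> \<in> circle" for \<zeta>
  proof -
    have "e2pi (g \<zeta>) = e2pi (f (b * \<zeta>)) * e2pi r"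
      using g[OF that] by (simp add: b_def distrib_left exp_add)
    then show ?thesis by (simp add: power_int_mult_distrib bd)
  qed
  have "?\<alpha>g (\<beta> u) = \<beta> (?\<alpha>f u)"
    using skew_comp(1)[OF star_autoD(1)[OF \<alpha>g(1)] \<alpha>g(2,3) \<beta>u \<beta>v cmod_e2pi Hg continuous_on_const]
      skew_comp(1)[OF star_autoD(1)[OF \<beta>(1)] \<beta>u \<beta>v \<alpha>f(2,3) b continuous_on_const Hf]
    by (simp add: mult.commute)
  \<comment> \<open>The two sides have the shape that \<open>skew_comp\<close> delivers for the two
    orders of composition; the factor 1 is the function belonging to \<open>\<beta>\<close>.\<close>
  moreover have "func_calc A u (\<lambda>\<zeta>. 1 * ?Hg \<zeta>) = func_calc A u (\<lambda>\<zeta>. ?Hf (b * \<zeta>) * 1)"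
    by (rule func_calc_cong) (simp only: H mult_1_left mult_1_right)
  then have "?\<alpha>g (\<beta> v) = \<beta> (?\<alpha>f v)"
    using skew_comp(2)[OF star_autoD(1)[OF \<alpha>g(1)] \<alpha>g(2,3) \<beta>u \<beta>v cmod_e2pi Hg continuous_on_const]
      skew_comp(2)[OF star_autoD(1)[OF \<beta>(1)] \<beta>u \<beta>v \<alpha>f(2,3) b continuous_on_const Hf]
    by (simp only:)
  ultimately show ?thesis
    using star_hom_eqI[OF cstar_algebra_axioms cstar_algebra_axioms
        star_hom_comp[OF star_autoD(1)[OF \<beta>(1)] star_autoD(1)[OF \<alpha>g(1)]]
        star_hom_comp[OF star_autoD(1)[OF \<alpha>f(1)] star_autoD(1)[OF \<beta>(1)]] generates_uv _ x] by blast
qed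

end

section \<open>Crossed products by conjugate automorphisms\<close>

text \<open>Universality reaches a generated target of any type: the generators of \<open>D\<close>
  are x and images of elements of \<open>A\<close>, so its carrier injects into
  \<open>nat \<Rightarrow> 'a\<close>, and the transported copy is a legitimate test
  algebra.\<close>

lemma crossed_product_hom:
  fixes A :: "'a cstar" and C :: "'c cstar" and D :: "'d cstar"
  assumes "cstar_algebra A" and C: "crossed_product A \<alpha> C \<iota> w" and "cstar_algebra D"
    and cov: "covariant_pair A \<alpha> D \<phi> x" and gen: "generates D (insert x (\<phi> ` carrier A))"
  shows "\<exists>\<psi>\<in>star_hom C D. (\<forall>a\<in>carrier A. \<psi> (\<iota> a) = \<phi> a) \<and> \<psi> w = x"
proof -
  interpret A: cstar_algebra A by fact
  interpret D: cstar_algebra D by fact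
  have \<phi>: "\<phi> \<in> star_hom A D" and x: "unitary D x"
    and cov': "\<And>a. a \<in> carrier A \<Longrightarrow> x \<otimes>\<^bsub>D\<^esub> \<phi> a \<otimes>\<^bsub>D\<^esub> star D x = \<phi> (\<alpha> a)"
    using cov by (auto simp: covariant_pair_def)
  have xC [simp]: "x \<in> carrier D" by (rule unitaryD[OF x])
  note hom = star_homD[OF \<phi>]
  have "\<exists>J :: 'd \<Rightarrow> nat \<Rightarrow> 'a. inj_on J (carrier D)"
  proof (cases "\<one>\<^bsub>A\<^esub> = \<zero>\<^bsub>A\<^esub>")
    \<comment> \<open>If \<open>A\<close> is the zero algebra, so is \<open>D\<close>, and any map
      is injective on its only element. The case is split off because the coding below needs zero
      and unit to differ.\<close>
    case True
    have "\<phi> \<zero>\<^bsub>A\<^esub> = \<zero>\<^bsub>D\<^esub>" using hom(5)[of "\<zero>\<^bsub>A\<^esub>" 0] hom(1)[of "\<zero>\<^bsub>A\<^esub>"] by simp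
    then have "\<one>\<^bsub>D\<^esub> = \<zero>\<^bsub>D\<^esub>" using hom(4) True by simp
    then have "y = \<zero>\<^bsub>D\<^esub>" if "y \<in> carrier D" for y using D.r_one[OF that] D.r_null[OF that] by simp
    then have "inj_on (\<lambda>_. undefined) (carrier D)" by (metis inj_onI)
    then show ?thesis by blast
  next
    case False
    \<comment> \<open>Position 0 separates x from the other generators by zero against unit; the
      remaining positions hold a preimage under \<open>\<phi>\<close>, which determines the
      generator.\<close>
    define j where "j = (\<lambda>y (n::nat). if y = x then \<zero>\<^bsub>A\<^esub> else
      if n = 0 then \<one>\<^bsub>A\<^esub> else inv_into (carrier A) \<phi> y)"
    have "inj_on j (insert x (\<phi> ` carrier A))"
    proof (rule inj_onI)
      fix y z assume yz: "y \<in> insert x (\<phi> ` carrier A)" "z \<in> insert x (\<phi> ` carrier A)" "j y = j z"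
      show "y = z"
      proof (cases "y = x \<or> z = x")
        case True
        then show ?thesis using fun_cong[OF yz(3), of 0] False by (auto simp: j_def split: if_splits)
      next
        case F: False
        then have "inv_into (carrier A) \<phi> y = inv_into (carrier A) \<phi> z"
          using fun_cong[OF yz(3), of 1] by (simp add: j_def)
        then show ?thesis using F yz(1,2) by (meson inv_into_injective insertE)
      qed
    qed
    \<comment> \<open>Distances are stored in \<open>'a\<close> as multiples of the unit, whose norm
      is nonzero in this case.\<close>
    moreover have "inj (\<lambda>t::real. complex_of_real t \<odot>\<^bsub>A\<^esub> \<one>\<^bsub>A\<^esub>)"
    proof (rule injI)
      fix s t :: real assume eq: "complex_of_real s \<odot>\<^bsub>A\<^esub> \<one>\<^bsub>A\<^esub> = complex_of_real t \<odot>\<^bsub>A\<^esub> \<one>\<^bsub>A\<^esub>"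
      have "(complex_of_real s - complex_of_real t) \<odot>\<^bsub>A\<^esub> \<one>\<^bsub>A\<^esub> = \<zero>\<^bsub>A\<^esub>"
        using A.smult_add_left[of "\<one>\<^bsub>A\<^esub>" "complex_of_real s" "- complex_of_real t"]
          A.smult_add_left[of "\<one>\<^bsub>A\<^esub>" "complex_of_real t" "- complex_of_real t"] eq by simp
      then have "cmod (complex_of_real s - complex_of_real t) * nrm A \<one>\<^bsub>A\<^esub> = 0"
        using A.nrm_smult[of "\<one>\<^bsub>A\<^esub>" "complex_of_real s - complex_of_real t"] by simp
      moreover have "nrm A \<one>\<^bsub>A\<^esub> \<noteq> 0" using False by (simp add: A.nrm_eq_zero_iff)
      ultimately show "s = t" by simp
    qed
    ultimately show ?thesis using D.ex_inj_on_generated[OF gen] by blast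
  qed
  then obtain J :: "'d \<Rightarrow> nat \<Rightarrow> 'a" where J: "inj_on J (carrier D)" by blast
  define B where "B = transport_cstar J D"
  define K where "K = inv_into (carrier D) J"
  have B: "cstar_algebra B" and JB: "J \<in> star_hom D B" and KB: "K \<in> star_hom B D"
    using D.transport_cstar[OF J] by (simp_all add: B_def K_def)
  have KJ: "K (J a) = a" if "a \<in> carrier D" for a using that J by (simp add: K_def)
  note homJ = star_homD[OF JB]
  have "J x \<otimes>\<^bsub>B\<^esub> J (\<phi> a) \<otimes>\<^bsub>B\<^esub> star B (J x) = J (\<phi> (\<alpha> a))" if "a \<in> carrier A" for a
    using that by (simp add: hom homJ flip: cov')
  then have "covariant_pair A \<alpha> B (\<lambda>a. J (\<phi> a)) (J x)"
    unfolding covariant_pair_def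
    using star_hom_comp[OF \<phi> JB] star_hom_unitary[OF D.cstar_algebra_axioms JB x] by blast
  then obtain \<psi> where "\<psi> \<in> star_hom C B" "\<And>a. a \<in> carrier A \<Longrightarrow> \<psi> (\<iota> a) = J (\<phi> a)" "\<psi> w = J x"
    using C B unfolding crossed_product_def by blast
  then show ?thesis
    using star_hom_comp[OF _ KB] by (intro bexI[of _ "\<lambda>c. K (\<psi> c)"]) (simp_all add: KJ hom)
qed

text \<open>Precomposing \<open>\<kappa>\<close> with \<open>\<beta>\<close> gives a covariant pair
  for \<open>\<alpha>\<close>, because z implements \<open>\<alpha>'\<close> and
  \<open>\<beta>\<close> intertwines the two maps. As \<open>\<beta>\<close> is onto, the image of
  \<open>A\<close> is unchanged and still generates \<open>D\<close> together with z. The inverse of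
  \<open>\<beta>\<close> works in the other direction, and both composites fix the
  generators.\<close>

lemma crossed_product_conjugate:
  assumes A: "cstar_algebra A" and \<beta>: "\<beta> \<in> star_auto A"
    and \<alpha>: "\<And>a. a \<in> carrier A \<Longrightarrow> \<alpha> a \<in> carrier A"
    and conj: "\<And>a. a \<in> carrier A \<Longrightarrow> \<alpha>' (\<beta> a) = \<beta> (\<alpha> a)"
    and C: "crossed_product A \<alpha> C \<iota> w" and D: "crossed_product A \<alpha>' D \<kappa> z"
  shows "star_isomorphic C D"
proof -
  define \<beta>' where "\<beta>' = inv_into (carrier A) \<beta>"
  have \<beta>'_hom: "\<beta>' \<in> star_hom A A"
    unfolding \<beta>'_def by (rule star_hom_inv_into[OF A star_autoD(1,2)[OF \<beta>]])
  have \<beta>\<beta>': "\<beta> (\<beta>' a) = a" "\<beta>' (\<beta> a) = a" if "a \<in> carrier A" for a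
    using star_autoD(2)[OF \<beta>] that
    by (auto simp: \<beta>'_def bij_betw_def f_inv_into_f inv_into_f_f)
  note closed = star_homD(1)[OF star_autoD(1)[OF \<beta>]] star_homD(1)[OF \<beta>'_hom]
  have \<beta>_image: "\<beta> ` carrier A = carrier A" "\<beta>' ` carrier A = carrier A"
    using closed \<beta>\<beta>' by (auto simp: image_iff) metis+
  have Calg: "cstar_algebra C" and Ccov: "covariant_pair A \<alpha> C \<iota> w"
    and Cgen: "generates C (insert w (\<iota> ` carrier A))" using C by (simp_all add: crossed_product_def)
  have Dalg: "cstar_algebra D" and Dcov: "covariant_pair A \<alpha>' D \<kappa> z"
    and Dgen: "generates D (insert z (\<kappa> ` carrier A))" using D by (simp_all add: crossed_product_def)
  have "(\<lambda>a. \<kappa> (\<beta> a)) \<in> star_hom A D" "(\<lambda>a. \<iota> (\<beta>' a)) \<in> star_hom A C"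
    using Dcov Ccov star_hom_comp[OF star_autoD(1)[OF \<beta>]] star_hom_comp[OF \<beta>'_hom]
    unfolding covariant_pair_def by blast+
  note homs = this
  have "covariant_pair A \<alpha> D (\<lambda>a. \<kappa> (\<beta> a)) z"
    using Dcov homs(1) closed by (simp add: covariant_pair_def flip: conj)
  moreover have "(\<lambda>a. \<kappa> (\<beta> a)) ` carrier A = \<kappa> ` carrier A"
    using \<beta>_image by (metis image_image)
  ultimately obtain \<psi> where \<psi>: "\<psi> \<in> star_hom C D" "\<And>a. a \<in> carrier A \<Longrightarrow> \<psi> (\<iota> a) = \<kappa> (\<beta> a)" "\<psi> w = z"
    using crossed_product_hom[OF A C Dalg] Dgen by (metis (no_types, lifting))
  have conj': "\<beta>' (\<alpha>' a) = \<alpha> (\<beta>' a)" if "a \<in> carrier A" for a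
    using conj[of "\<beta>' a"] \<beta>\<beta>' closed \<alpha> that by simp
  have "covariant_pair A \<alpha>' C (\<lambda>a. \<iota> (\<beta>' a)) w"
    using Ccov homs(2) closed by (simp add: covariant_pair_def conj')
  moreover have "(\<lambda>a. \<iota> (\<beta>' a)) ` carrier A = \<iota> ` carrier A"
    using \<beta>_image by (metis image_image)
  ultimately obtain \<psi>' where \<psi>': "\<psi>' \<in> star_hom D C" "\<And>a. a \<in> carrier A \<Longrightarrow> \<psi>' (\<kappa> a) = \<iota> (\<beta>' a)" "\<psi>' z = w"
    using crossed_product_hom[OF A D Calg] Cgen by (metis (no_types, lifting))
  have "\<psi>' (\<psi> y) = y" if "y \<in> carrier C" for y
    by (rule star_hom_eqI[OF Calg Calg star_hom_comp[OF \<psi>(1) \<psi>'(1)] star_hom_id Cgen _ that])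
      (auto simp: \<psi> \<psi>' closed \<beta>\<beta>')
  moreover have "\<psi> (\<psi>' y) = y" if "y \<in> carrier D" for y
    by (rule star_hom_eqI[OF Dalg Dalg star_hom_comp[OF \<psi>'(1) \<psi>(1)] star_hom_id Dgen _ that])
      (auto simp: \<psi> \<psi>' closed \<beta>\<beta>')
  ultimately have "bij_betw \<psi> (carrier C) (carrier D)"
    using star_homD(1)[OF \<psi>(1)] star_homD(1)[OF \<psi>'(1)]
    by (intro bij_betw_byWitness[where f' = \<psi>']) auto
  then show ?thesis using \<psi>(1) by (auto simp: star_isomorphic_def)
qed

theorem lemma1p5:
  fixes \<theta> \<gamma> r :: real and d :: int and f g :: "complex \<Rightarrow> real"
    and A :: "'a cstar" and u v :: 'a
  assumes A: "rotation_algebra \<theta> A u v"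
    and d: "d \<noteq> 0"
    and f: "continuous_on circle f"
    and g: "\<And>\<zeta>. \<zeta> \<in> circle \<Longrightarrow> g \<zeta> = f (e2pi (r / of_int d) * \<zeta>) + r"
  shows "(\<exists>!\<beta>. \<beta> \<in> star_auto A \<and> \<beta> u = e2pi (r / of_int d) \<odot>\<^bsub>A\<^esub> u \<and> \<beta> v = v) \<and>
    (\<forall>\<beta>. \<beta> \<in> star_auto A \<and> \<beta> u = e2pi (r / of_int d) \<odot>\<^bsub>A\<^esub> u \<and> \<beta> v = v \<longrightarrow>
       compose (carrier A) \<beta>
         (compose (carrier A) (rotation_auto A u v \<gamma> d f) (inv_into (carrier A) \<beta>))
       = rotation_auto A u v \<gamma> d g) \<and>
    (\<forall>(C :: 'c cstar) \<iota> w (D :: 'd cstar) \<kappa> z.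
       crossed_product A (rotation_auto A u v \<gamma> d f) C \<iota> w \<and>
       crossed_product A (rotation_auto A u v \<gamma> d g) D \<kappa> z \<longrightarrow>
       star_isomorphic C D)"
proof -
  interpret rotation_cstar_algebra \<theta> A u v by standard (rule A)
  let ?b = "e2pi (r / of_int d)"
  have "continuous_on circle (\<lambda>\<zeta>. f (?b * \<zeta>) + r)"
    by (intro continuous_intros continuous_on_compose2[OF f])
      (auto simp: norm_mult simp del: of_real_divide of_real_of_int_eq)
  then have gc: "continuous_on circle g"
    by (rule continuous_on_eq) (simp add: g)
  let ?\<alpha>f = "rotation_auto A u v \<gamma> d f" and ?\<alpha>g = "rotation_auto A u v \<gamma> d g"
  note \<alpha>f = rotation_auto(1)[OF f, of \<gamma> d] and \<alpha>g = rotation_auto(1)[OF gc, of \<gamma> d]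
  note conj = rotation_auto_conjugate[OF d f g]
  have ex1: "\<exists>!\<beta>. \<beta> \<in> star_auto A \<and> \<beta> u = ?b \<odot>\<^bsub>A\<^esub> u \<and> \<beta> v = v"
    by (rule ex1_rotate_u[OF cmod_e2pi])
  have "compose (carrier A) \<beta> (compose (carrier A) ?\<alpha>f (inv_into (carrier A) \<beta>)) = ?\<alpha>g"
    if \<beta>: "\<beta> \<in> star_auto A" "\<beta> u = ?b \<odot>\<^bsub>A\<^esub> u" "\<beta> v = v" for \<beta>
  proof (rule extensionalityI[OF compose_extensional star_autoD(3)[OF \<alpha>g]])
    fix x assume x: "x \<in> carrier A"
    \<comment> \<open>Writing x as \<open>\<beta>\<close> of its preimage turns the claim at x into
      the intertwining relation at that preimage.\<close>
    let ?y = "inv_into (carrier A) \<beta> x"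
    have y: "?y \<in> carrier A" "\<beta> ?y = x"
      using star_autoD(2)[OF \<beta>(1)] x by (auto simp: bij_betw_def inv_into_into f_inv_into_f)
    show "compose (carrier A) \<beta> (compose (carrier A) ?\<alpha>f (inv_into (carrier A) \<beta>)) x = ?\<alpha>g x"
      using conj[OF _ \<beta> y(1), of \<gamma>] x y(2) by (simp add: compose_eq)
  qed
  moreover have "star_isomorphic C D"
    if "crossed_product A ?\<alpha>f C \<iota> w" "crossed_product A ?\<alpha>g D \<kappa> z"
    for C :: "'c cstar" and D :: "'d cstar" and \<iota> w \<kappa> z
  proof -
    obtain \<beta> where \<beta>: "\<beta> \<in> star_auto A" "\<beta> u = ?b \<odot>\<^bsub>A\<^esub> u" "\<beta> v = v" using ex1 by blast
    show ?thesis
      using star_homD(1)[OF star_autoD(1)[OF \<alpha>f]] conj[OF _ \<beta>] that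
      by (intro crossed_product_conjugate[OF cstar_algebra_axioms \<beta>(1)])
  qed
  ultimately show ?thesis using ex1 by blast
qed

end
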